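(* Let $X$ be a locally compact separable metric space and let $P$ be a polyhedral $H$-group. Then the relation of being homotopic is a Borel and idealistic equivalence relation on the Polish space $\mathrm{Map}(X,P)$ of all continuous functions from $X$ to $P$.
   Context: $\mathrm{Map}(X,P)$ carries the compact-open topology. Two maps $f,g:X\to P$ are homotopic if there is a continuous $h:X\times[0,1]\to P$ with $h(-,0)=f$, $h(-,1)=g$. A polyhedron is a space homeomorphic to the topological realization of a countable, locally finite simplicial complex. A polyhedral $H$-group is a pointed polyhedron $(P,\ast)$ with a basepoint-preserving continuous multiplication $\mu:P\times P\to P$ such that, up to basepoint-preserving homotopy, $\mu$ is associative, $\ast$ is a two-sided identity, and there is a basepoint-preserving map $z:P\to P$ that is a two-sided inverse; i.e. it is a group object in the homotopy category of pointed locally compact Polish spaces. An equivalence relation $E$ on a Polish space $Y$ is Borel if it is a Borel subset of $Y\times Y$. It is idealistic if there are an assignment $[y]\mapsto\mathcal F_{[y]}$ of a $\sigma$-filter of subsets of $[y]$ to each $E$-class $[y]$ and a Borel function $\zeta:Y\to Y$ with $\zeta(y)\,E\,y$ for all $y$, such that for every Borel $A\subseteq Y\times Y$ the set $\{y\in Y:\{y'\in[y]:(\zeta(y),y')\in A\}\in\mathcal F_{[y]}\}$ is Borel. A $\sigma$-filter of subsets of $C$ is a nonempty collection of nonempty subsets of $C$ closed under supersets and countable intersections. *)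

theory Defs
  imports "HOL-Analysis.Analysis"
begin

section \<open>Mapping spaces\<close>

text \<open>Points of \<open>Map(X,Y)\<close> are continuous maps normalised to be \<^const>\<open>undefined\<close> off
  \<^term>\<open>topspace X\<close>, so that two of them are equal iff they agree on \<^term>\<open>topspace X\<close>.\<close>

definition map_set :: "'a topology \<Rightarrow> 'b topology \<Rightarrow> ('a \<Rightarrow> 'b) set" where
  "map_set X Y = {f \<in> extensional (topspace X). continuous_map X Y f}"

definition compact_open_topology :: "'a topology \<Rightarrow> 'b topology \<Rightarrow> ('a \<Rightarrow> 'b) topology" where
  "compact_open_topology X Y =
     topology_generated_by {{f \<in> map_set X Y. f ` K \<subseteq> U} | K U. compactin X K \<and> openin Y U}"

lemma topspace_compact_open_topology: "topspace (compact_open_topology X Y) = map_set X Y"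
proof -
  have "map_set X Y \<in> {{f \<in> map_set X Y. f ` K \<subseteq> U} | K U. compactin X K \<and> openin Y U}"
    by (rule CollectI, rule exI[of _ "{}"], rule exI[of _ "topspace Y"]) auto
  then show ?thesis
    unfolding compact_open_topology_def topology_generated_by_topspace by blast
qed

definition homotopy_relation :: "'a topology \<Rightarrow> 'b topology \<Rightarrow> (('a \<Rightarrow> 'b) \<times> ('a \<Rightarrow> 'b)) set" where
  "homotopy_relation X Y =
     {(f, g). f \<in> map_set X Y \<and> g \<in> map_set X Y \<and> homotopic_with (\<lambda>_. True) X Y f g}"

section \<open>Polyhedra\<close>

definition abstract_complex :: "'v set set \<Rightarrow> bool" where
  "abstract_complex K \<longleftrightarrow>
     (\<forall>\<sigma>\<in>K. finite \<sigma> \<and> \<sigma> \<noteq> {} \<and> (\<forall>\<tau>. \<tau> \<subseteq> \<sigma> \<and> \<tau> \<noteq> {} \<longrightarrow> \<tau> \<in> K))"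

definition locally_finite_complex :: "'v set set \<Rightarrow> bool" where
  "locally_finite_complex K \<longleftrightarrow> (\<forall>v. finite {\<sigma> \<in> K. v \<in> \<sigma>})"

text \<open>The closed simplex spanned by \<open>\<sigma>\<close>, in barycentric coordinates.\<close>

definition simplex_points :: "'v set \<Rightarrow> ('v \<Rightarrow> real) set" where
  "simplex_points \<sigma> = {t. (\<forall>v. 0 \<le> t v) \<and> (\<forall>v. v \<notin> \<sigma> \<longrightarrow> t v = 0) \<and> (\<Sum>v\<in>\<sigma>. t v) = 1}"

text \<open>The realization carries the weak topology: a set is open iff its trace on each closed simplex
  is open there, a closed simplex having its usual (coordinatewise) topology.\<close>

definition realization :: "'v set set \<Rightarrow> ('v \<Rightarrow> real) topology" where
  "realization K = topology (\<lambda>U. U \<subseteq> (\<Union>\<sigma>\<in>K. simplex_points \<sigma>) \<and>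
     (\<forall>\<sigma>\<in>K. openin (subtopology (powertop_real UNIV) (simplex_points \<sigma>)) (U \<inter> simplex_points \<sigma>)))"

lemma openin_realization:
  "openin (realization K) U \<longleftrightarrow> U \<subseteq> (\<Union>\<sigma>\<in>K. simplex_points \<sigma>) \<and>
     (\<forall>\<sigma>\<in>K. openin (subtopology (powertop_real UNIV) (simplex_points \<sigma>)) (U \<inter> simplex_points \<sigma>))"
proof -
  let ?T = "\<lambda>\<sigma>. subtopology (powertop_real UNIV) (simplex_points \<sigma>)"
  have "istopology (\<lambda>U. U \<subseteq> (\<Union>\<sigma>\<in>K. simplex_points \<sigma>) \<and>
     (\<forall>\<sigma>\<in>K. openin (?T \<sigma>) (U \<inter> simplex_points \<sigma>)))" (is "istopology ?P")
    unfolding istopology_def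
  proof (rule conjI, intro allI impI)
    fix S T assume S: "?P S" and T: "?P T"
    have "openin (?T \<sigma>) (S \<inter> T \<inter> simplex_points \<sigma>)" if "\<sigma> \<in> K" for \<sigma>
    proof -
      have "openin (?T \<sigma>) ((S \<inter> simplex_points \<sigma>) \<inter> (T \<inter> simplex_points \<sigma>))"
        by (rule openin_Int) (use S T that in blast)+
      moreover have "(S \<inter> simplex_points \<sigma>) \<inter> (T \<inter> simplex_points \<sigma>) = S \<inter> T \<inter> simplex_points \<sigma>"
        by blast
      ultimately show ?thesis by simp
    qed
    with S show "?P (S \<inter> T)" by blast
  next
    show "\<forall>\<K>. (\<forall>S\<in>\<K>. ?P S) \<longrightarrow> ?P (\<Union>\<K>)"
    proof (intro allI impI)
      fix \<K> assume \<K>: "\<forall>S\<in>\<K>. ?P S"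
      have "openin (?T \<sigma>) (\<Union>\<K> \<inter> simplex_points \<sigma>)" if "\<sigma> \<in> K" for \<sigma>
      proof -
        have "openin (?T \<sigma>) (\<Union>S\<in>\<K>. S \<inter> simplex_points \<sigma>)"
          using \<K> that by (intro openin_Union) auto
        moreover have "(\<Union>S\<in>\<K>. S \<inter> simplex_points \<sigma>) = \<Union>\<K> \<inter> simplex_points \<sigma>"
          by blast
        ultimately show ?thesis by simp
      qed
      moreover have "\<Union>\<K> \<subseteq> (\<Union>\<sigma>\<in>K. simplex_points \<sigma>)" using \<K> by blast
      ultimately show "?P (\<Union>\<K>)" by blast
    qed
  qed
  then show ?thesis by (simp add: realization_def)
qed

text \<open>Every vertex of a complex spans a simplex, so a countable complex has countably many vertices
  and, up to relabelling, these are natural numbers.\<close>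

definition polyhedron :: "'p topology \<Rightarrow> bool" where
  "polyhedron P \<longleftrightarrow>
     (\<exists>K :: nat set set. abstract_complex K \<and> countable K \<and> locally_finite_complex K \<and>
        P homeomorphic_space realization K)"

definition polyhedral_H_group :: "'p topology \<Rightarrow> 'p \<Rightarrow> ('p \<times> 'p \<Rightarrow> 'p) \<Rightarrow> bool" where
  "polyhedral_H_group P e \<mu> \<longleftrightarrow>
     polyhedron P \<and> e \<in> topspace P \<and>
     continuous_map (prod_topology P P) P \<mu> \<and> \<mu> (e, e) = e \<and>
     homotopic_with (\<lambda>h. h (e, e, e) = e) (prod_topology P (prod_topology P P)) P
       (\<lambda>(a, b, c). \<mu> (\<mu> (a, b), c)) (\<lambda>(a, b, c). \<mu> (a, \<mu> (b, c))) \<and>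
     homotopic_with (\<lambda>h. h e = e) P P (\<lambda>a. \<mu> (e, a)) (\<lambda>a. a) \<and>
     homotopic_with (\<lambda>h. h e = e) P P (\<lambda>a. \<mu> (a, e)) (\<lambda>a. a) \<and>
     (\<exists>z. continuous_map P P z \<and> z e = e \<and>
        homotopic_with (\<lambda>h. h e = e) P P (\<lambda>a. \<mu> (z a, a)) (\<lambda>_. e) \<and>
        homotopic_with (\<lambda>h. h e = e) P P (\<lambda>a. \<mu> (a, z a)) (\<lambda>_. e))"

section \<open>Borel and idealistic equivalence relations\<close>

definition Polish_space :: "'a topology \<Rightarrow> bool" where
  "Polish_space Y \<longleftrightarrow> separable_space Y \<and> completely_metrizable_space Y"

definition borel_of :: "'a topology \<Rightarrow> 'a measure" where
  "borel_of Y = sigma (topspace Y) {U. openin Y U}"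

definition Borel_relation :: "'a topology \<Rightarrow> ('a \<times> 'a) set \<Rightarrow> bool" where
  "Borel_relation Y E \<longleftrightarrow> E \<in> sets (borel_of (prod_topology Y Y))"

definition sigma_filter_on :: "'a set \<Rightarrow> 'a set set \<Rightarrow> bool" where
  "sigma_filter_on C F \<longleftrightarrow>
     F \<noteq> {} \<and> (\<forall>S\<in>F. S \<noteq> {} \<and> S \<subseteq> C) \<and>
     (\<forall>S T. S \<in> F \<and> S \<subseteq> T \<and> T \<subseteq> C \<longrightarrow> T \<in> F) \<and>
     (\<forall>A :: nat \<Rightarrow> 'a set. range A \<subseteq> F \<longrightarrow> (\<Inter>n. A n) \<in> F)"

text \<open>Here \<^term>\<open>E `` {y}\<close> is the class of \<open>y\<close> and \<^term>\<open>topspace Y // E\<close> the set of all classes.\<close>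

definition idealistic :: "'a topology \<Rightarrow> ('a \<times> 'a) set \<Rightarrow> bool" where
  "idealistic Y E \<longleftrightarrow>
     (\<exists>(F :: 'a set \<Rightarrow> 'a set set) \<zeta>.
        (\<forall>C \<in> topspace Y // E. sigma_filter_on C (F C)) \<and>
        \<zeta> \<in> measurable (borel_of Y) (borel_of Y) \<and>
        (\<forall>y \<in> topspace Y. (\<zeta> y, y) \<in> E) \<and>
        (\<forall>A \<in> sets (borel_of (prod_topology Y Y)).
           {y \<in> topspace Y. {y' \<in> E `` {y}. (\<zeta> y, y') \<in> A} \<in> F (E `` {y})} \<in> sets (borel_of Y)))"

end

theory Submission
  imports Defs
begin

text \<open>Write \<open>L\<close> for the Polish space \<open>Map([0,1] \<times> X, P)\<close> of homotopies and \<open>s, e\<close> for the two end maps from \<open>L\<close> to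
  \<open>Y = Map(X, P)\<close>. Polyhedra are locally equiconnected: two points sharing a vertex are joined by
  a canonical path, constant if they agree. With cutoff functions on \<open>X\<close> this yields that \<open>s\<close> is open
  and that, for homotopies \<open>h1, h2\<close> close to each other with the same start, any homotopy ending where \<open>h1\<close> ends can be
  changed slightly (uniformly on compact sets) so as to end where \<open>h2\<close> ends.

  Everything else follows formally from these two properties. On each homotopy class the
  topology coinduced by \<open>e\<close> from the homotopies with a fixed start does not depend on that start, is Baire and second countable, and its
  comeager sets form the required \<open>\<sigma>\<close>-filters, with \<open>\<zeta>\<close> the identity; openness of \<open>s\<close> makes the category quantifier
  preserve Borel sets. Each class is Borel by a variant of the Lusin--Souslin theorem. Finally the H-group
  structure exhibits the homotopy relation as a continuous preimage of the class of the constant map.\<close>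

section \<open>Separation by Borel sets\<close>

text \<open>Two obstacles shape the proof. A class is the image of a closed set of homotopies under
  the end map, hence analytic, but this map is far from injective, so Lusin--Souslin does not apply
  as it stands. \<open>transport\<close> substitutes for injectivity: exchanging the ends of two
  close homotopies with equal start costs little for every homotopy, whatever its own start, so that
  approximating sequences of ends lift to Cauchy sequences of homotopies. This uniformity in the
  start is also what lets a filter depend on the class alone and not on a representative. The other
  obstacle is that closeness in a mapping space is only felt on a compact subset of
  \<open>X\<close>. Elsewhere two close homotopies may be far apart, and no canonical path in
  \<open>P\<close> joins their values. On the other hand no size control is required there: an
  exchange of ends may take the long way through the common start, and a change of start may slow
  time down to a standstill. The cutoff functions interpolate between the two regimes.\<close>

lemma sets_borel_of: "sets (borel_of Y) = sigma_sets (topspace Y) {U. openin Y U}"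
  unfolding borel_of_def by (rule sets_measure_of) (auto dest: openin_subset)

lemma space_borel_of [simp]: "space (borel_of Y) = topspace Y"
  unfolding borel_of_def by (rule space_measure_of) (auto dest: openin_subset)

lemma openin_borel_of: "openin Y U \<Longrightarrow> U \<in> sets (borel_of Y)"
  by (simp add: sets_borel_of sigma_sets.Basic)

lemma closedin_borel_of: "closedin Y U \<Longrightarrow> U \<in> sets (borel_of Y)"
  by (metis closedin_def double_diff openin_borel_of order_refl sets.compl_sets space_borel_of)

lemma continuous_map_measurable_borel_of:
  assumes "continuous_map X Y f"
  shows "f \<in> measurable (borel_of X) (borel_of Y)"
  unfolding borel_of_def[of Y]
proof (rule measurable_measure_of)
  show "{U. openin Y U} \<subseteq> Pow (topspace Y)"
    by (auto dest: openin_subset)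
  show "f \<in> space (borel_of X) \<rightarrow> topspace Y"
    using assms by (simp add: continuous_map_def)
  show "f -` U \<inter> space (borel_of X) \<in> sets (borel_of X)" if "U \<in> {U. openin Y U}" for U
    using openin_borel_of[OF openin_continuous_map_preimage[OF assms, of U]] that
    by (simp add: vimage_def Int_def conj_commute)
qed

definition borel_separated :: "'a topology \<Rightarrow> 'a set \<Rightarrow> 'a set \<Rightarrow> bool" where
  "borel_separated Y A B \<longleftrightarrow> (\<exists>S \<in> sets (borel_of Y). A \<subseteq> S \<and> B \<subseteq> topspace Y - S)"

lemma borel_separated_sym: "borel_separated Y A B \<Longrightarrow> borel_separated Y B A"
  unfolding borel_separated_def
  by (metis Diff_Diff_Int Int_absorb1 sets.compl_sets sets.sets_into_space space_borel_of)

lemma borel_separated_UN: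
  assumes "countable I" and "B \<subseteq> topspace Y" and "\<And>i. i \<in> I \<Longrightarrow> borel_separated Y (A i) B"
  shows "borel_separated Y (\<Union>i\<in>I. A i) B"
proof -
  have "\<forall>i. \<exists>S. i \<in> I \<longrightarrow> S \<in> sets (borel_of Y) \<and> A i \<subseteq> S \<and> B \<subseteq> topspace Y - S"
    using assms(3) unfolding borel_separated_def by blast
  then obtain S where S: "\<And>i. i \<in> I \<Longrightarrow> S i \<in> sets (borel_of Y) \<and> A i \<subseteq> S i \<and> B \<subseteq> topspace Y - S i"
    by metis
  then have "(\<Union>i\<in>I. S i) \<in> sets (borel_of Y)"
    using assms(1) by (intro sets.countable_UN') auto
  with S assms(2) show ?thesis
    unfolding borel_separated_def by (intro bexI[of _ "\<Union>i\<in>I. S i"]) blast+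
qed

section \<open>Separable metric spaces and Lusin separation\<close>

context Metric_space
begin

lemma separable_dense_seq:
  assumes "separable_space mtopology"
  obtains C where "countable C" "C \<subseteq> M" "\<And>x r. x \<in> M \<Longrightarrow> r > 0 \<Longrightarrow> \<exists>q\<in>C. d q x < r"
proof -
  obtain C where C: "countable C" "C \<subseteq> M" "mtopology closure_of C = M"
    using assms unfolding separable_space_def by auto
  have "\<exists>q\<in>C. d q x < r" if "x \<in> M" "r > 0" for x r
  proof -
    have "x \<in> mtopology closure_of C"
      using C that by simp
    then have "\<exists>q\<in>C. q \<in> mball x r"
      using that by (auto simp: metric_closure_of)
    then show ?thesis
      by (auto simp: commute)
  qed
  with C that show ?thesis
    by blast
qed

text \<open>Balls of radius \<open>1 / Suc n\<close> about a countable dense set suffice; a radius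
  below \<open>r/2\<close> ensures that a ball containing \<open>x\<close> stays inside
  \<open>mball x r\<close>. The members are closed sets so that the separation theorem below applies
  to them, while their interiors form a base.\<close>

lemma separable_imp_countable_mcballs:
  assumes "separable_space mtopology"
  obtains \<W> where "countable \<W>" "\<And>W. W \<in> \<W> \<Longrightarrow> closedin mtopology W"
    "\<And>x r. x \<in> M \<Longrightarrow> r > 0 \<Longrightarrow> \<exists>W\<in>\<W>. x \<in> mtopology interior_of W \<and> W \<subseteq> mball x r"
proof -
  obtain C where C: "countable C" "C \<subseteq> M" "\<And>x r. x \<in> M \<Longrightarrow> r > 0 \<Longrightarrow> \<exists>q\<in>C. d q x < r"
    using separable_dense_seq[OF assms] by metis
  define \<W> where "\<W> = (\<lambda>(q,n::nat). mcball q (1 / Suc n)) ` (C \<times> UNIV)"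
  have "countable \<W>"
    using C(1) unfolding \<W>_def by (intro countable_image countable_SIGMA) auto
  moreover have "closedin mtopology W" if "W \<in> \<W>" for W
    using that unfolding \<W>_def by auto
  moreover have "\<exists>W\<in>\<W>. x \<in> mtopology interior_of W \<and> W \<subseteq> mball x r" if "x \<in> M" "r > 0" for x r
  proof -
    obtain n where n: "1 / Suc n < r/2"
      using nat_approx_posE[of "r/2"] \<open>r > 0\<close> by (metis half_gt_zero)
    obtain q where q: "q \<in> C" "d q x < 1 / Suc n"
      using C(3)[OF \<open>x \<in> M\<close>, of "1 / Suc n"] by auto
    then have qM: "q \<in> M"
      using C by auto
    have "mcball q (1 / Suc n) \<subseteq> mball x r"
    proof
      fix y assume "y \<in> mcball q (1 / Suc n)"
      then have "y \<in> M" "d q y \<le> 1 / Suc n"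
        by auto
      moreover have "d x y \<le> d x q + d q y"
        using calculation qM that triangle by auto
      ultimately show "y \<in> mball x r"
        using q n that commute[of q x] by auto
    qed
    moreover have "x \<in> mtopology interior_of (mcball q (1 / Suc n))"
      using q qM that by (auto simp: interior_of_def mball_subset_mcball intro!: exI[of _ "mball q (1 / Suc n)"])
    ultimately show ?thesis
      using q(1) unfolding \<W>_def by (auto intro!: bexI[of _ "(q,n)"])
  qed
  ultimately show ?thesis
    using that by blast
qed

lemma separable_imp_second_countable:
  assumes "separable_space mtopology"
  shows "second_countable mtopology"
proof -
  obtain \<W> where W: "countable \<W>" 
    "\<And>x r. x \<in> M \<Longrightarrow> r > 0 \<Longrightarrow> \<exists>W\<in>\<W>. x \<in> mtopology interior_of W \<and> W \<subseteq> mball x r"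
    using separable_imp_countable_mcballs[OF assms] by metis
  show ?thesis
    unfolding second_countable_def
  proof (intro exI[of _ "(\<lambda>W. mtopology interior_of W) ` \<W>"] conjI allI impI)
    show "countable ((\<lambda>W. mtopology interior_of W) ` \<W>)"
      using W by simp
    fix U x assume "openin mtopology U \<and> x \<in> U"
    then obtain r where "r > 0" "mball x r \<subseteq> U" "x \<in> M"
      unfolding openin_mtopology by blast
    then obtain W' where "W' \<in> \<W>" "x \<in> mtopology interior_of W'" "W' \<subseteq> mball x r"
      using W(2) by metis
    then show "\<exists>V\<in>(\<lambda>W. mtopology interior_of W) ` \<W>. x \<in> V \<and> V \<subseteq> U"
      using interior_of_subset[of mtopology W'] \<open>mball x r \<subseteq> U\<close> by blast
  qed auto
qed

lemma MCauchy_geometric: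
  assumes "\<And>n. \<sigma> n \<in> M" and "\<And>n. d (\<sigma> n) (\<sigma> (Suc n)) < (1/2) ^ n"
  shows "MCauchy \<sigma>"
proof -
  \<comment> \<open>The exact remainder of the geometric series makes the induction on
    \<open>k\<close> close; the bare bound \<open>2 * (1/2) ^ n\<close> would not.\<close>
  have *: "d (\<sigma> n) (\<sigma> (n + k)) \<le> 2 * (1/2) ^ n - 2 * (1/2) ^ (n + k)" for n k
  proof (induction k)
    case (Suc k)
    have "d (\<sigma> n) (\<sigma> (n + Suc k)) \<le> d (\<sigma> n) (\<sigma> (n + k)) + d (\<sigma> (n + k)) (\<sigma> (Suc (n + k)))"
      using assms(1) triangle by simp
    also have "\<dots> \<le> 2 * (1/2) ^ n - 2 * (1/2) ^ (n + k) + (1/2) ^ (n + k)"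
      using Suc assms(2)[of "n + k"] by linarith
    finally show ?case
      by simp
  qed (use assms in simp)
  have "d (\<sigma> n) (\<sigma> m) \<le> 2 * (1/2) ^ n" if "n \<le> m" for n m
    using *[of n "m - n"] that by (simp add: zero_le_power) (smt (verit) zero_le_power divide_nonneg_nonneg)
  then have **: "d (\<sigma> n) (\<sigma> m) \<le> 2 * (1/2) ^ N" if "N \<le> n" "N \<le> m" for N n m
    using that commute[of "\<sigma> n" "\<sigma> m"] linear[of n m] power_decreasing[of N n "1/2::real"]
      power_decreasing[of N m "1/2::real"]
    by (smt (verit, best) divide_le_eq_1_pos zero_less_divide_1_iff)
  show ?thesis
    unfolding MCauchy_def
  proof (intro conjI allI impI)
    fix \<epsilon>::real assume "\<epsilon> > 0"
    then obtain N where "(1/2) ^ N < \<epsilon>/2"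
      using real_arch_pow_inv[of "\<epsilon>/2" "1/2"] by auto
    then show "\<exists>N. \<forall>n n'. N \<le> n \<longrightarrow> N \<le> n' \<longrightarrow> d (\<sigma> n) (\<sigma> n') < \<epsilon>"
      using ** by (intro exI[of _ N]) (smt (verit) field_sum_of_halves)
  qed (use assms in auto)
qed

text \<open>By contraposition: countably many balls of radius \<open>r\<close> cover
  \<open>A\<close>, and separation from \<open>B\<close> survives countable unions.\<close>

lemma not_borel_separated_refine:
  assumes C: "countable C" "C \<subseteq> M" "\<And>x r. x \<in> M \<Longrightarrow> r > 0 \<Longrightarrow> \<exists>q\<in>C. d q x < r"
    and f: "f ` M \<subseteq> topspace Y" and AB: "A \<subseteq> M" "B \<subseteq> M"
    and "\<not> borel_separated Y (f ` A) (f ` B)" and "r > 0"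
  shows "\<exists>q\<in>M. \<not> borel_separated Y (f ` (A \<inter> mcball q r)) (f ` B)"
proof (rule ccontr)
  assume "\<not> ?thesis"
  then have "borel_separated Y (\<Union>q\<in>C. f ` (A \<inter> mcball q r)) (f ` B)"
    using C f AB by (intro borel_separated_UN) blast+
  moreover have "(\<Union>q\<in>C. f ` (A \<inter> mcball q r)) = f ` A"
    using C(3)[OF _ \<open>r > 0\<close>] AB C(2) by (fastforce simp: less_imp_le)
  ultimately show False
    using assms by simp
qed

text \<open>Lusin's separation theorem.\<close>

theorem disjoint_images_borel_separated:
  assumes "mcomplete" and sep: "separable_space mtopology" and Y: "Hausdorff_space Y"
    and f: "continuous_map mtopology Y f" and A: "closedin mtopology A" and B: "closedin mtopology B"
    and disj: "f ` A \<inter> f ` B = {}"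
  shows "borel_separated Y (f ` A) (f ` B)"
proof (rule ccontr)
  assume neg: "\<not> ?thesis"
  have fM: "f ` M \<subseteq> topspace Y"
    using f by (auto simp: continuous_map_def)
  obtain C where C: "countable C" "C \<subseteq> M" "\<And>x r. x \<in> M \<Longrightarrow> r > 0 \<Longrightarrow> \<exists>q\<in>C. d q x < r"
    using separable_dense_seq[OF sep] by metis
  let ?good = "\<lambda>(A', B'). closedin mtopology A' \<and> closedin mtopology B' \<and> \<not> borel_separated Y (f ` A') (f ` B')"
  \<comment> \<open>Both members of a non-separated pair can be shrunk to any size without becoming
    separated. The nested pairs then close in on points \<open>a\<close> and \<open>b\<close>, whose
    images are distinct by \<open>disj\<close>; disjoint open sets around these images separate all
    sufficiently small members, a contradiction.\<close>
  have step: "\<exists>p'. ?good p' \<and> fst p' \<subseteq> fst p \<and> snd p' \<subseteq> snd p \<and>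
      (\<exists>q. fst p' \<subseteq> mcball q ((1/2)^n)) \<and> (\<exists>q. snd p' \<subseteq> mcball q ((1/2)^n))"
    if p: "?good p" for p and n :: nat
  proof -
    obtain A' B' where [simp]: "p = (A', B')"
      by fastforce
    have M: "A' \<subseteq> M" "B' \<subseteq> M"
      using p closedin_subset by fastforce+
    obtain q where q: "\<not> borel_separated Y (f ` (A' \<inter> mcball q ((1/2)^n))) (f ` B')"
      using not_borel_separated_refine[OF C fM M, of "(1/2)^n"] p by auto
    then have "\<not> borel_separated Y (f ` B') (f ` (A' \<inter> mcball q ((1/2)^n)))"
      using borel_separated_sym by blast
    then obtain q' where "\<not> borel_separated Y (f ` (B' \<inter> mcball q' ((1/2)^n))) (f ` (A' \<inter> mcball q ((1/2)^n)))"
      using not_borel_separated_refine[OF C fM M(2), of "A' \<inter> mcball q ((1/2)^n)" "(1/2)^n"] M by auto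
    then have "\<not> borel_separated Y (f ` (A' \<inter> mcball q ((1/2)^n))) (f ` (B' \<inter> mcball q' ((1/2)^n)))"
      using borel_separated_sym by blast
    then show ?thesis
      using p by (intro exI[of _ "(A' \<inter> mcball q ((1/2)^n), B' \<inter> mcball q' ((1/2)^n))"]) (auto intro: closedin_Int)
  qed
  obtain F where F: "\<And>n. ?good (F n)" "\<And>n. fst (F (Suc n)) \<subseteq> fst (F n) \<and> snd (F (Suc n)) \<subseteq> snd (F n) \<and>
      (\<exists>q. fst (F (Suc n)) \<subseteq> mcball q ((1/2)^n)) \<and> (\<exists>q. snd (F (Suc n)) \<subseteq> mcball q ((1/2)^n))" and F0: "F 0 = (A, B)"
    using dependent_nat_choice[of "\<lambda>n p. ?good p \<and> (n = 0 \<longrightarrow> p = (A,B))"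
        "\<lambda>n p p'. fst p' \<subseteq> fst p \<and> snd p' \<subseteq> snd p \<and>
      (\<exists>q. fst p' \<subseteq> mcball q ((1/2)^n)) \<and> (\<exists>q. snd p' \<subseteq> mcball q ((1/2)^n))"] step neg A B
    by (smt (verit) nat.discI split_conv)
  have small: "\<exists>n q. fst (F n) \<subseteq> mcball q r" "\<exists>n q. snd (F n) \<subseteq> mcball q r" if "r > 0" for r
  proof -
    obtain n where n: "(1/2)^n < r"
      using \<open>r > 0\<close> real_arch_pow_inv[of r "1/2"] by auto
    show "\<exists>n q. fst (F n) \<subseteq> mcball q r" "\<exists>n q. snd (F n) \<subseteq> mcball q r"
      using F(2)[of n] n mcball_subset_concentric[of "(1/2)^n" r] by (meson less_imp_le subset_trans)+
  qed
  \<comment> \<open>A pair with an empty member is separated, so all nested sets are nonempty, as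
    Cantor's intersection property requires.\<close>
  have sepI: "borel_separated Y (f ` A') (f ` B')" if "A' = {} \<or> B' = {}" "A' \<subseteq> M" "B' \<subseteq> M" for A' B'
  proof (cases "A' = {}")
    case True
    then show ?thesis
      using that fM unfolding borel_separated_def by (intro bexI[of _ "{}"]) auto
  next
    case False
    then show ?thesis
      using that fM unfolding borel_separated_def by (intro bexI[of _ "topspace Y"]) (auto intro: openin_borel_of)
  qed
  have ne: "fst (F n) \<noteq> {}" "snd (F n) \<noteq> {}" for n
    using F(1)[of n] sepI[of "fst (F n)" "snd (F n)"] closedin_subset by fastforce+
  have dec: "decseq (\<lambda>n. fst (F n))" "decseq (\<lambda>n. snd (F n))"
    by (rule decseq_SucI; use F(2) in blast)+
  have clo: "closedin mtopology (fst (F n))" "closedin mtopology (snd (F n))" for n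
    using F(1)[of n] by (auto simp: case_prod_unfold)
  obtain a where a: "a \<in> M" "\<Inter>(range (\<lambda>n. fst (F n))) = {a}"
    using \<open>mcomplete\<close> ne dec clo small unfolding mcomplete_nest_sing by meson
  obtain b where b: "b \<in> M" "\<Inter>(range (\<lambda>n. snd (F n))) = {b}"
    using \<open>mcomplete\<close> ne dec clo small unfolding mcomplete_nest_sing by meson
  have "a \<in> A" "b \<in> B"
    using a b F0 by (metis INT_E fst_conv insertI1 UNIV_I, metis INT_E snd_conv insertI1 UNIV_I)
  then have "f a \<noteq> f b" "f a \<in> topspace Y" "f b \<in> topspace Y"
    using disj a b fM by blast+
  then obtain U V where UV: "openin Y U" "openin Y V" "f a \<in> U" "f b \<in> V" "disjnt U V"
    using Y unfolding Hausdorff_space_def by metis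
  obtain r1 where r1: "r1 > 0" "\<And>x. x \<in> M \<Longrightarrow> d a x < r1 \<Longrightarrow> f x \<in> U"
    using f a UV unfolding continuous_map_from_metric by metis
  obtain r2 where r2: "r2 > 0" "\<And>x. x \<in> M \<Longrightarrow> d b x < r2 \<Longrightarrow> f x \<in> V"
    using f b UV unfolding continuous_map_from_metric by metis
  \<comment> \<open>Two points of a ball of radius \<open>r/3\<close> are at distance at most
    \<open>2 * r / 3\<close>, which is less than \<open>r\<close>.\<close>
  have sub: "S \<subseteq> mball x r" if "S \<subseteq> mcball q (r/3)" "x \<in> S" "r > 0" for S x q r
  proof
    fix y assume "y \<in> S"
    with that have "q \<in> M" "x \<in> M" "y \<in> M" "d q x \<le> r/3" "d q y \<le> r/3"
      by auto
    then show "y \<in> mball x r"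
      using triangle[of x q y] commute[of x q] that by auto
  qed
  obtain n where n: "fst (F n) \<subseteq> mball a r1"
    using small(1)[of "r1/3"] sub[of _ _ r1 a] r1 a(2) by (metis INT_E UNIV_I divide_pos_pos insertI1 zero_less_numeral)
  obtain m where m: "snd (F m) \<subseteq> mball b r2"
    using small(2)[of "r2/3"] sub[of _ _ r2 b] r2 b(2) by (metis INT_E UNIV_I divide_pos_pos insertI1 zero_less_numeral)
  let ?k = "max n m"
  have "fst (F ?k) \<subseteq> mball a r1" "snd (F ?k) \<subseteq> mball b r2"
    using n m decseqD[OF dec(1), of n ?k] decseqD[OF dec(2), of m ?k] by auto
  then have "f ` fst (F ?k) \<subseteq> U" "f ` snd (F ?k) \<subseteq> V"
    using r1 r2 by auto
  then have "borel_separated Y (f ` fst (F ?k)) (f ` snd (F ?k))"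
    unfolding borel_separated_def using UV openin_subset[OF UV(2)] 
    by (intro bexI[of _ U]) (auto simp: openin_borel_of disjnt_def)
  then show False
    using F(1)[of ?k] by (auto simp: case_prod_unfold)
qed

end

section \<open>Equivalence relations given by paths\<close>

text \<open>Abstract setting: \<open>L\<close> plays the role of the space of homotopies, \<open>s\<close> and \<open>e\<close> send a homotopy to
  its two ends. The axiom \<open>transport\<close> says that the ends of two nearby homotopies
  with the same start can be exchanged at the end of any other homotopy at arbitrarily small cost.\<close>

locale path_structure = L: Metric_space L dL + N: Metric_space N dN
  for L :: "'l set" and dL and N :: "'n set" and dN +
  fixes s e :: "'l \<Rightarrow> 'n"
  assumes complete: "L.mcomplete" and separable: "separable_space L.mtopology"
    and cont_s: "continuous_map L.mtopology N.mtopology s"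
    and cont_e: "continuous_map L.mtopology N.mtopology e"
    and open_s: "open_map L.mtopology N.mtopology s"
    and transport: "\<And>h0 \<epsilon>. h0 \<in> L \<Longrightarrow> \<epsilon> > 0 \<Longrightarrow>
      \<exists>r>0. \<forall>h1 \<in> L.mball h0 r. \<forall>h2 \<in> L.mball h0 r. s h1 = s h2 \<longrightarrow>
        (\<forall>h\<in>L. e h = e h1 \<longrightarrow> (\<exists>h'\<in>L. s h' = s h \<and> e h' = e h2 \<and> dL h h' < \<epsilon>))"
    and equiv: "equiv N ((\<lambda>h. (s h, e h)) ` L)"
begin

definition E where "E = (\<lambda>h. (s h, e h)) ` L"

definition reach :: "'l set \<Rightarrow> 'n \<Rightarrow> 'n set" where
  "reach U y = e ` {h \<in> U. h \<in> L \<and> s h = y}"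

lemma s_in [simp]: "h \<in> L \<Longrightarrow> s h \<in> N" and e_in [simp]: "h \<in> L \<Longrightarrow> e h \<in> N"
  using cont_s cont_e by (auto simp: continuous_map_def)

lemma reach_subset: "reach U y \<subseteq> N"
  by (auto simp: reach_def)

lemma reach_mono: "U \<subseteq> V \<Longrightarrow> reach U y \<subseteq> reach V y"
  by (auto simp: reach_def)

lemma class_eq_reach: "E `` {y} = reach L y"
  by (auto simp: reach_def E_def)

lemma equiv_E: "equiv N E"
  using equiv by (simp add: E_def)

text \<open>This replaces Lusin--Souslin: the class is covered by countably many pieces \<open>R W\<close>, which have Borel
  hulls \<open>H W\<close> that meet only if the pieces do. A point lying in hulls of arbitrarily small
  pieces is the end of a limit of homotopies obtained by \<open>transport\<close>.\<close>

theorem class_Borel: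
  assumes y: "y \<in> N"
  shows "E `` {y} \<in> sets (borel_of N.mtopology)"
proof -
  let ?B = "sets (borel_of N.mtopology)"
  obtain \<W> where W: "countable \<W>" "\<And>W. W \<in> \<W> \<Longrightarrow> closedin L.mtopology W"
    "\<And>x r. x \<in> L \<Longrightarrow> r > 0 \<Longrightarrow> \<exists>W\<in>\<W>. x \<in> L.mtopology interior_of W \<and> W \<subseteq> L.mball x r"
    using L.separable_imp_countable_mcballs[OF separable] by metis
  define R where "R W = reach W y" for W
  \<comment> \<open>Smallness has two sides: the distance of ends keeps the closure of a piece near
    each of its points, which later identifies the limit, and the transport cost makes the lifted
    homotopies a Cauchy sequence.\<close>
  define small where "small n W \<longleftrightarrow> (\<forall>h1\<in>W. \<forall>h2\<in>W. dN (e h1) (e h2) < (1/2)^n \<and> (s h1 = s h2 \<longrightarrow>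
        (\<forall>h\<in>L. e h = e h1 \<longrightarrow> (\<exists>h'\<in>L. s h' = s h \<and> e h' = e h2 \<and> dL h h' < (1/2)^n))))" for n :: nat and W
  have cover: "\<exists>W\<in>\<W>. h \<in> W \<and> small n W" if h: "h \<in> L" for h n
  proof -
    obtain r where r: "r > 0" "\<forall>h1 \<in> L.mball h r. \<forall>h2 \<in> L.mball h r. s h1 = s h2 \<longrightarrow>
        (\<forall>h\<in>L. e h = e h1 \<longrightarrow> (\<exists>h'\<in>L. s h' = s h \<and> e h' = e h2 \<and> dL h h' < (1/2)^n))"
      using transport[OF h, of "(1/2)^n"] by auto
    have "(1/2)^n/2 > (0::real)"
      by simp
    then obtain r' where r': "r' > 0" "\<And>x. x \<in> L \<Longrightarrow> dL h x < r' \<Longrightarrow> dN (e h) (e x) < (1/2)^n/2"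
      using cont_e h unfolding L.metric_continuous_map[OF N.Metric_space_axioms] by metis
    obtain W where WW: "W \<in> \<W>" "h \<in> L.mtopology interior_of W" "W \<subseteq> L.mball h (min r r')"
      using W(3)[OF h, of "min r r'"] r r' by auto
    have "small n W"
      unfolding small_def
    proof (intro ballI conjI)
      fix h1 h2 assume h12: "h1 \<in> W" "h2 \<in> W"
      then have "h1 \<in> L.mball h (min r r')" "h2 \<in> L.mball h (min r r')"
        using WW by auto
      then have *: "h1 \<in> L" "h2 \<in> L" "dL h h1 < r" "dL h h1 < r'" "dL h h2 < r" "dL h h2 < r'"
        by auto
      then show "dN (e h1) (e h2) < (1/2)^n"
        using r'(2)[of h1] r'(2)[of h2] N.triangle''[of "e h1" "e h" "e h2"] h by simp
      show "s h1 = s h2 \<longrightarrow>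
        (\<forall>h\<in>L. e h = e h1 \<longrightarrow> (\<exists>h'\<in>L. s h' = s h \<and> e h' = e h2 \<and> dL h h' < (1/2)^n))"
        using r(2) * h by auto
    qed
    moreover have "h \<in> W"
      using WW(2) interior_of_subset[of L.mtopology W] by blast
    ultimately show ?thesis
      using WW(1) by blast
  qed
  have sepT: "\<exists>T\<in>?B. R W \<subseteq> T \<and> R W' \<subseteq> N - T" if "W \<in> \<W>" "W' \<in> \<W>" "R W \<inter> R W' = {}" for W W'
  proof -
    have clo: "closedin L.mtopology {h \<in> V. h \<in> L \<and> s h = y}" if V: "V \<in> \<W>" for V
    proof -
      have "closedin N.mtopology {y}"
        using y N.Hausdorff_space_mtopology Hausdorff_imp_t1_space t1_space_closedin_singleton by fastforce
      then have "closedin L.mtopology {h \<in> L. s h \<in> {y}}"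
        using closedin_continuous_map_preimage[OF cont_s] by fastforce
      then have "closedin L.mtopology (V \<inter> {h \<in> L. s h \<in> {y}})"
        using W(2)[OF V] by blast
      moreover have "V \<inter> {h \<in> L. s h \<in> {y}} = {h \<in> V. h \<in> L \<and> s h = y}"
        by auto
      ultimately show ?thesis
        by simp
    qed
    show ?thesis
      using L.disjoint_images_borel_separated[OF complete separable N.Hausdorff_space_mtopology cont_e clo[OF that(1)] clo[OF that(2)]] that(3)
      unfolding borel_separated_def R_def reach_def by simp
  qed
  define T where "T W W' = (SOME T. T \<in> ?B \<and> R W \<subseteq> T \<and> R W' \<subseteq> N - T)" for W W'
  have T: "T W W' \<in> ?B \<and> R W \<subseteq> T W W' \<and> R W' \<subseteq> N - T W W'"
    if "W \<in> \<W>" "W' \<in> \<W>" "R W \<inter> R W' = {}" for W W'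
    unfolding T_def
    using someI_ex[of "\<lambda>T. T \<in> ?B \<and> R W \<subseteq> T \<and> R W' \<subseteq> N - T"] sepT[OF that] by blast
  define D where "D W = {W' \<in> \<W>. R W \<inter> R W' = {}}" for W
  \<comment> \<open>The hull of \<open>W\<close> lies in \<open>T W W'\<close>, whereas the hull of
    \<open>W'\<close> avoids this set; hence hulls of disjoint pieces are disjoint. Intersecting
    with the closure keeps a hull as small as its piece.\<close>
  define H where "H W = (N.mtopology closure_of (R W)) - (\<Union>W'\<in>D W. (N - T W W') \<union> T W' W)" for W
  have H_meas: "H W \<in> ?B" if "W \<in> \<W>" for W
  proof -
    have "countable (D W)"
      using W(1) by (simp add: D_def)
    moreover have "(N - T W W') \<union> T W' W \<in> ?B" if "W' \<in> D W" for W'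
    proof -
      have *: "W' \<in> \<W>" "R W \<inter> R W' = {}" "R W' \<inter> R W = {}"
        using that by (auto simp: D_def)
      have "N - T W W' \<in> ?B" "T W' W \<in> ?B"
        using T[OF \<open>W \<in> \<W>\<close> *(1,2)] T[OF *(1) \<open>W \<in> \<W>\<close> *(3)] sets.compl_sets[of "T W W'" "borel_of N.mtopology"]
        by simp_all
      then show ?thesis
        by blast
    qed
    ultimately show ?thesis
      unfolding H_def by (intro sets.Diff sets.countable_UN') (auto intro: closedin_borel_of)
  qed
  have R_H: "R W \<subseteq> H W" if "W \<in> \<W>" for W
  proof
    fix x assume x: "x \<in> R W"
    then have "x \<in> N.mtopology closure_of (R W)"
      using closure_of_subset[of "R W" N.mtopology] reach_subset by (auto simp: R_def)
    moreover have "x \<in> T W W' \<and> x \<notin> T W' W" if "W' \<in> D W" for W'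
    proof -
      have *: "W' \<in> \<W>" "R W \<inter> R W' = {}" "R W' \<inter> R W = {}"
        using that by (auto simp: D_def)
      show ?thesis
        using T[OF \<open>W \<in> \<W>\<close> *(1,2)] T[OF *(1) \<open>W \<in> \<W>\<close> *(3)] x by blast
    qed
    ultimately show "x \<in> H W"
      by (auto simp: H_def)
  qed
  have H_disj: "R W \<inter> R W' \<noteq> {}" if "x \<in> H W" "x \<in> H W'" "W \<in> \<W>" "W' \<in> \<W>" for x W W'
  proof
    assume "R W \<inter> R W' = {}"
    then have "W' \<in> D W" "W \<in> D W'"
      using that by (auto simp: D_def)
    moreover have "x \<in> N"
      using that(1) closure_of_subset_topspace[of N.mtopology] by (auto simp: H_def)
    ultimately show False
      using that by (auto simp: H_def)
  qed
  have "E `` {y} = (\<Inter>n. \<Union>W\<in>{W\<in>\<W>. small n W}. H W)"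
  proof (intro equalityI subsetI)
    fix x assume "x \<in> E `` {y}"
    then obtain h where h: "h \<in> L" "s h = y" "e h = x"
      by (auto simp: E_def)
    have "\<exists>W\<in>{W\<in>\<W>. small n W}. x \<in> H W" for n
    proof -
      obtain W where "W \<in> \<W>" "h \<in> W" "small n W"
        using cover h by blast
      then show ?thesis
        using h R_H[of W] by (auto simp: R_def reach_def)
    qed
    then show "x \<in> (\<Inter>n. \<Union>W\<in>{W\<in>\<W>. small n W}. H W)"
      by blast
  next
    fix x assume "x \<in> (\<Inter>n. \<Union>W\<in>{W\<in>\<W>. small n W}. H W)"
    then have "\<forall>n. \<exists>W. W \<in> \<W> \<and> small n W \<and> x \<in> H W"
      by auto
    then obtain V where V: "\<And>n. V n \<in> \<W>" "\<And>n. small n (V n)" "\<And>n. x \<in> H (V n)"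
      by metis
    \<comment> \<open>The hulls of \<open>V n\<close> and \<open>V (Suc n)\<close> share
      \<open>x\<close>, so the pieces themselves share some end \<open>c n\<close>, although
      \<open>x\<close> is not yet known to lie in any piece.\<close>
    have "\<forall>n. \<exists>c. c \<in> R (V n) \<inter> R (V (Suc n))"
      using H_disj V by blast
    then obtain c where c: "\<And>n. c n \<in> R (V n)" "\<And>n. c n \<in> R (V (Suc n))"
      by (metis IntE)
    \<comment> \<open>\<open>V (Suc n)\<close> contains homotopies from \<open>y\<close> to
      \<open>c n\<close> and to \<open>c (Suc n)\<close>, so its transport bound pays for the
      passage from \<open>h n\<close> to \<open>h (Suc n)\<close>; hence the exponent
      \<open>Suc n\<close>.\<close>
    have "\<exists>h. \<forall>n. (h n \<in> L \<and> s (h n) = y \<and> e (h n) = c n) \<and> dL (h n) (h (Suc n)) < (1/2)^(Suc n)"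
    proof (rule dependent_nat_choice)
      show "\<exists>h. h \<in> L \<and> s h = y \<and> e h = c 0"
        using c[of 0] by (auto simp: R_def reach_def)
    next
      fix h n assume h: "h \<in> L \<and> s h = y \<and> e h = c n"
      obtain h1 where h1: "h1 \<in> V (Suc n)" "h1 \<in> L" "s h1 = y" "e h1 = c n"
        using c(2)[of n] by (auto simp: R_def reach_def)
      obtain h2 where h2: "h2 \<in> V (Suc n)" "h2 \<in> L" "s h2 = y" "e h2 = c (Suc n)"
        using c(1)[of "Suc n"] by (auto simp: R_def reach_def)
      have "\<exists>h'\<in>L. s h' = s h \<and> e h' = e h2 \<and> dL h h' < (1/2)^(Suc n)"
        using V(2)[of "Suc n"] h h1 h2 unfolding small_def by metis
      then show "\<exists>h'. (h' \<in> L \<and> s h' = y \<and> e h' = c (Suc n)) \<and> dL h h' < (1/2)^(Suc n)"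
        using h h2 by auto
    qed
    then obtain h where h: "\<And>n. h n \<in> L" "\<And>n. s (h n) = y" "\<And>n. e (h n) = c n"
      "\<And>n. dL (h n) (h (Suc n)) < (1/2)^(Suc n)"
      by blast
    have "dL (h n) (h (Suc n)) < (1/2)^n" for n
      using h(4)[of n] by (rule less_le_trans) (simp add: power_le_one)
    then have "L.MCauchy h"
      using L.MCauchy_geometric h by blast
    then obtain k where k: "limitin L.mtopology h k sequentially"
      using complete unfolding L.mcomplete_def by blast
    then have kL: "k \<in> L"
      using L.limitin_mspace by blast
    have "limitin N.mtopology (s \<circ> h) (s k) sequentially" "limitin N.mtopology (e \<circ> h) (e k) sequentially"
      using continuous_map_limit[OF cont_s k] continuous_map_limit[OF cont_e k] .
    moreover have "s \<circ> h = (\<lambda>n. y)" "e \<circ> h = c"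
      using h by auto
    ultimately have sk: "limitin N.mtopology (\<lambda>n. y) (s k) sequentially" and ek: "limitin N.mtopology c (e k) sequentially"
      by auto
    have "s k = y"
      using N.limitin_metric_unique[OF sk, of y] y by (simp add: limitin_const_iff)
    have "x \<in> N"
      using V(3)[of 0] closure_of_subset_topspace[of N.mtopology] by (auto simp: H_def)
    have near: "dN (c n) x \<le> (1/2)^n" for n
    proof -
      have "R (V n) \<subseteq> N.mcball (c n) ((1/2)^n)"
        using V(2)[of n] c(1)[of n] unfolding small_def by (force simp: R_def reach_def less_imp_le)
      then have "N.mtopology closure_of R (V n) \<subseteq> N.mcball (c n) ((1/2)^n)"
        by (simp add: closure_of_minimal)
      then show ?thesis
        using V(3)[of n] by (auto simp: H_def)
    qed
    have "limitin N.mtopology c x sequentially"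
      unfolding N.limit_metric_sequentially
    proof (intro conjI allI impI)
      fix \<epsilon>::real assume "\<epsilon> > 0"
      then obtain n where n: "(1/2)^n < \<epsilon>"
        using real_arch_pow_inv[of \<epsilon> "1/2"] by auto
      have "c m \<in> N \<and> dN (c m) x < \<epsilon>" if "m \<ge> n" for m
      proof -
        have "(1/2)^m \<le> (1/2::real)^n"
          using that by (intro power_decreasing) auto
        with near[of m] n have "dN (c m) x < \<epsilon>"
          by linarith
        moreover have "c m \<in> N"
          using c(1)[of m] reach_subset by (auto simp: R_def)
        ultimately show ?thesis
          by simp
      qed
      then show "\<exists>n. \<forall>m\<ge>n. c m \<in> N \<and> dN (c m) x < \<epsilon>"
        by blast
    qed fact
    then have "e k = x"
      using N.limitin_metric_unique[OF ek] by simp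
    with kL \<open>s k = y\<close> show "x \<in> E `` {y}"
      by (auto simp: E_def)
  qed
  also have "\<dots> \<in> ?B"
  proof -
    have "(\<Union>W\<in>{W\<in>\<W>. small n W}. H W) \<in> ?B" for n
      using W(1) H_meas by (intro sets.countable_UN') auto
    then show ?thesis
      by (intro sets.countable_INT') auto
  qed
  finally show ?thesis .
qed

section \<open>The coinduced topology on the classes and Baire category in it\<close>

definition fine_top :: "'n topology" where
  "fine_top = topology (\<lambda>W. W \<subseteq> N \<and> (\<forall>h\<in>L. e h \<in> W \<longrightarrow> (\<exists>r>0. reach (L.mball h r) (s h) \<subseteq> W)))"

lemma openin_fine:
  "openin fine_top W \<longleftrightarrow> W \<subseteq> N \<and> (\<forall>h\<in>L. e h \<in> W \<longrightarrow> (\<exists>r>0. reach (L.mball h r) (s h) \<subseteq> W))"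
proof -
  have "istopology (\<lambda>W. W \<subseteq> N \<and> (\<forall>h\<in>L. e h \<in> W \<longrightarrow> (\<exists>r>0. reach (L.mball h r) (s h) \<subseteq> W)))" (is "istopology ?P")
    unfolding istopology_def
  proof (intro conjI allI impI)
    fix S T assume S: "?P S" and T: "?P T"
    show "S \<inter> T \<subseteq> N"
      using S by blast
    show "\<forall>h\<in>L. e h \<in> S \<inter> T \<longrightarrow> (\<exists>r>0. reach (L.mball h r) (s h) \<subseteq> S \<inter> T)"
    proof (intro ballI impI)
      fix h assume h: "h \<in> L" "e h \<in> S \<inter> T"
      then obtain r r' where r: "r > 0" "reach (L.mball h r) (s h) \<subseteq> S" "r' > 0" "reach (L.mball h r') (s h) \<subseteq> T"
        using S T by blast
      have "L.mball h (min r r') \<subseteq> L.mball h r" "L.mball h (min r r') \<subseteq> L.mball h r'"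
        by auto
      then have "reach (L.mball h (min r r')) (s h) \<subseteq> S \<inter> T"
        using r reach_mono by blast
      then show "\<exists>r>0. reach (L.mball h r) (s h) \<subseteq> S \<inter> T"
        using r by (intro exI[of _ "min r r'"]) auto
    qed
  next
    fix \<K> assume K: "\<forall>S\<in>\<K>. ?P S"
    then show "\<Union>\<K> \<subseteq> N"
      by blast
    show "\<forall>h\<in>L. e h \<in> \<Union>\<K> \<longrightarrow> (\<exists>r>0. reach (L.mball h r) (s h) \<subseteq> \<Union>\<K>)"
    proof (intro ballI impI)
      fix h assume h: "h \<in> L" "e h \<in> \<Union>\<K>"
      then obtain S where S: "S \<in> \<K>" "e h \<in> S"
        by blast
      then obtain r where "r > 0" "reach (L.mball h r) (s h) \<subseteq> S"
        using K h by blast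
      with S show "\<exists>r>0. reach (L.mball h r) (s h) \<subseteq> \<Union>\<K>"
        by blast
    qed
  qed
  then show ?thesis
    by (simp add: fine_top_def)
qed

lemma topspace_fine [simp]: "topspace fine_top = N"
proof -
  have "openin fine_top N"
    by (auto simp: openin_fine reach_def intro: exI[of _ 1])
  then show ?thesis
    using openin_subset openin_topspace[of fine_top] unfolding openin_fine[of "topspace fine_top"] by auto
qed

text \<open>\<open>transport\<close> is applied with \<open>h1 = g\<close>: the end of any homotopy
  near \<open>g\<close> with the same start is also the end of a slight modification of
  \<open>h\<close>. Since \<open>g\<close> may start anywhere in the class, the end map on each
  fibre of \<open>s\<close> is open into \<open>fine_top\<close>, and the homotopies from a single
  \<open>y\<close> already determine the topology on the class of \<open>y\<close>.\<close>

lemma openin_fine_reach: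
  assumes U: "openin L.mtopology U"
  shows "openin fine_top (reach U y)"
  unfolding openin_fine
proof (intro conjI ballI impI)
  fix g assume g: "g \<in> L" "e g \<in> reach U y"
  then obtain h where h: "h \<in> U" "h \<in> L" "s h = y" "e h = e g"
    by (auto simp: reach_def)
  obtain r where r: "r > 0" "L.mball h r \<subseteq> U"
    using U h unfolding L.openin_mtopology by blast
  obtain \<rho> where \<rho>: "\<rho> > 0" "\<forall>h1 \<in> L.mball g \<rho>. \<forall>h2 \<in> L.mball g \<rho>. s h1 = s h2 \<longrightarrow>
        (\<forall>h\<in>L. e h = e h1 \<longrightarrow> (\<exists>h'\<in>L. s h' = s h \<and> e h' = e h2 \<and> dL h h' < r))"
    using transport[OF g(1) r(1)] by blast
  have "reach (L.mball g \<rho>) (s g) \<subseteq> reach U y"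
  proof
    fix x assume "x \<in> reach (L.mball g \<rho>) (s g)"
    then obtain h2 where h2: "h2 \<in> L.mball g \<rho>" "s h2 = s g" "e h2 = x"
      by (auto simp: reach_def)
    moreover have "g \<in> L.mball g \<rho>"
      using g \<rho> by simp
    ultimately obtain h' where "h' \<in> L" "s h' = s h" "e h' = e h2" "dL h h' < r"
      using \<rho>(2) h by metis
    moreover from this have "h' \<in> U"
      using r h by auto
    ultimately show "x \<in> reach U y"
      using h h2 by (auto simp: reach_def)
  qed
  with \<rho>(1) show "\<exists>r>0. reach (L.mball g r) (s g) \<subseteq> reach U y"
    by blast
qed (rule reach_subset)

lemma const_path:
  assumes "y \<in> N"
  obtains h where "h \<in> L" "s h = y" "e h = y"
proof -
  have "(y, y) \<in> E"
    using equiv_E assms by (meson equivE refl_onD)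
  then show ?thesis
    using that by (auto simp: E_def)
qed

definition fmeager :: "'n set \<Rightarrow> bool" where
  "fmeager S \<longleftrightarrow> (\<exists>\<T>. countable \<T> \<and> (\<forall>T\<in>\<T>. closedin fine_top T \<and> fine_top interior_of T = {}) \<and> S \<subseteq> \<Union>\<T>)"

lemma fmeager_subset: "fmeager S \<Longrightarrow> T \<subseteq> S \<Longrightarrow> fmeager T"
  unfolding fmeager_def by (meson subset_trans)

lemma fmeager_empty [simp]: "fmeager {}"
  unfolding fmeager_def by (intro exI[of _ "{}"]) auto

lemma fmeager_UN:
  assumes "countable I" and "\<And>i. i \<in> I \<Longrightarrow> fmeager (S i)"
  shows "fmeager (\<Union>i\<in>I. S i)"
proof -
  have "\<forall>i\<in>I. \<exists>\<T>. countable \<T> \<and> (\<forall>T\<in>\<T>. closedin fine_top T \<and> fine_top interior_of T = {}) \<and> S i \<subseteq> \<Union>\<T>"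
    using assms(2) unfolding fmeager_def by blast
  then obtain \<T> where T: "\<And>i. i \<in> I \<Longrightarrow> countable (\<T> i) \<and> (\<forall>T\<in>\<T> i. closedin fine_top T \<and> fine_top interior_of T = {}) \<and> S i \<subseteq> \<Union>(\<T> i)"
    by metis
  show ?thesis
    unfolding fmeager_def
  proof (intro exI[of _ "\<Union>i\<in>I. \<T> i"] conjI)
    show "countable (\<Union>i\<in>I. \<T> i)"
      using assms(1) T by (intro countable_UN) simp_all
    show "\<forall>T\<in>\<Union>(\<T> ` I). closedin fine_top T \<and> fine_top interior_of T = {}"
      using T by blast
    show "\<Union>(S ` I) \<subseteq> \<Union>(\<Union>(\<T> ` I))"
    proof (rule UN_least)
      fix i assume i: "i \<in> I"
      then have "\<Union>(\<T> i) \<subseteq> \<Union>(\<Union>(\<T> ` I))"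
        by (intro Union_mono) auto
      with T[OF i] show "S i \<subseteq> \<Union>(\<Union>(\<T> ` I))"
        by (meson subset_trans)
    qed
  qed
qed

lemma fmeager_Un:
  assumes "fmeager S" and "fmeager T"
  shows "fmeager (S \<union> T)"
proof -
  have "fmeager (\<Union>b. if b then S else T)"
    using assms by (intro fmeager_UN) auto
  also have "(\<Union>b. if b then S else T) = S \<union> T"
    by (auto split: if_splits)
  finally show ?thesis .
qed

text \<open>The end map on the fibre of \<open>s\<close> over a point \<open>y\<close> of
  \<open>W\<close> is continuous and open for \<open>fine_top\<close>, so closed sets with empty
  interior pull back to such sets in a closed subspace of \<open>L\<close>, where the Baire category
  theorem holds. A path from \<open>y\<close> to itself, given by reflexivity, shows that the
  preimage of \<open>W\<close> is nonempty.\<close>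

lemma fine_Baire:
  assumes W: "openin fine_top W" and ne: "W \<noteq> {}"
  shows "\<not> fmeager W"
proof
  assume "fmeager W"
  then obtain \<T> where T: "countable \<T>" "\<And>T. T \<in> \<T> \<Longrightarrow> closedin fine_top T \<and> fine_top interior_of T = {}" "W \<subseteq> \<Union>\<T>"
    unfolding fmeager_def by blast
  obtain y where y: "y \<in> W" "y \<in> N"
    using ne W openin_subset by fastforce
  obtain h where h: "h \<in> L" "s h = y" "e h = y"
    using const_path y by blast
  define F where "F = {h \<in> L. s h = y}"
  define X where "X = subtopology L.mtopology F"
  have topX: "topspace X = F"
    by (auto simp: X_def F_def)
  have "closedin N.mtopology {y}"
    using y N.Hausdorff_space_mtopology Hausdorff_imp_t1_space t1_space_closedin_singleton by fastforce
  then have "closedin L.mtopology F"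
    using closedin_continuous_map_preimage[OF cont_s, of "{y}"] by (simp add: F_def)
  then have cm: "completely_metrizable_space X"
    unfolding X_def using L.completely_metrizable_space_mtopology[OF complete] completely_metrizable_space_closedin by blast
  have ball_open: "openin X {g \<in> F. e g \<in> V}" if V: "openin fine_top V" for V
  proof -
    have "openin L.mtopology (\<Union>g\<in>{g \<in> F. e g \<in> V}. \<Union>r\<in>{r. r > 0 \<and> reach (L.mball g r) y \<subseteq> V}. L.mball g r)"
      by (intro openin_Union) auto
    moreover have "{g \<in> F. e g \<in> V} = (\<Union>g\<in>{g \<in> F. e g \<in> V}. \<Union>r\<in>{r. r > 0 \<and> reach (L.mball g r) y \<subseteq> V}. L.mball g r) \<inter> F"
    proof (intro equalityI subsetI)
      fix g assume g: "g \<in> {g \<in> F. e g \<in> V}"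
      then obtain r where r: "r > 0" "reach (L.mball g r) y \<subseteq> V"
        using V unfolding openin_fine F_def by blast
      then have "r \<in> {r. r > 0 \<and> reach (L.mball g r) y \<subseteq> V}" "g \<in> L.mball g r"
        using g by (auto simp: F_def)
      with g show "g \<in> (\<Union>g\<in>{g \<in> F. e g \<in> V}. \<Union>r\<in>{r. r > 0 \<and> reach (L.mball g r) y \<subseteq> V}. L.mball g r) \<inter> F"
        by blast
    next
      fix g assume "g \<in> (\<Union>g\<in>{g \<in> F. e g \<in> V}. \<Union>r\<in>{r. r > 0 \<and> reach (L.mball g r) y \<subseteq> V}. L.mball g r) \<inter> F"
      then obtain g' r where "g \<in> L.mball g' r" "reach (L.mball g' r) y \<subseteq> V" "g \<in> F"
        by blast
      then show "g \<in> {g \<in> F. e g \<in> V}"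
        by (auto simp: F_def reach_def)
    qed
    ultimately show ?thesis
      unfolding X_def openin_subtopology by blast
  qed
  let ?G = "(\<lambda>T. {g \<in> F. e g \<in> T}) ` \<T>"
  have "X interior_of \<Union>?G = {}"
  proof (rule Baire_category_alt)
    fix G assume "G \<in> ?G"
    then obtain T where TT: "T \<in> \<T>" "G = {g \<in> F. e g \<in> T}"
      by blast
    have clT: "openin fine_top (N - T)" "fine_top interior_of T = {}"
      using T(2)[OF TT(1)] by (auto simp: closedin_def)
    have "F - G = {g \<in> F. e g \<in> N - T}"
      by (auto simp: TT(2) F_def)
    then have "closedin X G"
      using ball_open[OF clT(1)] TT(2) by (auto simp: closedin_def topX)
    moreover have "X interior_of G = {}"
    proof (rule ccontr)
      assume "X interior_of G \<noteq> {}"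
      then obtain O' where O': "openin X O'" "O' \<noteq> {}" "O' \<subseteq> G"
        by (metis interior_of_subset openin_interior_of)
      then obtain U where U: "openin L.mtopology U" "O' = U \<inter> F"
        unfolding X_def openin_subtopology by blast
      have "reach U y = e ` O'"
        by (auto simp: reach_def U(2) F_def)
      then have "reach U y \<noteq> {}" "reach U y \<subseteq> T"
        using O' TT by auto
      then show False
        using openin_fine_reach[OF U(1)] clT(2) interior_of_maximal[of "reach U y" T fine_top] by auto
    qed
    ultimately show "closedin X G \<and> X interior_of G = {}"
      by blast
  qed (use T cm in auto)
  moreover have "{g \<in> F. e g \<in> W} \<subseteq> \<Union>?G"
    using T(3) by auto
  ultimately have "{g \<in> F. e g \<in> W} = {}"
    using ball_open[OF W] interior_of_maximal by (metis (no_types, lifting) subset_empty)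
  then show False
    using h y by (auto simp: F_def)
qed

section \<open>Comeager filters and the category quantifier\<close>

definition class_filter :: "'n set \<Rightarrow> 'n set set" where
  "class_filter C = {S. S \<subseteq> C \<and> fmeager (C - S)}"

lemma sigma_filter_on_class_filter:
  assumes "C \<in> N // E"
  shows "sigma_filter_on C (class_filter C)"
proof -
  obtain y where y: "y \<in> N" "C = E `` {y}"
    using assms by (auto elim: quotientE)
  have "openin fine_top C"
    using openin_fine_reach[of L y] y class_eq_reach by auto
  moreover have "y \<in> C"
    using equiv_E y equiv_class_self by metis
  ultimately have "\<not> fmeager C"
    using fine_Baire by blast
  have inter: "fmeager (C - (\<Inter>n. A n))" if "range A \<subseteq> class_filter C" for A :: "nat \<Rightarrow> 'n set"
  proof -
    have "C - (\<Inter>n. A n) = (\<Union>n. C - A n)"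
      by blast
    then show ?thesis
      using fmeager_UN[of UNIV "\<lambda>n. C - A n"] that by (auto simp: class_filter_def)
  qed
  have up: "fmeager (C - T)" if "fmeager (C - S)" "S \<subseteq> T" for S T
    using that(1) by (rule fmeager_subset) (use that(2) in blast)
  have "C \<in> class_filter C"
    by (simp add: class_filter_def)
  show ?thesis
    unfolding sigma_filter_on_def
  proof (intro conjI ballI allI impI)
    show "class_filter C \<noteq> {}"
      using \<open>C \<in> class_filter C\<close> by blast
    show "S \<noteq> {}" "S \<subseteq> C" if "S \<in> class_filter C" for S
      using that \<open>\<not> fmeager C\<close> by (auto simp: class_filter_def)
    show "T \<in> class_filter C" if "S \<in> class_filter C \<and> S \<subseteq> T \<and> T \<subseteq> C" for S T
      using that up[of S T] by (simp add: class_filter_def)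
    show "(\<Inter>n. A n) \<in> class_filter C" if "range A \<subseteq> class_filter C" for A :: "nat \<Rightarrow> 'n set"
      using that inter[OF that] by (auto simp: class_filter_def)
  qed
qed

text \<open>A form of Banach's category theorem, that locally meager sets are meager, for images of
  basic open sets of \<open>L\<close>. Removing from the closure of \<open>reach U y\<close> all
  basic images on which \<open>S\<close> is meager leaves a closed set, and the density hypothesis
  denies it interior points; countability of the base does the rest.\<close>

lemma fmeager_localized:
  assumes \<B>: "countable \<B>" "\<And>U. U \<in> \<B> \<Longrightarrow> openin L.mtopology U"
      "\<And>U h. openin L.mtopology U \<Longrightarrow> h \<in> U \<Longrightarrow> \<exists>V\<in>\<B>. h \<in> V \<and> V \<subseteq> U"
    and U: "U \<in> \<B>"
    and dense: "\<And>V. V \<in> \<B> \<Longrightarrow> V \<subseteq> U \<Longrightarrow> reach V y \<noteq> {} \<Longrightarrow>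
      \<exists>V'\<in>\<B>. V' \<subseteq> V \<and> reach V' y \<noteq> {} \<and> fmeager (reach V' y \<inter> S)"
  shows "fmeager (reach U y \<inter> S)"
proof -
  define \<B>' where "\<B>' = {V\<in>\<B>. fmeager (reach V y \<inter> S)}"
  define G where "G = (\<Union>V\<in>\<B>'. reach V y)"
  have openG: "openin fine_top G"
    unfolding G_def \<B>'_def using \<B>(2) by (intro openin_Union) (auto intro: openin_fine_reach)
  define Z where "Z = fine_top closure_of (reach U y) - G"
  have oU: "openin fine_top (reach U y)"
    using openin_fine_reach \<B>(2) U by blast
  have "closedin fine_top Z"
    unfolding Z_def using openG by (intro closedin_diff) auto
  moreover have "fine_top interior_of Z = {}"
  proof (rule ccontr)
    assume "fine_top interior_of Z \<noteq> {}"
    then obtain x where x: "x \<in> fine_top interior_of Z"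
      by blast
    then have "x \<in> fine_top closure_of (reach U y)"
      using interior_of_subset[of fine_top Z] by (auto simp: Z_def)
    then obtain z where z: "z \<in> reach U y" "z \<in> fine_top interior_of Z"
      using x openin_interior_of[of fine_top Z] by (meson in_closure_of)
    then obtain h where h: "h \<in> U" "h \<in> L" "s h = y" "e h = z"
      by (auto simp: reach_def)
    obtain r where r: "r > 0" "reach (L.mball h r) (s h) \<subseteq> fine_top interior_of Z"
      using openin_interior_of[of fine_top Z] h z unfolding openin_fine by blast
    have "openin L.mtopology (L.mball h r \<inter> U)" "h \<in> L.mball h r \<inter> U"
      using \<B>(2) U h r by auto
    then obtain V where V: "V \<in> \<B>" "h \<in> V" "V \<subseteq> L.mball h r \<inter> U"
      using \<B>(3) by metis
    have "reach V y \<noteq> {}"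
      using V(2) h by (auto simp: reach_def)
    then obtain V' where V': "V' \<in> \<B>" "V' \<subseteq> V" "reach V' y \<noteq> {}" "fmeager (reach V' y \<inter> S)"
      using dense[of V] V by blast
    have "reach V' y \<subseteq> Z"
      using r V V' h interior_of_subset[of fine_top Z] reach_mono[of V' "L.mball h r" y] by blast
    moreover have "reach V' y \<subseteq> G"
      using V' by (auto simp: G_def \<B>'_def)
    ultimately show False
      using V'(3) by (auto simp: Z_def)
  qed
  ultimately have "fmeager Z"
    unfolding fmeager_def by (intro exI[of _ "{Z}"]) auto
  moreover have "fmeager (\<Union>V\<in>\<B>'. reach V y \<inter> S)"
    using \<B>(1) by (intro fmeager_UN) (auto simp: \<B>'_def)
  ultimately have "fmeager (Z \<union> (\<Union>V\<in>\<B>'. reach V y \<inter> S))"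
    by (rule fmeager_Un)
  moreover have "reach U y \<inter> S \<subseteq> Z \<union> (\<Union>V\<in>\<B>'. reach V y \<inter> S)"
    using closure_of_subset[of "reach U y" fine_top] reach_subset by (auto simp: Z_def G_def)
  ultimately show ?thesis
    using fmeager_subset by blast
qed

text \<open>The Montgomery--Novikov argument for category quantifiers, with the images
  \<open>reach U y\<close> of basic open sets of \<open>L\<close> in the role of basic open sets of
  the sections.\<close>

theorem idealistic_E: "idealistic N.mtopology E"
proof -
  let ?B = "sets (borel_of N.mtopology)"
  let ?B2 = "sets (borel_of (prod_topology N.mtopology N.mtopology))"
  obtain \<B> where "countable \<B> \<and> (\<forall>V \<in> \<B>. openin L.mtopology V) \<and>
      (\<forall>U x. openin L.mtopology U \<and> x \<in> U \<longrightarrow> (\<exists>V \<in> \<B>. x \<in> V \<and> V \<subseteq> U))"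
    using L.separable_imp_second_countable[OF separable] unfolding second_countable_def by (elim exE)
  then have \<B>: "countable \<B>" "\<And>U. U \<in> \<B> \<Longrightarrow> openin L.mtopology U"
      "\<And>U h. openin L.mtopology U \<Longrightarrow> h \<in> U \<Longrightarrow> \<exists>V\<in>\<B>. h \<in> V \<and> V \<subseteq> U"
    by simp_all
  have se: "continuous_map L.mtopology (prod_topology N.mtopology N.mtopology) (\<lambda>h. (s h, e h))"
    by (intro continuous_map_pairedI cont_s cont_e)
  define sec :: "('n \<times> 'n) set \<Rightarrow> 'n \<Rightarrow> 'n set" where "sec A y = {y'. (y, y') \<in> A}" for A y
  \<comment> \<open>Measurability alone is not visibly stable under complements. The second clause,
    a localized Baire property of the sections, is carried along to make it so.\<close>
  define good :: "('n \<times> 'n) set \<Rightarrow> bool" where "good A \<longleftrightarrow>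
     (\<forall>U\<in>\<B>. {y \<in> N. fmeager (reach U y \<inter> sec A y)} \<in> ?B) \<and>
     (\<forall>U\<in>\<B>. \<forall>y. reach U y \<noteq> {} \<longrightarrow> (\<exists>V\<in>\<B>. V \<subseteq> U \<and> reach V y \<noteq> {} \<and>
         (fmeager (reach V y \<inter> sec A y) \<or> fmeager (reach V y - sec A y))))" for A
  have reach_eq: "{y \<in> N. reach U y \<noteq> {}} = s ` U" if "U \<in> \<B>" for U
    using openin_subset[OF \<B>(2)[OF that]] by (auto simp: reach_def)
  \<comment> \<open>Openness of \<open>s\<close> enters here, and once more for open
    \<open>A\<close>: the points \<open>y\<close> with nonempty \<open>reach U y\<close> form an
    open set.\<close>
  have nonempty_meas: "{y \<in> N. reach U y \<noteq> {}} \<in> ?B" if "U \<in> \<B>" for U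
    using reach_eq[OF that] open_s \<B>(2)[OF that] by (auto simp: open_map_def intro: openin_borel_of)
  have compl: "{y \<in> N. \<not> Q y} \<in> ?B" if "{y \<in> N. Q y} \<in> ?B" for Q
  proof -
    have "{y \<in> N. \<not> Q y} = space (borel_of N.mtopology) - {y \<in> N. Q y}"
      by auto
    then show ?thesis
      using that sets.compl_sets by metis
  qed
  have good_open: "good A" if A: "openin (prod_topology N.mtopology N.mtopology) A" for A
  proof -
    define A' where "A' = {h \<in> L. (s h, e h) \<in> A}"
    have A': "openin L.mtopology A'"
      using openin_continuous_map_preimage[OF se A] by (simp add: A'_def)
    have reachA: "reach (U \<inter> A') y = reach U y \<inter> sec A y" for U y
      by (auto simp: reach_def A'_def sec_def)
    have opn: "openin fine_top (reach U y \<inter> sec A y)" if "U \<in> \<B>" for U y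
      using openin_fine_reach[of "U \<inter> A'" y] reachA A' \<B>(2)[OF that] by (metis openin_Int)
    have "{y \<in> N. fmeager (reach U y \<inter> sec A y)} \<in> ?B" if U: "U \<in> \<B>" for U
    proof -
      \<comment> \<open>The set is fine-open, so by the Baire property it is meager only when empty,
        and emptiness is a condition on the image of an open set under \<open>s\<close>.\<close>
      have "fmeager (reach U y \<inter> sec A y) \<longleftrightarrow> reach U y \<inter> sec A y = {}" for y
        using opn[OF U] fine_Baire by (metis fmeager_empty)
      then have "{y \<in> N. fmeager (reach U y \<inter> sec A y)} = {y \<in> N. \<not> reach (U \<inter> A') y \<noteq> {}}"
        by (simp add: reachA)
      moreover have "{y \<in> N. reach (U \<inter> A') y \<noteq> {}} = s ` (U \<inter> A')"
        using openin_subset[OF \<B>(2)[OF U]] by (auto simp: reach_def)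
      moreover have "s ` (U \<inter> A') \<in> ?B"
        using open_s A' \<B>(2)[OF U] by (auto simp: open_map_def intro!: openin_borel_of)
      ultimately show ?thesis
        using compl[of "\<lambda>y. reach (U \<inter> A') y \<noteq> {}"] by simp
    qed
    moreover have "\<exists>V\<in>\<B>. V \<subseteq> U \<and> reach V y \<noteq> {} \<and>
         (fmeager (reach V y \<inter> sec A y) \<or> fmeager (reach V y - sec A y))"
      if U: "U \<in> \<B>" "reach U y \<noteq> {}" for U y
    proof (cases "reach U y \<inter> sec A y = {}")
      case True
      then have "fmeager (reach U y \<inter> sec A y)"
        by simp
      then show ?thesis
        using U by blast
    next
      case False
      then obtain h where h: "h \<in> U" "h \<in> A'" "h \<in> L" "s h = y"
        unfolding reachA[symmetric] by (auto simp: reach_def)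
      then obtain V where V: "V \<in> \<B>" "h \<in> V" "V \<subseteq> U \<inter> A'"
        using \<B>(3)[of "U \<inter> A'" h] A' \<B>(2)[OF U(1)] by auto
      then have "reach V y \<subseteq> sec A y"
        using reach_mono reachA by blast
      then have "fmeager (reach V y - sec A y)"
        by (metis Diff_eq_empty_iff fmeager_empty)
      moreover have "reach V y \<noteq> {}"
        using h V by (auto simp: reach_def)
      ultimately show ?thesis
        using V by blast
    qed
    ultimately show ?thesis
      unfolding good_def by blast
  qed
  have good_compl: "good (N \<times> N - A)" if A: "good A" for A
  proof -
    have sec: "reach U y \<inter> sec (N \<times> N - A) y = reach U y - sec A y" for U y
      using reach_subset[of U y] by (auto simp: sec_def reach_def)
    have sec': "reach U y - sec (N \<times> N - A) y = reach U y \<inter> sec A y" for U y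
      using reach_subset[of U y] by (auto simp: sec_def reach_def)
    \<comment> \<open>Failure of comeagerness on \<open>U\<close> is turned into meagerness on some
      nonempty smaller image, that is, into a countable union of conditions already known to be
      Borel. One direction localizes by the second clause of \<open>good\<close>, the other is the
      Baire property.\<close>
    have key: "\<not> fmeager (reach U y - sec A y) \<longleftrightarrow>
        (\<exists>V\<in>{V \<in> \<B>. V \<subseteq> U}. reach V y \<noteq> {} \<and> fmeager (reach V y \<inter> sec A y))" if U: "U \<in> \<B>" for U y
    proof
      assume n: "\<not> fmeager (reach U y - sec A y)"
      show "\<exists>V\<in>{V \<in> \<B>. V \<subseteq> U}. reach V y \<noteq> {} \<and> fmeager (reach V y \<inter> sec A y)"
      proof (rule ccontr)
        assume c: "\<not> ?thesis"
        have "fmeager (reach U y \<inter> (- sec A y))"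
        proof (rule fmeager_localized[OF \<B> U])
          fix V assume V: "V \<in> \<B>" "V \<subseteq> U" "reach V y \<noteq> {}"
          then obtain V' where V': "V' \<in> \<B>" "V' \<subseteq> V" "reach V' y \<noteq> {}"
            "fmeager (reach V' y \<inter> sec A y) \<or> fmeager (reach V' y - sec A y)"
            using A unfolding good_def by blast
          then have "fmeager (reach V' y - sec A y)"
            using c V by blast
          then show "\<exists>V'\<in>\<B>. V' \<subseteq> V \<and> reach V' y \<noteq> {} \<and> fmeager (reach V' y \<inter> (- sec A y))"
            using V' by (auto simp: Diff_eq)
        qed
        with n show False
          by (simp add: Diff_eq)
      qed
    next
      assume "\<exists>V\<in>{V \<in> \<B>. V \<subseteq> U}. reach V y \<noteq> {} \<and> fmeager (reach V y \<inter> sec A y)"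
      then obtain V where V: "V \<in> \<B>" "V \<subseteq> U" "reach V y \<noteq> {}" "fmeager (reach V y \<inter> sec A y)"
        by blast
      show "\<not> fmeager (reach U y - sec A y)"
      proof
        assume "fmeager (reach U y - sec A y)"
        then have "fmeager ((reach V y \<inter> sec A y) \<union> (reach U y - sec A y))"
          using V fmeager_Un by blast
        then have "fmeager (reach V y)"
          by (rule fmeager_subset) (use reach_mono[OF V(2)] in blast)
        then show False
          using fine_Baire[OF openin_fine_reach[OF \<B>(2)[OF V(1)]] V(3)] by blast
      qed
    qed
    have "{y \<in> N. fmeager (reach U y \<inter> sec (N \<times> N - A) y)} \<in> ?B" if U: "U \<in> \<B>" for U
    proof -
      have "{y \<in> N. \<not> fmeager (reach U y - sec A y)} =
         (\<Union>V\<in>{V \<in> \<B>. V \<subseteq> U}. {y \<in> N. reach V y \<noteq> {}} \<inter> {y \<in> N. fmeager (reach V y \<inter> sec A y)})"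
        unfolding key[OF U] by blast
      also have "\<dots> \<in> ?B"
        using \<B>(1) A nonempty_meas unfolding good_def by (intro sets.countable_UN') auto
      finally show ?thesis
        using compl[of "\<lambda>y. \<not> fmeager (reach U y - sec A y)"] by (simp add: sec)
    qed
    then show ?thesis
      using A unfolding good_def sec sec' by blast
  qed
  have good_UN: "good (\<Union>n. A n)" if A: "\<And>n::nat. good (A n)" for A
  proof -
    have sec: "reach U y \<inter> sec (\<Union>n. A n) y = (\<Union>n. reach U y \<inter> sec (A n) y)" for U y
      by (auto simp: sec_def)
    have "fmeager (reach U y \<inter> sec (\<Union>n. A n) y) \<longleftrightarrow> (\<forall>n. fmeager (reach U y \<inter> sec (A n) y))" for U y
      unfolding sec by (meson UN_upper UNIV_I countableI_type fmeager_UN fmeager_subset)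
    then have "{y \<in> N. fmeager (reach U y \<inter> sec (\<Union>n. A n) y)} = (\<Inter>n. {y \<in> N. fmeager (reach U y \<inter> sec (A n) y)})" for U
      by auto
    moreover have "(\<Inter>n. {y \<in> N. fmeager (reach U y \<inter> sec (A n) y)}) \<in> ?B" if "U \<in> \<B>" for U
      using A that unfolding good_def by (intro sets.countable_INT') auto
    moreover have "\<exists>V\<in>\<B>. V \<subseteq> U \<and> reach V y \<noteq> {} \<and>
         (fmeager (reach V y \<inter> sec (\<Union>n. A n) y) \<or> fmeager (reach V y - sec (\<Union>n. A n) y))"
      if U: "U \<in> \<B>" "reach U y \<noteq> {}" for U y
    \<comment> \<open>If some single section is comeager on a smaller image, so is the union.
      Otherwise the second clause leaves only the meager alternative everywhere below
      \<open>U\<close>, and localization makes each section, hence the union, meager on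
      \<open>U\<close>.\<close>
    proof (cases "\<exists>V\<in>\<B>. V \<subseteq> U \<and> reach V y \<noteq> {} \<and> (\<exists>n. fmeager (reach V y - sec (A n) y))")
      case True
      then obtain V n where V: "V \<in> \<B>" "V \<subseteq> U" "reach V y \<noteq> {}" "fmeager (reach V y - sec (A n) y)"
        by blast
      have "fmeager (reach V y - sec (\<Union>n. A n) y)"
        by (rule fmeager_subset[OF V(4)]) (auto simp: sec_def)
      with V show ?thesis
        by blast
    next
      case False
      have "fmeager (reach U y \<inter> sec (A n) y)" for n
      proof (rule fmeager_localized[OF \<B> U(1)])
        fix V assume V: "V \<in> \<B>" "V \<subseteq> U" "reach V y \<noteq> {}"
        then obtain V' where V': "V' \<in> \<B>" "V' \<subseteq> V" "reach V' y \<noteq> {}"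
          "fmeager (reach V' y \<inter> sec (A n) y) \<or> fmeager (reach V' y - sec (A n) y)"
          using A[of n] unfolding good_def by blast
        then have "fmeager (reach V' y \<inter> sec (A n) y)"
          using False V by blast
        then show "\<exists>V'\<in>\<B>. V' \<subseteq> V \<and> reach V' y \<noteq> {} \<and> fmeager (reach V' y \<inter> sec (A n) y)"
          using V' by blast
      qed
      then have "fmeager (reach U y \<inter> sec (\<Union>n. A n) y)"
        unfolding sec by (intro fmeager_UN) auto
      with U show ?thesis
        by blast
    qed
    ultimately show ?thesis
      unfolding good_def by simp
  qed
  have good_Borel: "good A" if "A \<in> ?B2" for A
    using that unfolding sets_borel_of
  proof (induction rule: sigma_sets.induct)
    case (Basic A)
    then show ?case
      using good_open by simp
  next
    case Empty
    show ?case
      using good_open by simp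
  next
    case (Compl A)
    then show ?case
      using good_compl by simp
  next
    case (Union A)
    then show ?case
      using good_UN by simp
  qed
  \<comment> \<open>Countably many basic images exhaust a class, so comeagerness in the class can be
    tested on each of them.\<close>
  have UB: "(\<Union>U\<in>\<B>. reach U y) = E `` {y}" for y
    unfolding class_eq_reach
  proof (intro equalityI subsetI)
    fix x assume "x \<in> reach L y"
    then obtain h where h: "h \<in> L" "s h = y" "e h = x"
      by (auto simp: reach_def)
    then obtain V where "V \<in> \<B>" "h \<in> V"
      using \<B>(3)[of L h] by auto
    with h show "x \<in> (\<Union>U\<in>\<B>. reach U y)"
      by (auto simp: reach_def)
  qed (auto simp: reach_def)
  have "{y \<in> N. {y' \<in> E `` {y}. (y, y') \<in> A} \<in> class_filter (E `` {y})} \<in> ?B" if A: "A \<in> ?B2" for A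
  proof -
    have A2: "good (N \<times> N - A)"
      using good_compl good_Borel[OF A] by blast
    have "{y' \<in> E `` {y}. (y, y') \<in> A} \<in> class_filter (E `` {y}) \<longleftrightarrow> (\<forall>U\<in>\<B>. fmeager (reach U y \<inter> sec (N \<times> N - A) y))"
      if y: "y \<in> N" for y
    proof -
      have "E `` {y} \<subseteq> N"
        unfolding class_eq_reach by (rule reach_subset)
      then have *: "E `` {y} - {y' \<in> E `` {y}. (y, y') \<in> A} = (\<Union>U\<in>\<B>. reach U y \<inter> sec (N \<times> N - A) y)"
        using y UB[of y] by (auto simp: sec_def)
      have "{y' \<in> E `` {y}. (y, y') \<in> A} \<in> class_filter (E `` {y}) \<longleftrightarrow>
          fmeager (\<Union>U\<in>\<B>. reach U y \<inter> sec (N \<times> N - A) y)"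
        unfolding class_filter_def *[symmetric] by blast
      also have "\<dots> \<longleftrightarrow> (\<forall>U\<in>\<B>. fmeager (reach U y \<inter> sec (N \<times> N - A) y))"
        using fmeager_UN[OF \<B>(1), of "\<lambda>U. reach U y \<inter> sec (N \<times> N - A) y"]
        by (meson UN_upper fmeager_subset)
      finally show ?thesis .
    qed
    then have "{y \<in> N. {y' \<in> E `` {y}. (y, y') \<in> A} \<in> class_filter (E `` {y})}
        = {y \<in> N. \<not> (\<exists>U\<in>\<B>. \<not> fmeager (reach U y \<inter> sec (N \<times> N - A) y))}"
      by blast
    moreover have "{y \<in> N. \<exists>U\<in>\<B>. \<not> fmeager (reach U y \<inter> sec (N \<times> N - A) y)} =
        (\<Union>U\<in>\<B>. {y \<in> N. \<not> fmeager (reach U y \<inter> sec (N \<times> N - A) y)})"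
      by blast
    moreover have "\<dots> \<in> ?B"
      using A2 \<B>(1) compl unfolding good_def by (intro sets.countable_UN') auto
    ultimately show ?thesis
      using compl[of "\<lambda>y. \<exists>U\<in>\<B>. \<not> fmeager (reach U y \<inter> sec (N \<times> N - A) y)"] by (metis (no_types, lifting))
  qed
  moreover have "(y, y) \<in> E" if "y \<in> N" for y
    using equiv_E that by (meson equivE refl_onD)
  ultimately show ?thesis
    unfolding idealistic_def
    using sigma_filter_on_class_filter
    by (intro exI[of _ class_filter] exI[of _ "\<lambda>y. y"]) auto
qed

end

section \<open>Polyhedra\<close>

text \<open>Constancy of the paths on the diagonal is what later makes paths between close points
  short, uniformly over compact sets.\<close>

definition locally_equiconnected :: "'p topology \<Rightarrow> bool" where
  "locally_equiconnected P \<longleftrightarrow> (\<exists>\<Omega> \<theta>. openin (prod_topology P P) \<Omega> \<and> (\<forall>p\<in>topspace P. (p, p) \<in> \<Omega>) \<and>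
     continuous_map (prod_topology (subtopology (prod_topology P P) \<Omega>) (top_of_set {0..1::real})) P
       (\<lambda>z. \<theta> (fst (fst z)) (snd (fst z)) (snd z)) \<and>
     (\<forall>(p, q)\<in>\<Omega>. \<theta> p q 0 = p \<and> \<theta> p q 1 = q) \<and>
     (\<forall>p\<in>topspace P. \<forall>u\<in>{0..1}. \<theta> p p u = p))"

lemma second_countable_euclidean: "second_countable (euclidean :: 'a::second_countable_topology topology)"
proof -
  obtain B :: "'a set set" where B: "countable B" "\<And>C. C \<in> B \<Longrightarrow> open C" "\<And>S. open S \<Longrightarrow> \<exists>U. U \<subseteq> B \<and> S = \<Union>U"
    using univ_second_countable by metis
  show ?thesis
    unfolding second_countable_def
  proof (intro exI[of _ B] conjI allI impI ballI)
    fix U :: "'a set" and x assume "openin euclidean U \<and> x \<in> U"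
    then obtain T where "T \<subseteq> B" "U = \<Union>T" "x \<in> U"
      using B(3)[of U] by auto
    then show "\<exists>V\<in>B. x \<in> V \<and> V \<subseteq> U"
      by blast
  qed (use B in auto)
qed

lemma second_countable_prod_topology:
  assumes "second_countable X" "second_countable Y"
  shows "second_countable (prod_topology X Y)"
proof -
  obtain \<A> where A: "countable \<A>" "\<forall>V \<in> \<A>. openin X V" "\<forall>U x. openin X U \<and> x \<in> U \<longrightarrow> (\<exists>V \<in> \<A>. x \<in> V \<and> V \<subseteq> U)"
    using assms(1) unfolding second_countable_def by (elim exE conjE)
  obtain \<B> where B: "countable \<B>" "\<forall>V \<in> \<B>. openin Y V" "\<forall>U x. openin Y U \<and> x \<in> U \<longrightarrow> (\<exists>V \<in> \<B>. x \<in> V \<and> V \<subseteq> U)"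
    using assms(2) unfolding second_countable_def by (elim exE conjE)
  show ?thesis
    unfolding second_countable_def
  proof (intro exI[of _ "(\<lambda>(U,V). U \<times> V) ` (\<A> \<times> \<B>)"] conjI allI impI)
    show "countable ((\<lambda>(U,V). U \<times> V) ` (\<A> \<times> \<B>))"
      using A(1) B(1) by blast
    show "\<forall>V\<in>(\<lambda>(U,V). U \<times> V) ` (\<A> \<times> \<B>). openin (prod_topology X Y) V"
      using A(2) B(2) by (auto simp: openin_prod_Times_iff)
    fix W z assume W: "openin (prod_topology X Y) W \<and> z \<in> W"
    obtain x y where z: "z = (x, y)"
      by fastforce
    then obtain U V where UV: "openin X U" "openin Y V" "x \<in> U" "y \<in> V" "U \<times> V \<subseteq> W"
      using W unfolding openin_prod_topology_alt by metis
    obtain U' where U': "U' \<in> \<A>" "x \<in> U'" "U' \<subseteq> U"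
      using A(3) UV by meson
    obtain V' where V': "V' \<in> \<B>" "y \<in> V'" "V' \<subseteq> V"
      using B(3) UV by meson
    have "U' \<times> V' \<in> (\<lambda>(U,V). U \<times> V) ` (\<A> \<times> \<B>)"
      using U' V' by auto
    moreover have "z \<in> U' \<times> V'" "U' \<times> V' \<subseteq> W"
      using z U' V' UV by auto
    ultimately show "\<exists>V\<in>(\<lambda>(U,V). U \<times> V) ` (\<A> \<times> \<B>). z \<in> V \<and> V \<subseteq> W"
      by blast
  qed
qed

lemma locally_equiconnected_homeomorphic:
  assumes hom: "P homeomorphic_space Q" and Q: "locally_equiconnected Q"
  shows "locally_equiconnected P"
proof -
  obtain f g where fg: "homeomorphic_maps P Q f g"
    using hom unfolding homeomorphic_space_def by blast
  then have f: "continuous_map P Q f" and g: "continuous_map Q P g"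
    and gf: "\<And>p. p \<in> topspace P \<Longrightarrow> g (f p) = p"
    by (auto simp: homeomorphic_maps_def)
  obtain \<Omega> \<theta> where \<Omega>: "openin (prod_topology Q Q) \<Omega>" "\<forall>p\<in>topspace Q. (p, p) \<in> \<Omega>"
    and \<theta>: "continuous_map (prod_topology (subtopology (prod_topology Q Q) \<Omega>) (top_of_set {0..1::real})) Q
       (\<lambda>z. \<theta> (fst (fst z)) (snd (fst z)) (snd z))"
      "\<forall>(p, q)\<in>\<Omega>. \<theta> p q 0 = p \<and> \<theta> p q 1 = q" "\<forall>p\<in>topspace Q. \<forall>u\<in>{0..1}. \<theta> p p u = p"
    using Q unfolding locally_equiconnected_def by (elim exE conjE) (rule that; assumption)
  define \<Omega>' where "\<Omega>' = {z \<in> topspace (prod_topology P P). (f (fst z), f (snd z)) \<in> \<Omega>}"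
  have ff: "continuous_map (prod_topology P P) (prod_topology Q Q) (\<lambda>z. (f (fst z), f (snd z)))"
    using f by (intro continuous_map_pairedI continuous_map_compose[unfolded o_def, OF continuous_map_fst]
        continuous_map_compose[unfolded o_def, OF continuous_map_snd])
  show ?thesis
    unfolding locally_equiconnected_def
  proof (intro exI[of _ \<Omega>'] exI[of _ "\<lambda>p q u. g (\<theta> (f p) (f q) u)"] conjI)
    show "openin (prod_topology P P) \<Omega>'"
      unfolding \<Omega>'_def by (rule openin_continuous_map_preimage[OF ff \<Omega>(1)])
    have fQ: "f p \<in> topspace Q" if "p \<in> topspace P" for p
      using f that by (auto simp: continuous_map_def)
    show "\<forall>p\<in>topspace P. (p, p) \<in> \<Omega>'"
      using \<Omega>(2) fQ by (auto simp: \<Omega>'_def)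
    show "\<forall>(p, q)\<in>\<Omega>'. g (\<theta> (f p) (f q) 0) = p \<and> g (\<theta> (f p) (f q) 1) = q"
      using \<theta>(2) gf by (fastforce simp: \<Omega>'_def)
    show "\<forall>p\<in>topspace P. \<forall>u\<in>{0..1}. g (\<theta> (f p) (f p) u) = p"
      using \<theta>(3) gf fQ by simp
    have "continuous_map (subtopology (prod_topology P P) \<Omega>') (subtopology (prod_topology Q Q) \<Omega>) (\<lambda>z. (f (fst z), f (snd z)))"
      using ff by (auto simp: continuous_map_in_subtopology continuous_map_from_subtopology \<Omega>'_def)
    from continuous_map_compose[OF continuous_map_fst this]
    have "continuous_map (prod_topology (subtopology (prod_topology P P) \<Omega>') (top_of_set {0..1::real}))
        (prod_topology (subtopology (prod_topology Q Q) \<Omega>) (top_of_set {0..1::real}))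
        (\<lambda>z. ((f (fst (fst z)), f (snd (fst z))), snd z))"
      by (intro continuous_map_pairedI continuous_map_snd) (simp_all add: o_def)
    from continuous_map_compose[OF continuous_map_compose[OF this \<theta>(1)] g]
    show "continuous_map (prod_topology (subtopology (prod_topology P P) \<Omega>') (top_of_set {0..1::real})) P
       (\<lambda>z. g (\<theta> (f (fst (fst z))) (f (snd (fst z))) (snd z)))"
      by (simp add: o_def)
  qed
qed

section \<open>Realizations of countable locally finite complexes\<close>

context
  fixes K :: "nat set set"
  assumes complex: "abstract_complex K" and locfin: "locally_finite_complex K"
begin

definition cx_points :: "(nat \<Rightarrow> real) set" where
  "cx_points = (\<Union>\<sigma>\<in>K. simplex_points \<sigma>)"

definition star_verts :: "nat \<Rightarrow> nat set" where
  "star_verts v = \<Union>{\<sigma>\<in>K. v \<in> \<sigma>}"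

lemma finite_simplex: "\<sigma> \<in> K \<Longrightarrow> finite \<sigma>"
  using complex by (simp add: abstract_complex_def)

lemma finite_star: "finite {\<sigma> \<in> K. v \<in> \<sigma>}"
  using locfin by (simp add: locally_finite_complex_def)

lemma finite_star_verts: "finite (star_verts v)"
  using finite_star finite_simplex by (auto simp: star_verts_def)

lemma closed_simplex_points: "closed (simplex_points \<sigma>)"
proof -
  have "simplex_points \<sigma> = (\<Inter>v. {t. 0 \<le> t v}) \<inter> (\<Inter>v\<in>-\<sigma>. {t. t v = 0}) \<inter> {t. (\<Sum>v\<in>\<sigma>. t v) = 1}"
    by (auto simp: simplex_points_def)
  moreover have "closed \<dots>"
    by (intro closed_Int closed_INT ballI closed_Collect_le closed_Collect_eq continuous_on_sum
        continuous_on_product_coordinates continuous_on_const)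
  ultimately show ?thesis
    by simp
qed

lemma simplex_points_le_1:
  assumes "\<sigma> \<in> K" "t \<in> simplex_points \<sigma>"
  shows "t v \<le> 1"
proof (cases "v \<in> \<sigma>")
  case True
  then have "t v \<le> (\<Sum>v\<in>\<sigma>. t v)"
    using assms finite_simplex by (intro member_le_sum) (auto simp: simplex_points_def)
  then show ?thesis
    using assms by (simp add: simplex_points_def)
qed (use assms in \<open>simp add: simplex_points_def\<close>)

lemma compact_simplex_points:
  assumes "\<sigma> \<in> K"
  shows "compact (simplex_points \<sigma>)"
proof -
  have "compactin (powertop_real UNIV) (PiE UNIV (\<lambda>_. {0..1}))"
    by (simp add: compactin_PiE)
  then have "compact (PiE (UNIV :: nat set) (\<lambda>_. {0..1::real}))"
    by (simp add: euclidean_product_topology)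
  moreover have "simplex_points \<sigma> = PiE UNIV (\<lambda>_. {0..1}) \<inter> simplex_points \<sigma>"
    using simplex_points_le_1[OF assms] by (auto simp: simplex_points_def)
  ultimately show ?thesis
    using compact_Int_closed[OF _ closed_simplex_points] by metis
qed

lemma simplex_points_pos: "t \<in> simplex_points \<sigma> \<Longrightarrow> t v > 0 \<Longrightarrow> v \<in> \<sigma>"
  unfolding simplex_points_def by (metis (mono_tags, lifting) less_irrefl mem_Collect_eq)

lemma simplex_points_ex_pos:
  assumes "t \<in> simplex_points \<sigma>"
  obtains v where "t v > 0"
proof -
  have "\<exists>v. t v > 0"
  proof (rule ccontr)
    assume "\<nexists>v. t v > 0"
    then have "t v \<le> 0" for v
      by (simp add: not_less)
    then have "(\<Sum>v\<in>\<sigma>. t v) \<le> 0"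
      by (intro sum_nonpos)
    with assms show False
      by (simp add: simplex_points_def)
  qed
  with that show ?thesis
    by blast
qed

lemma open_coordinate_pos: "open {t :: nat \<Rightarrow> real. t v > 0}"
  by (intro open_Collect_less continuous_on_const continuous_on_product_coordinates)

text \<open>A point with positive coordinate \<open>v\<close> lies only in simplices that contain
  \<open>v\<close>, and these are finitely many by local finiteness. On this open star the weak
  topology is thus tested on finitely many closed sets, where it agrees with the coordinatewise
  one.\<close>

lemma realization_eq: "realization K = top_of_set cx_points"
  unfolding topology_eq
proof (intro allI iffI)
  fix U assume U: "openin (top_of_set cx_points) U"
  then obtain T where T: "open T" "U = cx_points \<inter> T"
    by (auto simp: openin_open)
  have "U \<inter> simplex_points \<sigma> = simplex_points \<sigma> \<inter> T" if "\<sigma> \<in> K" for \<sigma>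
    using that T by (auto simp: cx_points_def)
  then show "openin (realization K) U"
    using T unfolding openin_realization by (auto simp: euclidean_product_topology openin_open cx_points_def)
next
  fix U assume "openin (realization K) U"
  then have U: "U \<subseteq> cx_points" "\<And>\<sigma>. \<sigma> \<in> K \<Longrightarrow> openin (top_of_set (simplex_points \<sigma>)) (U \<inter> simplex_points \<sigma>)"
    unfolding openin_realization by (auto simp: cx_points_def euclidean_product_topology)
  show "openin (top_of_set cx_points) U"
  proof (subst openin_subopen, intro ballI)
    fix t assume t: "t \<in> U"
    then obtain \<sigma> where "\<sigma> \<in> K" "t \<in> simplex_points \<sigma>"
      using U by (auto simp: cx_points_def)
    then obtain v where v: "t v > 0"
      using simplex_points_ex_pos by blast
    define C where "C = (\<Union>\<sigma>\<in>{\<sigma>\<in>K. v \<in> \<sigma>}. simplex_points \<sigma> - U)"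
    have "closed (simplex_points \<sigma> - U)" if "\<sigma> \<in> K" for \<sigma>
    proof -
      have "closedin (top_of_set (simplex_points \<sigma>)) (simplex_points \<sigma> - U \<inter> simplex_points \<sigma>)"
        using U(2)[OF that] by (metis closedin_diff closedin_topspace topspace_euclidean_subtopology)
      moreover have "simplex_points \<sigma> - U \<inter> simplex_points \<sigma> = simplex_points \<sigma> - U"
        by blast
      ultimately show ?thesis
        using closed_simplex_points closedin_closed_trans by metis
    qed
    then have C: "closed C"
      unfolding C_def using finite_star by (intro closed_UN) auto
    define W where "W = cx_points \<inter> ({t. t v > 0} - C)"
    have "openin (top_of_set cx_points) W"
      unfolding W_def using C open_coordinate_pos by (intro openin_open_Int open_Diff)
    moreover have "t \<in> W"
      using t v U by (auto simp: W_def C_def)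
    moreover have "W \<subseteq> U"
    proof
      fix r assume r: "r \<in> W"
      then obtain \<tau> where "\<tau> \<in> K" "r \<in> simplex_points \<tau>"
        by (auto simp: W_def cx_points_def)
      moreover from this r have "v \<in> \<tau>"
        using simplex_points_pos by (auto simp: W_def)
      ultimately show "r \<in> U"
        using r by (auto simp: W_def C_def)
    qed
    ultimately show "\<exists>T. openin (top_of_set cx_points) T \<and> t \<in> T \<and> T \<subseteq> U"
      by blast
  qed
qed

text \<open>The open star of a vertex lies in the union of finitely many compact simplices.\<close>

lemma locally_compact_cx_points: "locally_compact_space (top_of_set cx_points)"
  unfolding locally_compact_space_def
proof (intro ballI)
  fix t assume "t \<in> topspace (top_of_set cx_points)"
  then obtain \<sigma> where \<sigma>: "\<sigma> \<in> K" "t \<in> simplex_points \<sigma>"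
    by (auto simp: cx_points_def)
  then obtain v where v: "t v > 0"
    using simplex_points_ex_pos by blast
  define C where "C = (\<Union>\<sigma>\<in>{\<sigma>\<in>K. v \<in> \<sigma>}. simplex_points \<sigma>)"
  have "compact C"
    unfolding C_def using finite_star compact_simplex_points by (intro compact_UN) auto
  then have "compactin (top_of_set cx_points) C"
    by (auto simp: compactin_subtopology C_def cx_points_def)
  moreover have "openin (top_of_set cx_points) (cx_points \<inter> {t. t v > 0})"
    using open_coordinate_pos by (rule openin_open_Int)
  moreover have "cx_points \<inter> {t. t v > 0} \<subseteq> C"
    using simplex_points_pos by (fastforce simp: C_def cx_points_def)
  moreover have "t \<in> cx_points \<inter> {t. t v > 0}"
    using \<sigma> v by (auto simp: cx_points_def)
  ultimately show "\<exists>U C. openin (top_of_set cx_points) U \<and> compactin (top_of_set cx_points) C \<and> t \<in> U \<and> U \<subseteq> C"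
    by blast
qed

lemma Polish_cx_points: "Polish_space (top_of_set cx_points)"
proof -
  have "completely_metrizable_space (top_of_set cx_points)"
    using locally_compact_cx_points
    by (intro locally_compact_imp_completely_metrizable_space metrizable_space_subtopology metrizable_space_euclidean)
  moreover have "separable_space (top_of_set cx_points)"
    by (intro second_countable_imp_separable_space second_countable_subtopology second_countable_euclidean)
  ultimately show ?thesis
    by (simp add: Polish_space_def)
qed

section \<open>Canonical paths between points that share a vertex\<close>

definition overlap :: "(nat \<Rightarrow> real) \<Rightarrow> (nat \<Rightarrow> real) \<Rightarrow> real" where
  "overlap p q = (\<Sum>w | p w \<noteq> 0. min (p w) (q w))"

definition midpoint_of :: "(nat \<Rightarrow> real) \<Rightarrow> (nat \<Rightarrow> real) \<Rightarrow> nat \<Rightarrow> real" where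
  "midpoint_of p q w = min (p w) (q w) / overlap p q"

text \<open>If \<open>p\<close> and \<open>q\<close> share a vertex then \<open>midpoint_of p q\<close> lies in a common face of their simplices, so that the
  two segments from it to \<open>p\<close> and to \<open>q\<close> stay in the complex.\<close>

definition link_path :: "(nat \<Rightarrow> real) \<Rightarrow> (nat \<Rightarrow> real) \<Rightarrow> real \<Rightarrow> nat \<Rightarrow> real" where
  "link_path p q u w = max 0 (1 - 2*u) * p w + (1 - \<bar>1 - 2*u\<bar>) * midpoint_of p q w + max 0 (2*u - 1) * q w"

text \<open>The defining sum runs over the support of \<open>p\<close> in order to be finite without
  mention of a simplex. It can be moved to any finite set that contains the common support, and
  \<open>star_verts v\<close> is such a set for all pairs with \<open>p v > 0\<close>
  simultaneously.\<close>

lemma overlap_eq: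
  assumes "finite A" "\<And>w. p w \<ge> 0" "\<And>w. q w \<ge> 0" "finite {w. p w \<noteq> 0}" "\<And>w. w \<notin> A \<Longrightarrow> p w = 0 \<or> q w = 0"
  shows "overlap p q = (\<Sum>w\<in>A. min (p w) (q w))"
proof -
  have zero: "min (p w) (q w) = 0" if "w \<notin> A \<or> p w = 0" for w
    using assms(2,3)[of w] assms(5)[of w] that by (auto simp: min_def)
  have "overlap p q = (\<Sum>w\<in>A \<inter> {w. p w \<noteq> 0}. min (p w) (q w))"
    unfolding overlap_def using assms(4) zero by (intro sum.mono_neutral_right) auto
  also have "\<dots> = (\<Sum>w\<in>A. min (p w) (q w))"
    using assms(1) zero by (intro sum.mono_neutral_left) blast+
  finally show ?thesis .
qed

lemma simplex_points_nonneg: "p \<in> simplex_points \<sigma> \<Longrightarrow> p w \<ge> 0"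
  by (simp add: simplex_points_def)

lemma finite_support: "\<sigma> \<in> K \<Longrightarrow> p \<in> simplex_points \<sigma> \<Longrightarrow> finite {w. p w \<noteq> 0}"
  by (rule finite_subset[of _ \<sigma>]) (auto simp: simplex_points_def finite_simplex)

text \<open>The pointwise minimum vanishes off either simplex, and the shared vertex gives it
  positive mass, so it can be normalised.\<close>

lemma midpoint_of_simplex:
  assumes p: "\<sigma> \<in> K" "p \<in> simplex_points \<sigma>" and q: "\<tau> \<in> K" "q \<in> simplex_points \<tau>"
    and v: "p v > 0" "q v > 0"
  shows "midpoint_of p q \<in> simplex_points \<sigma>" "midpoint_of p q \<in> simplex_points \<tau>"
proof -
  have nn: "p w \<ge> 0" "q w \<ge> 0" for w
    using simplex_points_nonneg[OF p(2)] simplex_points_nonneg[OF q(2)] by simp_all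
  have \<sigma>: "overlap p q = (\<Sum>w\<in>\<sigma>. min (p w) (q w))"
    using p nn finite_support[OF p] by (intro overlap_eq) (auto simp: simplex_points_def finite_simplex)
  have \<tau>: "overlap p q = (\<Sum>w\<in>\<tau>. min (p w) (q w))"
    using p q nn finite_support[OF p] by (intro overlap_eq) (auto simp: simplex_points_def finite_simplex)
  have "v \<in> \<sigma>"
    using simplex_points_pos[OF p(2) v(1)] .
  then have "min (p v) (q v) \<le> overlap p q"
    unfolding \<sigma> using nn p finite_simplex by (intro member_le_sum) auto
  then have pos: "overlap p q > 0"
    using v by linarith
  have "midpoint_of p q w \<ge> 0" for w
    using nn pos by (simp add: midpoint_of_def)
  moreover have "midpoint_of p q w = 0" if "w \<notin> \<sigma> \<or> w \<notin> \<tau>" for w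
    using that p q nn[of w] by (auto simp: midpoint_of_def simplex_points_def)
  moreover have "(\<Sum>w\<in>\<sigma>. midpoint_of p q w) = 1" "(\<Sum>w\<in>\<tau>. midpoint_of p q w) = 1"
    using \<sigma> \<tau> pos by (simp_all add: midpoint_of_def sum_divide_distrib[symmetric])
  ultimately show "midpoint_of p q \<in> simplex_points \<sigma>" "midpoint_of p q \<in> simplex_points \<tau>"
    by (auto simp: simplex_points_def)
qed

lemma simplex_points_convex:
  assumes "p \<in> simplex_points \<sigma>" "q \<in> simplex_points \<sigma>" "a \<ge> 0" "b \<ge> 0" "a + b = 1"
  shows "(\<lambda>w. a * p w + b * q w) \<in> simplex_points \<sigma>"
  using assms by (auto simp: simplex_points_def sum.distrib sum_distrib_left[symmetric])

lemma link_path_in: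
  assumes "p \<in> cx_points" "q \<in> cx_points" "p v > 0" "q v > 0" "0 \<le> u" "u \<le> 1"
  shows "link_path p q u \<in> cx_points"
proof -
  obtain \<sigma> \<tau> where p: "\<sigma> \<in> K" "p \<in> simplex_points \<sigma>" and q: "\<tau> \<in> K" "q \<in> simplex_points \<tau>"
    using assms by (auto simp: cx_points_def)
  note mid = midpoint_of_simplex[OF p q assms(3,4)]
  show ?thesis
  proof (cases "u \<le> 1/2")
    case True
    have "link_path p q u = (\<lambda>w. (1 - 2*u) * p w + (2*u) * midpoint_of p q w)"
      using True by (auto simp: link_path_def fun_eq_iff)
    also have "\<dots> \<in> simplex_points \<sigma>"
      using True assms by (intro simplex_points_convex p mid) auto
    finally show ?thesis
      using p by (auto simp: cx_points_def)
  next
    case False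
    have "link_path p q u = (\<lambda>w. (2 - 2*u) * midpoint_of p q w + (2*u - 1) * q w)"
      using False by (auto simp: link_path_def fun_eq_iff)
    also have "\<dots> \<in> simplex_points \<tau>"
      using False assms by (intro simplex_points_convex q mid) auto
    finally show ?thesis
      using q by (auto simp: cx_points_def)
  qed
qed

text \<open>A point has overlap 1 with itself and is its own midpoint; the three time weights in
  \<open>link_path\<close> add up to 1.\<close>

lemma link_path_same:
  assumes "p \<in> cx_points"
  shows "link_path p p u = p"
proof -
  obtain \<sigma> where p: "\<sigma> \<in> K" "p \<in> simplex_points \<sigma>"
    using assms by (auto simp: cx_points_def)
  have "overlap p p = (\<Sum>w\<in>\<sigma>. min (p w) (p w))"
    using p finite_support[OF p] by (intro overlap_eq) (auto simp: simplex_points_def finite_simplex)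
  then have "overlap p p = 1"
    using p by (simp add: simplex_points_def)
  then have "link_path p p u w = (max 0 (1 - 2*u) + (1 - \<bar>1 - 2*u\<bar>) + max 0 (2*u - 1)) * p w" for w
    by (simp add: link_path_def midpoint_of_def algebra_simps)
  moreover have "max 0 (1 - 2*u) + (1 - \<bar>1 - 2*u\<bar>) + max 0 (2*u - 1) = 1"
    by (auto simp: max_def abs_if)
  ultimately show ?thesis
    by (simp add: fun_eq_iff)
qed

definition sharing :: "((nat \<Rightarrow> real) \<times> (nat \<Rightarrow> real)) set" where
  "sharing = (cx_points \<times> cx_points) \<inter> (\<Union>v. {z. fst z v > 0 \<and> snd z v > 0})"

lemma open_both_pos: "open {z :: (nat \<Rightarrow> real) \<times> (nat \<Rightarrow> real). fst z v > 0 \<and> snd z v > 0}"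
  by (intro open_Collect_conj open_Collect_less continuous_on_const
      continuous_on_product_then_coordinatewise[OF continuous_on_fst[OF continuous_on_id]]
      continuous_on_product_then_coordinatewise[OF continuous_on_snd[OF continuous_on_id]])

text \<open>The number of terms in \<open>overlap\<close> varies with the pair. On the open set
  \<open>T v\<close> it can be written as a sum over the fixed finite set
  \<open>star_verts v\<close>, so that the path is given by one continuous formula there; these sets
  cover the domain.\<close>

lemma continuous_on_link_path:
  "continuous_on (sharing \<times> {0..1}) (\<lambda>z. link_path (fst (fst z)) (snd (fst z)) (snd z))"
proof -
  let ?D = "sharing \<times> {0..1::real}"
  let ?f = "\<lambda>z. link_path (fst (fst z)) (snd (fst z)) (snd z)"
  define T where "T v = ?D \<inter> {z. fst (fst z) v > 0 \<and> snd (fst z) v > 0}" for v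
  have cf: "continuous_on A (\<lambda>z. fst (fst z) w)" and cs: "continuous_on A (\<lambda>z. snd (fst z) w)"
    for w and A :: "(((nat \<Rightarrow> real) \<times> (nat \<Rightarrow> real)) \<times> real) set"
    by (rule continuous_on_product_then_coordinatewise; intro continuous_intros)+
  have "continuous_map (top_of_set ?D) euclidean ?f"
  proof (rule pasting_lemma[where I=UNIV and T=T and f="\<lambda>_. ?f"])
    fix v
    have "open {z :: ((nat \<Rightarrow> real) \<times> (nat \<Rightarrow> real)) \<times> real. fst (fst z) v > 0 \<and> snd (fst z) v > 0}"
      by (intro open_Collect_conj open_Collect_less continuous_on_const cf cs)
    then show "openin (top_of_set ?D) (T v)"
      unfolding T_def by (rule openin_open_Int)
    have eq: "overlap p q = (\<Sum>w\<in>star_verts v. min (p w) (q w)) \<and> overlap p q > 0"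
      if pq: "p \<in> cx_points" "q \<in> cx_points" "p v > 0" "q v > 0" for p q
    proof -
      obtain \<sigma> \<tau> where p: "\<sigma> \<in> K" "p \<in> simplex_points \<sigma>" and q: "\<tau> \<in> K" "q \<in> simplex_points \<tau>"
        using pq by (auto simp: cx_points_def)
      have sub: "\<sigma> \<subseteq> star_verts v" "v \<in> star_verts v"
        using simplex_points_pos[OF p(2) that(3)] p by (auto simp: star_verts_def)
      have nn: "p w \<ge> 0" "q w \<ge> 0" for w
        using simplex_points_nonneg[OF p(2)] simplex_points_nonneg[OF q(2)] by simp_all
      have *: "overlap p q = (\<Sum>w\<in>star_verts v. min (p w) (q w))"
        using p nn sub finite_support[OF p] finite_star_verts
        by (intro overlap_eq) (auto simp: simplex_points_def)
      have "min (p v) (q v) \<le> overlap p q"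
        unfolding * using nn sub finite_star_verts by (intro member_le_sum) auto
      with * that show ?thesis
        by linarith
    qed
    define G :: "((nat \<Rightarrow> real) \<times> (nat \<Rightarrow> real)) \<times> real \<Rightarrow> nat \<Rightarrow> real" where
      "G z w = max 0 (1 - 2 * snd z) * fst (fst z) w
        + (1 - \<bar>1 - 2 * snd z\<bar>) * (min (fst (fst z) w) (snd (fst z) w) / (\<Sum>w\<in>star_verts v. min (fst (fst z) w) (snd (fst z) w)))
        + max 0 (2 * snd z - 1) * snd (fst z) w" for z w
    have mass: "(\<Sum>w\<in>star_verts v. min (fst (fst z) w) (snd (fst z) w)) = overlap (fst (fst z)) (snd (fst z))"
      "overlap (fst (fst z)) (snd (fst z)) > 0" if "z \<in> T v" for z
      using that eq[of "fst (fst z)" "snd (fst z)"] by (auto simp: T_def sharing_def)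
    have "continuous_on (T v) (\<lambda>z. G z w)" for w
    proof -
      have "(\<Sum>w\<in>star_verts v. min (fst (fst z) w) (snd (fst z) w)) \<noteq> 0" if "z \<in> T v" for z
        using mass[OF that] by simp
      then show ?thesis
        unfolding G_def by (intro continuous_intros cf cs) auto
    qed
    then have "continuous_on (T v) G"
      by (rule continuous_on_coordinatewise_then_product)
    then have "continuous_on (T v) ?f"
    proof (rule continuous_on_eq)
      fix z assume "z \<in> T v"
      then show "G z = ?f z"
        using mass by (simp add: G_def link_path_def midpoint_of_def fun_eq_iff)
    qed
    moreover have "?D \<inter> T v = T v"
      by (auto simp: T_def)
    ultimately show "continuous_map (subtopology (top_of_set ?D) (T v)) euclidean ?f"
      by (simp add: subtopology_subtopology)
  next
    fix z assume "z \<in> topspace (top_of_set ?D)"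
    then show "\<exists>v. v \<in> UNIV \<and> z \<in> T v \<and> ?f z = ?f z"
      by (auto simp: T_def sharing_def)
  qed auto
  then show ?thesis
    by simp
qed

lemma locally_equiconnected_cx_points: "locally_equiconnected (top_of_set cx_points)"
  unfolding locally_equiconnected_def
proof (intro exI[of _ sharing] exI[of _ link_path] conjI)
  let ?P = "top_of_set cx_points"
  have PP: "prod_topology ?P ?P = top_of_set (cx_points \<times> cx_points)"
    by (simp add: subtopology_Times)
  show "openin (prod_topology ?P ?P) sharing"
    unfolding PP sharing_def using open_both_pos by (intro openin_open_Int open_UN) auto
  show "\<forall>p\<in>topspace ?P. (p, p) \<in> sharing"
  proof
    fix p assume p: "p \<in> topspace ?P"
    then obtain \<sigma> where "p \<in> simplex_points \<sigma>"
      by (auto simp: cx_points_def)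
    then obtain v where "p v > 0"
      using simplex_points_ex_pos by blast
    with p show "(p, p) \<in> sharing"
      by (auto simp: sharing_def)
  qed
  have "subtopology (prod_topology ?P ?P) sharing = top_of_set sharing"
    unfolding PP subtopology_subtopology by (simp add: sharing_def Int_absorb1)
  then have "prod_topology (subtopology (prod_topology ?P ?P) sharing) (top_of_set {0..1::real}) = top_of_set (sharing \<times> {0..1})"
    by (simp add: subtopology_Times)
  moreover have "link_path p q u \<in> cx_points" if "(p, q) \<in> sharing" "u \<in> {0..1}" for p q u
    using that link_path_in by (auto simp: sharing_def)
  ultimately show "continuous_map (prod_topology (subtopology (prod_topology ?P ?P) sharing) (top_of_set {0..1::real})) ?P
       (\<lambda>z. link_path (fst (fst z)) (snd (fst z)) (snd z))"
    using continuous_on_link_path by (auto simp: continuous_map_in_subtopology)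
  show "\<forall>(p, q)\<in>sharing. link_path p q 0 = p \<and> link_path p q 1 = q"
    by (auto simp: link_path_def fun_eq_iff)
  show "\<forall>p\<in>topspace ?P. \<forall>u\<in>{0..1}. link_path p p u = p"
    using link_path_same by simp
qed

end

theorem polyhedron_Polish_locally_equiconnected:
  assumes "polyhedron P"
  shows "Polish_space P" "locally_equiconnected P"
proof -
  obtain K :: "nat set set" where K: "abstract_complex K" "locally_finite_complex K" "P homeomorphic_space realization K"
    using assms unfolding polyhedron_def by blast
  then have hom: "P homeomorphic_space top_of_set (cx_points K)"
    using realization_eq by metis
  show "Polish_space P"
    using Polish_cx_points[OF K(1,2)] homeomorphic_separable_space[OF hom] homeomorphic_completely_metrizable_space[OF hom]
    by (simp add: Polish_space_def)
  show "locally_equiconnected P"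
    using locally_equiconnected_homeomorphic[OF hom locally_equiconnected_cx_points[OF K(1,2)]] .
qed

section \<open>The metric of uniform convergence on compact sets\<close>

lemma compactin_subcover_image:
  assumes C: "compactin X C" and V: "\<And>i. i \<in> I \<Longrightarrow> openin X (V i)" and sub: "C \<subseteq> (\<Union>i\<in>I. V i)"
  obtains F where "finite F" "F \<subseteq> I" "C \<subseteq> (\<Union>i\<in>F. V i)"
proof -
  have "\<forall>U\<in>V ` I. openin X U"
    using V by auto
  then obtain \<F> where \<F>: "finite \<F>" "\<F> \<subseteq> V ` I" "C \<subseteq> \<Union>\<F>"
    using C sub unfolding compactin_def by metis
  then obtain F where "F \<subseteq> I" "finite F" "\<F> = V ` F"
    using finite_subset_image[OF \<F>(1,2)] by blast
  with \<F>(3) that show ?thesis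
    by blast
qed

text \<open>The Lebesgue number argument for an arbitrary predicate that persists when the radius
  shrinks.\<close>

lemma compact_uniform_radius:
  assumes C: "compactin Z C"
    and loc: "\<And>z. z \<in> C \<Longrightarrow> \<exists>r>0. \<exists>V. openin Z V \<and> z \<in> V \<and> (\<forall>z'\<in>V \<inter> C. Q r z')"
    and anti: "\<And>r r' z. 0 < r' \<Longrightarrow> r' \<le> r \<Longrightarrow> Q r z \<Longrightarrow> Q (r'::real) z"
  shows "\<exists>r>0. \<forall>z\<in>C. Q r z"
proof -
  have "\<forall>z\<in>C. \<exists>r V. r > 0 \<and> openin Z V \<and> z \<in> V \<and> (\<forall>z'\<in>V \<inter> C. Q r z')"
    using loc by blast
  then obtain r V where rV: "\<And>z. z \<in> C \<Longrightarrow> r z > 0 \<and> openin Z (V z) \<and> z \<in> V z \<and> (\<forall>z'\<in>V z \<inter> C. Q (r z) z')"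
    by metis
  obtain F where F: "finite F" "F \<subseteq> C" "C \<subseteq> \<Union>(V ` F)"
    by (rule compactin_subcover_image[OF C, of C V]) (use rV in blast)+
  \<comment> \<open>The extra 1 provides a positive value when the subcover is empty.\<close>
  define \<rho> where "\<rho> = Min (insert 1 (r ` F))"
  have "\<rho> > 0"
    using F rV by (auto simp: \<rho>_def)
  moreover have "Q \<rho> z" if "z \<in> C" for z
  proof -
    obtain x where x: "x \<in> F" "z \<in> V x"
      using F(3) \<open>z \<in> C\<close> by blast
    then have "\<rho> \<le> r x"
      using F by (auto simp: \<rho>_def)
    moreover have "Q (r x) z"
      using rV[of x] x F that by blast
    ultimately show ?thesis
      using anti \<open>\<rho> > 0\<close> by blast
  qed
  ultimately show ?thesis
    by blast
qed

text \<open>A Lebesgue number for the graph of a pair of maps over a compact set. The pair makes it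
  serve for a single target (\<open>W = U \<times> M\<close>), for neighbourhoods of the diagonal,
  and for preimages under a binary operation.\<close>

lemma (in Metric_space) compact_graph_margin:
  assumes f: "continuous_map X mtopology f" and g: "continuous_map X mtopology g" and C: "compactin X C"
    and W: "openin (prod_topology mtopology mtopology) W" and sub: "\<And>x. x \<in> C \<Longrightarrow> (f x, g x) \<in> W"
  shows "\<exists>\<eta>>0. \<forall>x\<in>C. \<forall>p\<in>M. \<forall>q\<in>M. d (f x) p < \<eta> \<longrightarrow> d (g x) q < \<eta> \<longrightarrow> (p, q) \<in> W"
proof (rule compact_uniform_radius[OF C])
  fix x assume x: "x \<in> C"
  then have xX: "x \<in> topspace X"
    using C compactin_subset_topspace by blast
  obtain U V where UV: "openin mtopology U" "openin mtopology V" "f x \<in> U" "g x \<in> V" "U \<times> V \<subseteq> W"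
    using W sub[OF x] unfolding openin_prod_topology_alt by metis
  obtain r1 where r1: "r1 > 0" "mball (f x) r1 \<subseteq> U"
    using UV unfolding openin_mtopology by blast
  obtain r2 where r2: "r2 > 0" "mball (g x) r2 \<subseteq> V"
    using UV unfolding openin_mtopology by blast
  \<comment> \<open>Halved because the oscillation of the maps near \<open>x\<close> and the
    perturbation consume one \<open>r\<close> each.\<close>
  define r where "r = min r1 r2 / 2"
  have r: "r > 0" "2 * r \<le> r1" "2 * r \<le> r2"
    using r1 r2 by (auto simp: r_def)
  define T where "T = {y \<in> topspace X. f y \<in> mball (f x) r} \<inter> {y \<in> topspace X. g y \<in> mball (g x) r}"
  have M: "f x \<in> M" "g x \<in> M"
    using xX f g by (auto simp: continuous_map_def)
  show "\<exists>r>0. \<exists>V. openin X V \<and> x \<in> V \<and>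
       (\<forall>z\<in>V \<inter> C. \<forall>p\<in>M. \<forall>q\<in>M. d (f z) p < r \<longrightarrow> d (g z) q < r \<longrightarrow> (p, q) \<in> W)"
  proof (intro exI[of _ r] exI[of _ T] conjI ballI impI)
    show "openin X T"
      unfolding T_def using f g by (intro openin_Int openin_continuous_map_preimage) auto
    show "x \<in> T"
      using xX M r by (simp add: T_def)
    fix z p q assume z: "z \<in> T \<inter> C" "p \<in> M" "q \<in> M" "d (f z) p < r" "d (g z) q < r"
    have "d (f x) p < r1" "d (g x) q < r2"
      using z triangle[of "f x" "f z" p] triangle[of "g x" "g z" q] r by (auto simp: T_def)
    then have "p \<in> U" "q \<in> V"
      using r1 r2 M z by auto
    then show "(p, q) \<in> W"
      using UV by blast
  qed (use r in auto)
qed (meson order_less_le_trans)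

text \<open>The tube lemma: projection along a compact factor is closed, so the points whose fibre
  meets the complement of \<open>W\<close> form a closed set.\<close>

lemma open_tube:
  assumes "compact_space I" and "openin (prod_topology I X) W"
  shows "openin X {x \<in> topspace X. \<forall>t\<in>topspace I. (t, x) \<in> W}"
proof -
  have "closedin (prod_topology I X) (topspace I \<times> topspace X - W)"
    using assms(2) by (metis openin_closedin_eq topspace_prod_topology)
  then have "closedin X (snd ` (topspace I \<times> topspace X - W))"
    using closed_map_snd[OF assms(1), of X] by (auto simp: closed_map_def)
  then have "openin X (topspace X - snd ` (topspace I \<times> topspace X - W))"
    by blast
  moreover have "topspace X - snd ` (topspace I \<times> topspace X - W) = {x \<in> topspace X. \<forall>t\<in>topspace I. (t, x) \<in> W}"
    by force
  ultimately show ?thesis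
    by simp
qed

locale exhausted_space =
  fixes X :: "'a topology" and K :: "nat \<Rightarrow> 'a set"
  assumes compact_K: "compactin X (K n)"
    and K_Suc: "K n \<subseteq> X interior_of K (Suc n)"
    and K_cover: "topspace X \<subseteq> (\<Union>n. K n)"
begin

lemma K_mono: "m \<le> n \<Longrightarrow> K m \<subseteq> K n"
  using lift_Suc_mono_le[of K] K_Suc interior_of_subset by (metis subset_trans)

lemma K_subset: "K n \<subseteq> topspace X"
  using compact_K compactin_subset_topspace by blast

lemma compact_subset_K:
  assumes C: "compactin X C"
  obtains n where "C \<subseteq> K n"
proof -
  have "C \<subseteq> (\<Union>n. X interior_of K n)"
  proof
    fix x assume "x \<in> C"
    then obtain n where "x \<in> K n"
      using compactin_subset_topspace[OF C] K_cover by blast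
    then have "x \<in> X interior_of K (Suc n)"
      using K_Suc by blast
    then show "x \<in> (\<Union>n. X interior_of K n)"
      by blast
  qed
  then obtain F where F: "finite F" "C \<subseteq> (\<Union>n\<in>F. X interior_of K n)"
    using compactin_subcover_image[OF C, of UNIV "\<lambda>n. X interior_of K n"] by auto
  obtain m where "\<forall>n\<in>F. n \<le> m"
    using F finite_nat_set_iff_bounded_le by auto
  then have "X interior_of K n \<subseteq> K m" if "n \<in> F" for n
    using that K_mono[of n m] interior_of_subset[of X "K n"] by blast
  then have "C \<subseteq> K m"
    using F by blast
  then show ?thesis
    using that by blast
qed

end

section \<open>Metrization of the compact-open topology\<close>

locale metric_mapping_space = exhausted_space X K + Metric_space M d
  for X :: "'a topology" and K and M :: "'b set" and d
begin

definition weight :: "'a \<Rightarrow> real" where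
  "weight x = 1 / (real (LEAST n. x \<in> K n) + 1)"

text \<open>The weight takes values in \<open>(0,1]\<close> and tends to \<open>0\<close> at infinity, which is all that is needed for this
  capped supremum to metrize uniform convergence on compact sets; it need not be continuous.\<close>

definition mapd :: "('a \<Rightarrow> 'b) \<Rightarrow> ('a \<Rightarrow> 'b) \<Rightarrow> real" where
  "mapd f g = Sup (insert 0 ((\<lambda>x. min (d (f x) (g x)) (weight x)) ` topspace X))"

abbreviation "Maps \<equiv> map_set X mtopology"

lemma weight_pos: "weight x > 0" and weight_le_1: "weight x \<le> 1"
  by (auto simp: weight_def)

lemma weight_ge: "x \<in> K n \<Longrightarrow> weight x \<ge> 1 / (real n + 1)"
  unfolding weight_def by (intro divide_left_mono) (auto intro: Least_le)

lemma weight_le: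
  assumes "x \<in> topspace X" "x \<notin> K n"
  shows "weight x \<le> 1 / (real n + 1)"
proof -
  obtain m where "x \<in> K m"
    using assms K_cover by blast
  then have "x \<in> K (LEAST n. x \<in> K n)"
    by (rule LeastI)
  then have "n < (LEAST n. x \<in> K n)"
    using assms K_mono[of "LEAST n. x \<in> K n" n] by (meson not_less subsetD)
  then show ?thesis
    unfolding weight_def by (intro divide_left_mono) auto
qed

lemma bdd: "bdd_above (insert 0 ((\<lambda>x. min (d (f x) (g x)) (weight x)) ` topspace X))"
  using weight_le_1 by (intro bdd_aboveI[of _ 1]) (auto simp: min_le_iff_disj)

lemma mapd_least:
  assumes "\<epsilon> \<ge> 0" and "\<And>x. x \<in> topspace X \<Longrightarrow> min (d (f x) (g x)) (weight x) \<le> \<epsilon>"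
  shows "mapd f g \<le> \<epsilon>"
  unfolding mapd_def using assms by (intro cSup_least) auto

lemma mapd_upper: "x \<in> topspace X \<Longrightarrow> min (d (f x) (g x)) (weight x) \<le> mapd f g"
  unfolding mapd_def using bdd by (intro cSup_upper) auto

lemma mapd_nonneg: "mapd f g \<ge> 0"
  unfolding mapd_def using bdd by (intro cSup_upper) auto

lemma mapd_le_if_close_on:
  assumes "\<And>x. x \<in> K n \<Longrightarrow> d (f x) (g x) \<le> \<epsilon>" and "1 / (real n + 1) \<le> \<epsilon>"
  shows "mapd f g \<le> \<epsilon>"
proof (rule mapd_least)
  have "0 < 1 / (real n + 1)"
    by simp
  then show "\<epsilon> \<ge> 0"
    using assms(2) by linarith
  show "min (d (f x) (g x)) (weight x) \<le> \<epsilon>" if "x \<in> topspace X" for x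
    using assms weight_le[OF that, of n] by (cases "x \<in> K n") (auto simp: min_le_iff_disj)
qed

lemma close_on_if_mapd_less:
  assumes "mapd f g < \<epsilon>" "\<epsilon> \<le> 1 / (real n + 1)" "x \<in> K n"
  shows "d (f x) (g x) < \<epsilon>"
  using mapd_upper[of x f g] weight_ge[OF assms(3)] assms K_subset[of n] by (auto simp: min_le_iff_disj)

lemma in_Maps: "f \<in> Maps \<Longrightarrow> x \<in> topspace X \<Longrightarrow> f x \<in> M"
  by (auto simp: map_set_def continuous_map_def)

lemma Metric_space_mapd: "Metric_space Maps mapd"
proof
  show "0 \<le> mapd f g" "mapd f g = mapd g f" for f g
    using mapd_nonneg by (simp_all add: mapd_def commute)
  show "mapd f g = 0 \<longleftrightarrow> f = g" if "f \<in> Maps" "g \<in> Maps" for f g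
  proof
    assume 0: "mapd f g = 0"
    have "f x = g x" if "x \<in> topspace X" for x
    proof -
      have "d (f x) (g x) \<le> 0"
        using mapd_upper[OF that, of f g] weight_pos[of x] 0 by (auto simp: min_le_iff_disj)
      then show ?thesis
        using that in_Maps \<open>f \<in> Maps\<close> \<open>g \<in> Maps\<close> by (metis nonneg order_antisym zero)
    qed
    then show "f = g"
      using that by (intro extensionalityI[of _ "topspace X"]) (auto simp: map_set_def)
  next
    assume "f = g"
    then have "mapd f g \<le> 0"
      using that in_Maps by (intro mapd_least) (auto simp: min_le_iff_disj)
    then show "mapd f g = 0"
      using mapd_nonneg[of f g] by simp
  qed
  show "mapd f h \<le> mapd f g + mapd g h" if "f \<in> Maps" "g \<in> Maps" "h \<in> Maps" for f g h
  proof (rule mapd_least)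
    show "0 \<le> mapd f g + mapd g h"
      using mapd_nonneg[of f g] mapd_nonneg[of g h] by simp
    fix x assume x: "x \<in> topspace X"
    have "d (f x) (h x) \<le> d (f x) (g x) + d (g x) (h x)"
      using that x in_Maps triangle by blast
    then show "min (d (f x) (h x)) (weight x) \<le> mapd f g + mapd g h"
      using mapd_upper[OF x, of f g] mapd_upper[OF x, of g h] weight_pos[of x] mapd_nonneg[of f g] mapd_nonneg[of g h]
        nonneg[of "f x" "g x"] nonneg[of "g x" "h x"] by (auto simp: min_def split: if_splits)
  qed
qed

sublocale Map: Metric_space Maps mapd
  by (rule Metric_space_mapd)

text \<open>The compact set lies in some \<open>K n\<close>, where the weight is at least
  \<open>1 / (n + 1)\<close>; below this value the cap in \<open>mapd\<close> is inactive.\<close>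

lemma uniform_nbhd:
  assumes C: "compactin X C" and "\<epsilon> > 0"
  obtains r where "r > 0" "\<And>f g x. mapd f g < r \<Longrightarrow> x \<in> C \<Longrightarrow> d (f x) (g x) < \<epsilon>"
proof -
  obtain n where n: "C \<subseteq> K n"
    using compact_subset_K[OF C] .
  let ?r = "min \<epsilon> (1 / (real n + 1))"
  have "?r > 0"
    using assms by auto
  moreover have "d (f x) (g x) < \<epsilon>" if "mapd f g < ?r" "x \<in> C" for f g x
    using close_on_if_mapd_less[OF that(1), of n x] n that by auto
  ultimately show ?thesis
    using that by blast
qed

text \<open>Off \<open>K n\<close> the cap alone bounds the terms by \<open>1 / (n + 1)\<close>, so
  a single compact set has to be inspected to make \<open>mapd\<close> small.\<close>

lemma uniform_control:
  assumes "\<epsilon> > 0"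
  obtains n where "\<And>f g. (\<And>x. x \<in> K n \<Longrightarrow> d (f x) (g x) \<le> \<epsilon>/2) \<Longrightarrow> mapd f g < \<epsilon>"
proof -
  obtain n where n: "1 / real (Suc n) < \<epsilon>/2"
    using nat_approx_posE[of "\<epsilon>/2"] assms by (metis half_gt_zero)
  have "mapd f g < \<epsilon>" if "\<And>x. x \<in> K n \<Longrightarrow> d (f x) (g x) \<le> \<epsilon>/2" for f g
  proof -
    have "mapd f g \<le> \<epsilon>/2"
      using n by (intro mapd_le_if_close_on[of n] that) (auto simp: add.commute)
    then show ?thesis
      using assms by linarith
  qed
  then show ?thesis
    using that by blast
qed

lemma compact_open_imp_mapd_open:
  assumes C: "compactin X C" and U: "openin mtopology U"
  shows "openin Map.mtopology {f \<in> Maps. f ` C \<subseteq> U}"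
  unfolding Map.openin_mtopology
proof (intro conjI allI impI)
  fix f assume f: "f \<in> {f \<in> Maps. f ` C \<subseteq> U}"
  then have fc: "continuous_map X mtopology f"
    by (simp add: map_set_def)
  have "openin (prod_topology mtopology mtopology) (U \<times> M)"
    using U by (simp add: openin_prod_Times_iff)
  moreover have "(f x, f x) \<in> U \<times> M" if "x \<in> C" for x
    using that f openin_subset[OF U] by auto
  ultimately obtain \<eta> where \<eta>: "\<eta> > 0"
      "\<forall>x\<in>C. \<forall>p\<in>M. \<forall>q\<in>M. d (f x) p < \<eta> \<longrightarrow> d (f x) q < \<eta> \<longrightarrow> (p, q) \<in> U \<times> M"
    using compact_graph_margin[OF fc fc C] by blast
  obtain r where r: "r > 0" "\<And>f g x. mapd f g < r \<Longrightarrow> x \<in> C \<Longrightarrow> d (f x) (g x) < \<eta>"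
    using uniform_nbhd[OF C \<eta>(1)] by blast
  have "g x \<in> U" if "g \<in> Maps" "mapd f g < r" "x \<in> C" for g x
  proof -
    have "g x \<in> M" "d (f x) (g x) < \<eta>"
      using that r(2) in_Maps[of g x] compactin_subset_topspace[OF C] by auto
    then show ?thesis
      using \<eta>(2) that(3) by blast
  qed
  then show "\<exists>r>0. Map.mball f r \<subseteq> {f \<in> Maps. f ` C \<subseteq> U}"
    using r(1) by (intro exI[of _ r]) auto
qed auto

lemma mapd_open_imp_compact_open:
  assumes U: "openin Map.mtopology U"
  shows "openin (compact_open_topology X mtopology) U"
proof (subst openin_subopen, intro ballI)
  fix f assume f: "f \<in> U"
  then obtain \<epsilon> where \<epsilon>: "\<epsilon> > 0" "Map.mball f \<epsilon> \<subseteq> U" and fM: "f \<in> Maps"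
    using U unfolding Map.openin_mtopology by blast
  then have fc: "continuous_map X mtopology f"
    by (simp add: map_set_def)
  obtain n where n: "\<And>f g. (\<And>x. x \<in> K n \<Longrightarrow> d (f x) (g x) \<le> \<epsilon>/2) \<Longrightarrow> mapd f g < \<epsilon>"
    using uniform_control[OF \<epsilon>(1)] by blast
  define V where "V x = {y \<in> topspace X. f y \<in> mball (f x) (\<epsilon>/8)}" for x
  \<comment> \<open>Closed balls make \<open>C x\<close> compact, hence admissible in a basic open
    set, and still \<open>C x\<close> contains \<open>V x \<inter> K n\<close>. A map in the
    resulting neighbourhood differs from \<open>f\<close> on \<open>K n\<close> by less than
    \<open>\<epsilon>/8 + \<epsilon>/4\<close>.\<close>
  define C where "C x = K n \<inter> {y \<in> topspace X. f y \<in> mcball (f x) (\<epsilon>/8)}" for x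
  have V: "openin X (V x)" for x
    unfolding V_def using fc by (intro openin_continuous_map_preimage) auto
  have "x \<in> V x" if "x \<in> K n" for x
    using that \<epsilon> K_subset[of n] in_Maps[OF fM] by (auto simp: V_def)
  then have "K n \<subseteq> (\<Union>x\<in>K n. V x)"
    by blast
  then obtain F where F: "finite F" "F \<subseteq> K n" "K n \<subseteq> \<Union>(V ` F)"
    by (rule compactin_subcover_image[OF compact_K[of n] V])
  have C: "compactin X (C x)" for x
    unfolding C_def using fc compact_K by (intro compact_Int_closedin closedin_continuous_map_preimage) auto
  define T where "T = Maps \<inter> (\<Inter>x\<in>F. {g \<in> Maps. g ` C x \<subseteq> mball (f x) (\<epsilon>/4)})"
  have "openin (compact_open_topology X mtopology) {g \<in> Maps. g ` C x \<subseteq> mball (f x) (\<epsilon>/4)}" for x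
    unfolding compact_open_topology_def by (rule topology_generated_by_Basis) (use C in blast)
  then have "openin (compact_open_topology X mtopology) T"
  proof -
    have "openin (compact_open_topology X mtopology) Maps"
      using openin_topspace[of "compact_open_topology X mtopology"] by (simp add: topspace_compact_open_topology)
    moreover have "T = \<Inter>(insert Maps ((\<lambda>x. {g \<in> Maps. g ` C x \<subseteq> mball (f x) (\<epsilon>/4)}) ` F))"
      by (auto simp: T_def)
    moreover have "openin (compact_open_topology X mtopology) \<dots>"
      using F(1) calculation(1) \<open>\<And>x. openin _ {g \<in> Maps. g ` C x \<subseteq> mball (f x) (\<epsilon>/4)}\<close>
      by (intro openin_Inter) auto
    ultimately show ?thesis
      by simp
  qed
  moreover have "f \<in> T"
    using fM \<epsilon> F K_subset[of n] in_Maps[OF fM] by (auto simp: T_def C_def)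
  moreover have "T \<subseteq> U"
  proof
    fix g assume g: "g \<in> T"
    have "d (f x) (g x) \<le> \<epsilon>/2" if x: "x \<in> K n" for x
    proof -
      obtain z where z: "z \<in> F" "x \<in> V z"
        using F x by blast
      then have "x \<in> C z"
        using x by (auto simp: C_def V_def)
      moreover have "g ` C z \<subseteq> mball (f z) (\<epsilon>/4)"
        using g z(1) by (simp add: T_def)
      ultimately have "g x \<in> mball (f z) (\<epsilon>/4)"
        by blast
      then have "d (f z) (g x) < \<epsilon>/4" "g x \<in> M" "f z \<in> M"
        by simp_all
      moreover have "d (f z) (f x) < \<epsilon>/8" "f x \<in> M"
        using z by (auto simp: V_def)
      ultimately show ?thesis
        using triangle''[of "f x" "f z" "g x"] \<epsilon> by linarith
    qed
    then have "mapd f g < \<epsilon>"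
      using n by blast
    then show "g \<in> U"
      using g \<epsilon> fM by (auto simp: T_def)
  qed
  ultimately show "\<exists>T. openin (compact_open_topology X mtopology) T \<and> f \<in> T \<and> T \<subseteq> U"
    by blast
qed

theorem mtopology_mapd: "Map.mtopology = compact_open_topology X mtopology"
proof -
  have "openin Map.mtopology U" if "openin (compact_open_topology X mtopology) U" for U
    using that[unfolded compact_open_topology_def openin_topology_generated_by_iff]
  proof (induction rule: generate_topology_on.induct)
    case (Basis s)
    then show ?case
      using compact_open_imp_mapd_open by auto
  qed auto
  then show ?thesis
    using mapd_open_imp_compact_open by (auto simp: topology_eq)
qed

section \<open>Completeness and separability of mapping spaces\<close>

theorem mcomplete_mapd:
  assumes mcomplete
  shows "Map.mcomplete"
  unfolding Map.mcomplete_def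
proof (intro allI impI)
  fix \<sigma> assume \<sigma>: "Map.MCauchy \<sigma>"
  then have \<sigma>M: "\<sigma> i \<in> Maps" for i
    unfolding Map.MCauchy_def by blast
  have cauchy: "\<exists>N. \<forall>i\<ge>N. \<forall>j\<ge>N. \<forall>x\<in>C. d (\<sigma> i x) (\<sigma> j x) < \<epsilon>" if C: "compactin X C" and "\<epsilon> > 0" for C \<epsilon>
  proof -
    obtain r where "r > 0" "\<And>f g x. mapd f g < r \<Longrightarrow> x \<in> C \<Longrightarrow> d (f x) (g x) < \<epsilon>"
      using uniform_nbhd[OF C \<open>\<epsilon> > 0\<close>] by blast
    then show ?thesis
      using \<sigma> unfolding Map.MCauchy_def by meson
  qed
  have "\<exists>l. limitin mtopology (\<lambda>i. \<sigma> i x) l sequentially" if x: "x \<in> topspace X" for x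
  proof -
    have "MCauchy (\<lambda>i. \<sigma> i x)"
      unfolding MCauchy_def using cauchy[of "{x}"] \<sigma>M in_Maps x by fastforce
    then show ?thesis
      using assms by (simp add: mcomplete_def)
  qed
  then obtain l where l: "\<And>x. x \<in> topspace X \<Longrightarrow> limitin mtopology (\<lambda>i. \<sigma> i x) (l x) sequentially"
    by metis
  define f where "f = restrict l (topspace X)"
  have lM: "l x \<in> M" if "x \<in> topspace X" for x
    using l[OF that] limitin_mspace by blast
  have unif: "\<exists>N. \<forall>i\<ge>N. \<forall>x\<in>C. d (\<sigma> i x) (f x) \<le> \<epsilon>" if C: "compactin X C" and "\<epsilon> > 0" for C \<epsilon>
  proof -
    obtain N where N: "\<And>i j x. i \<ge> N \<Longrightarrow> j \<ge> N \<Longrightarrow> x \<in> C \<Longrightarrow> d (\<sigma> i x) (\<sigma> j x) < \<epsilon>/2"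
      using cauchy[OF C, of "\<epsilon>/2"] \<open>\<epsilon> > 0\<close> by auto
    have "d (\<sigma> i x) (f x) \<le> \<epsilon>" if i: "i \<ge> N" and x: "x \<in> C" for i x
    proof -
      have xX: "x \<in> topspace X"
        using x C compactin_subset_topspace by blast
      obtain N' where "\<forall>n\<ge>N'. \<sigma> n x \<in> M \<and> d (\<sigma> n x) (l x) < \<epsilon>/2"
        using l[OF xX] \<open>\<epsilon> > 0\<close> unfolding limit_metric_sequentially by (meson half_gt_zero)
      then have "d (\<sigma> (max N N') x) (l x) < \<epsilon>/2"
        by simp
      moreover have "d (\<sigma> i x) (\<sigma> (max N N') x) < \<epsilon>/2"
        using N i x by simp
      ultimately show ?thesis
        using triangle[of "\<sigma> i x" "\<sigma> (max N N') x" "l x"] in_Maps[OF \<sigma>M xX] lM[OF xX] xX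
        by (simp add: f_def)
    qed
    then show ?thesis
      by blast
  qed
  have "continuous_map X mtopology l"
    unfolding continuous_map_to_metric
  proof (intro ballI allI impI)
    fix x and \<epsilon>::real assume x: "x \<in> topspace X" and "\<epsilon> > 0"
    then obtain n where n: "x \<in> K n"
      using K_cover by blast
    \<comment> \<open>The estimate is taken on \<open>K (Suc n)\<close>, which is a neighbourhood of
      \<open>x\<close>, as \<open>K n\<close> need not be one.\<close>
    obtain i where i: "\<And>x. x \<in> K (Suc n) \<Longrightarrow> d (\<sigma> i x) (f x) \<le> \<epsilon>/4"
      using unif[OF compact_K, of "\<epsilon>/4" "Suc n"] \<open>\<epsilon> > 0\<close> by auto
    have "continuous_map X mtopology (\<sigma> i)"
      using \<sigma>M by (simp add: map_set_def)
    then obtain U where U: "openin X U" "x \<in> U" "\<forall>y\<in>U. \<sigma> i y \<in> mball (\<sigma> i x) (\<epsilon>/4)"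
      using x \<open>\<epsilon> > 0\<close> unfolding continuous_map_to_metric by (metis zero_less_divide_iff zero_less_numeral)
    have xi: "x \<in> X interior_of K (Suc n)"
      using n K_Suc by blast
    have "l y \<in> mball (l x) \<epsilon>" if y: "y \<in> U \<inter> X interior_of K (Suc n)" for y
    proof -
      have K: "y \<in> K (Suc n)" "x \<in> K (Suc n)"
        using y xi interior_of_subset[of X "K (Suc n)"] by blast+
      then have X: "y \<in> topspace X"
        using K_subset by blast
      have "d (\<sigma> i y) (l y) \<le> \<epsilon>/4" "d (\<sigma> i x) (l x) \<le> \<epsilon>/4"
        using i[OF K(1)] i[OF K(2)] x X by (simp_all add: f_def)
      moreover have "d (\<sigma> i x) (\<sigma> i y) < \<epsilon>/4"
        using U y by auto
      moreover have "d (l x) (l y) \<le> d (\<sigma> i x) (l x) + d (\<sigma> i x) (\<sigma> i y) + d (\<sigma> i y) (l y)"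
        using triangle''[of "l x" "\<sigma> i x" "l y"] triangle[of "\<sigma> i x" "\<sigma> i y" "l y"]
          lM[OF x] lM[OF X] in_Maps[OF \<sigma>M x] in_Maps[OF \<sigma>M X] by fastforce
      ultimately show ?thesis
        using lM[OF x] lM[OF X] \<open>\<epsilon> > 0\<close> by simp
    qed
    then show "\<exists>U. openin X U \<and> x \<in> U \<and> (\<forall>y\<in>U. l y \<in> mball (l x) \<epsilon>)"
      using U xi by (intro exI[of _ "U \<inter> X interior_of K (Suc n)"]) auto
  qed
  then have "continuous_map X mtopology f"
    by (rule continuous_map_eq) (simp add: f_def)
  then have fM: "f \<in> Maps"
    by (simp add: map_set_def f_def)
  have "limitin Map.mtopology \<sigma> f sequentially"
    unfolding Map.limit_metric_sequentially
  proof (intro conjI allI impI fM)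
    fix \<epsilon>::real assume "\<epsilon> > 0"
    obtain n where n: "\<And>f g. (\<And>x. x \<in> K n \<Longrightarrow> d (f x) (g x) \<le> \<epsilon>/2) \<Longrightarrow> mapd f g < \<epsilon>"
      using uniform_control[OF \<open>\<epsilon> > 0\<close>] by blast
    obtain N where "\<forall>i\<ge>N. \<forall>x\<in>K n. d (\<sigma> i x) (f x) \<le> \<epsilon>/2"
      using unif[OF compact_K, of "\<epsilon>/2" n] \<open>\<epsilon> > 0\<close> by auto
    then show "\<exists>N. \<forall>i\<ge>N. \<sigma> i \<in> Maps \<and> mapd (\<sigma> i) f < \<epsilon>"
      using n \<sigma>M by blast
  qed
  then show "\<exists>f. limitin Map.mtopology \<sigma> f sequentially"
    by blast
qed

text \<open>Dense maps are selected rather than constructed: one from each nonempty set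
  \<open>S n F\<close> given by a finite pattern of sources and targets. For the pattern read off
  from a fine finite cover adapted to \<open>f\<close>, the map \<open>f\<close> itself witnesses
  nonemptiness, and every map with this pattern is close to \<open>f\<close>.\<close>

theorem separable_mapd:
  assumes X: "second_countable X" and M: "separable_space mtopology"
  shows "separable_space Map.mtopology"
proof -
  obtain \<B> where \<B>: "countable \<B>" "\<forall>V \<in> \<B>. openin X V" "\<forall>U x. openin X U \<and> x \<in> U \<longrightarrow> (\<exists>V \<in> \<B>. x \<in> V \<and> V \<subseteq> U)"
    using X unfolding second_countable_def by (elim exE conjE)
  obtain \<W> where \<W>: "countable \<W>" "\<And>x r. x \<in> M \<Longrightarrow> r > 0 \<Longrightarrow> \<exists>W\<in>\<W>. x \<in> mtopology interior_of W \<and> W \<subseteq> mball x r"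
    using separable_imp_countable_mcballs[OF M] by metis
  define S where "S n F = {g \<in> Maps. \<forall>(B,W)\<in>F. g ` (B \<inter> K n) \<subseteq> W}" for n and F :: "('a set \<times> 'b set) set"
  define I where "I = (UNIV :: nat set) \<times> {F. finite F \<and> F \<subseteq> \<B> \<times> \<W>}"
  define D where "D = (\<lambda>(n,F). SOME g. g \<in> S n F) ` {(n,F) \<in> I. S n F \<noteq> {}}"
  have "countable I"
    unfolding I_def using \<B>(1) \<W>(1) by (intro countable_SIGMA countable_Collect_finite_subset) auto
  then have "countable D"
    unfolding D_def by (intro countable_image) (auto elim: countable_subset[rotated])
  moreover have "D \<subseteq> Maps"
  proof -
    have "(SOME g. g \<in> S n F) \<in> S n F" if "S n F \<noteq> {}" for n F
      using that some_in_eq by blast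
    then show ?thesis
      unfolding D_def by (auto simp: S_def)
  qed
  moreover have "Map.mtopology closure_of D = Maps"
  proof (intro equalityI subsetI)
    fix f assume f: "f \<in> Maps"
    then have fc: "continuous_map X mtopology f"
      by (simp add: map_set_def)
    show "f \<in> Map.mtopology closure_of D"
      unfolding Map.metric_closure_of
    proof (intro CollectI conjI allI impI f)
      fix \<epsilon>::real assume "\<epsilon> > 0"
      obtain n where n: "\<And>f g. (\<And>x. x \<in> K n \<Longrightarrow> d (f x) (g x) \<le> \<epsilon>/2) \<Longrightarrow> mapd f g < \<epsilon>"
        using uniform_control[OF \<open>\<epsilon> > 0\<close>] by blast
      have "\<exists>B W. B \<in> \<B> \<and> W \<in> \<W> \<and> x \<in> B \<and> f ` B \<subseteq> W \<and> W \<subseteq> mball (f x) (\<epsilon>/4)" if x: "x \<in> K n" for x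
      proof -
        have xX: "x \<in> topspace X"
          using x K_subset by blast
        obtain W where W: "W \<in> \<W>" "f x \<in> mtopology interior_of W" "W \<subseteq> mball (f x) (\<epsilon>/4)"
          using \<W>(2)[OF in_Maps[OF f xX], of "\<epsilon>/4"] \<open>\<epsilon> > 0\<close> by auto
        have "openin X {y \<in> topspace X. f y \<in> mtopology interior_of W}"
          using fc by (intro openin_continuous_map_preimage) auto
        then obtain B where B: "B \<in> \<B>" "x \<in> B" "B \<subseteq> {y \<in> topspace X. f y \<in> mtopology interior_of W}"
          using \<B>(3) xX W(2) by (metis (mono_tags, lifting) mem_Collect_eq)
        then have "f ` B \<subseteq> W"
          using interior_of_subset[of mtopology W] by blast
        then show ?thesis
          using B W by blast
      qed
      then obtain B W where BW: "\<And>x. x \<in> K n \<Longrightarrow> B x \<in> \<B> \<and> W x \<in> \<W> \<and> x \<in> B x \<and> f ` B x \<subseteq> W x \<and> W x \<subseteq> mball (f x) (\<epsilon>/4)"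
        by metis
      have "openin X (B x)" if "x \<in> K n" for x
        using BW[OF that] \<B>(2) by simp
      moreover have "K n \<subseteq> (\<Union>x\<in>K n. B x)"
        using BW by auto
      ultimately obtain F where F: "finite F" "F \<subseteq> K n" "K n \<subseteq> \<Union>(B ` F)"
        by (rule compactin_subcover_image[OF compact_K[of n], of "K n" B])
      define F' where "F' = (\<lambda>x. (B x, W x)) ` F"
      have "f \<in> S n F'"
        using f F BW by (force simp: S_def F'_def)
      moreover have "(n, F') \<in> I"
        using F BW by (auto simp: I_def F'_def)
      ultimately have gS: "(SOME g. g \<in> S n F') \<in> S n F'" and "(n, F') \<in> {(n,F) \<in> I. S n F \<noteq> {}}"
        by (auto simp: some_in_eq)
      then have gD: "(SOME g. g \<in> S n F') \<in> D"
        unfolding D_def by (metis (mono_tags, lifting) case_prod_conv imageI)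
      have "mapd f g < \<epsilon>" if g: "g \<in> S n F'" for g
      proof (rule n)
        fix x assume x: "x \<in> K n"
        then obtain z where z: "z \<in> F" "x \<in> B z"
          using F by blast
        then have zb: "W z \<subseteq> mball (f z) (\<epsilon>/4)" "f x \<in> W z"
          using BW[of z] F by auto
        moreover have "g x \<in> W z"
          using g z x by (auto simp: S_def F'_def)
        ultimately have "f z \<in> M" "g x \<in> M" "f x \<in> M" "d (f z) (f x) < \<epsilon>/4" "d (f z) (g x) < \<epsilon>/4"
          by auto
        then show "d (f x) (g x) \<le> \<epsilon>/2"
          using triangle''[of "f x" "f z" "g x"] by linarith
      qed
      from this[OF gS] gS f have "(SOME g. g \<in> S n F') \<in> Map.mball f \<epsilon>"
        by (simp add: S_def)
      with gD show "\<exists>g\<in>D. g \<in> Map.mball f \<epsilon>"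
        by blast
    qed
  qed (use closure_of_subset_topspace[of Map.mtopology] in auto)
  ultimately show ?thesis
    unfolding separable_space_def by auto
qed

end

section \<open>Constructions of homotopies\<close>

abbreviation unit_interval :: "real topology" where
  "unit_interval \<equiv> top_of_set {0..1}"

lemma continuous_map_cylinder:
  assumes "continuous_map (prod_topology T X) P h" "continuous_map Z T t" "continuous_map Z X x"
  shows "continuous_map Z P (\<lambda>z. h (t z, x z))"
  using continuous_map_compose[OF continuous_map_pairedI[OF assms(2,3)] assms(1)] by (simp add: o_def)

lemma continuous_map_unit_compose:
  assumes "continuous_on {0..1} a" "\<And>u. u \<in> {0..1} \<Longrightarrow> a u \<in> {0..1::real}" "continuous_map Z unit_interval t"
  shows "continuous_map Z unit_interval (\<lambda>z. a (t z))"
proof -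
  have "continuous_map unit_interval unit_interval a"
    using assms(1,2) by (auto simp: continuous_map_in_subtopology)
  from continuous_map_compose[OF assms(3) this] show ?thesis
    by (simp add: o_def)
qed

lemma continuous_map_unit_max:
  assumes "continuous_map Z unit_interval f" "continuous_map Z unit_interval g"
  shows "continuous_map Z unit_interval (\<lambda>z. max (f z) (g z))"
proof -
  have "continuous_map Z euclideanreal (\<lambda>z. max (f z) (g z))"
    using assms by (intro continuous_map_real_max) (auto simp: continuous_map_in_subtopology)
  moreover have "max (f z) (g z) \<in> {0..1}" if "z \<in> topspace Z" for z
    using assms that by (auto simp: continuous_map_in_subtopology max_def)
  ultimately show ?thesis
    by (auto simp: continuous_map_in_subtopology)
qed

lemma continuous_map_unit_mult:
  assumes "continuous_map Z unit_interval f" "continuous_map Z unit_interval g"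
  shows "continuous_map Z unit_interval (\<lambda>z. f z * g z)"
proof -
  have "continuous_map Z euclideanreal (\<lambda>z. f z * g z)"
    using assms by (intro continuous_map_real_mult) (auto simp: continuous_map_in_subtopology)
  moreover have "f z * g z \<in> {0..1}" if "z \<in> topspace Z" for z
    using assms that by (auto simp: continuous_map_in_subtopology Pi_iff intro!: mult_le_one)
  ultimately show ?thesis
    by (auto simp: continuous_map_in_subtopology)
qed

lemma continuous_map_glue_open:
  assumes "openin Z U" "openin Z V" "topspace Z \<subseteq> U \<union> V"
    and "continuous_map (subtopology Z U) P f" "continuous_map (subtopology Z V) P g"
    and "\<And>z. z \<in> topspace Z \<Longrightarrow> z \<in> U \<Longrightarrow> z \<in> V \<Longrightarrow> f z = g z"
  shows "continuous_map Z P (\<lambda>z. if z \<in> U then f z else g z)"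
proof (rule pasting_lemma[where I="UNIV :: bool set" and T="\<lambda>b. if b then U else V" and f="\<lambda>b. if b then f else g"])
  fix z assume "z \<in> topspace Z"
  then show "\<exists>b. b \<in> UNIV \<and> z \<in> (if b then U else V) \<and> (if z \<in> U then f z else g z) = (if b then f else g) z"
    using assms(3) by (intro exI[of _ "z \<in> U"]) auto
qed (use assms in \<open>auto split: if_splits\<close>)

text \<open>A Urysohn function need not vanish on a neighbourhood of the complement of
  \<open>V\<close>. Rescaling it to \<open>max 0 (2 * f x - 1)\<close> produces zeros on the open
  set where \<open>f x < 1/2\<close>, which together with \<open>V\<close> forms an open cover
  suitable for gluing.\<close>

lemma cutoff_function:
  assumes X: "normal_space X" and C: "closedin X C" and V: "openin X V" and sub: "C \<subseteq> V"
  obtains l W where "continuous_map X unit_interval l" "\<And>x. x \<in> C \<Longrightarrow> l x = 1"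
    "openin X W" "topspace X \<subseteq> V \<union> W" "\<And>x. x \<in> W \<Longrightarrow> l x = 0"
proof -
  have "closedin X (topspace X - V)" "disjnt (topspace X - V) C"
    using V sub by (auto simp: disjnt_def)
  then obtain f where f: "continuous_map X unit_interval f" "f ` (topspace X - V) \<subseteq> {0}" "f ` C \<subseteq> {1}"
    using Urysohn_lemma[OF X _ C, of "topspace X - V" 0 1] by auto
  define l where "l x = max 0 (2 * f x - 1)" for x
  define W where "W = {x \<in> topspace X. f x \<in> {..<1/2}}"
  have fr: "continuous_map X euclideanreal f"
    using f by (simp add: continuous_map_in_subtopology)
  show ?thesis
  proof (rule that[of l W])
    show "continuous_map X unit_interval l"
      unfolding l_def by (rule continuous_map_unit_compose[OF _ _ f(1)]) (auto intro!: continuous_intros)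
    show "openin X W"
      unfolding W_def by (rule openin_continuous_map_preimage[OF fr]) auto
    show "topspace X \<subseteq> V \<union> W"
      using f(2) by (auto simp: W_def)
  qed (use f in \<open>auto simp: l_def W_def\<close>)
qed

section \<open>Changing the ends of homotopies along canonical paths\<close>

locale equiconnection =
  fixes P :: "'p topology" and \<Omega> :: "('p \<times> 'p) set" and \<theta> :: "'p \<Rightarrow> 'p \<Rightarrow> real \<Rightarrow> 'p"
  assumes open_\<Omega>: "openin (prod_topology P P) \<Omega>"
    and diag_\<Omega>: "\<And>p. p \<in> topspace P \<Longrightarrow> (p, p) \<in> \<Omega>"
    and cont_\<theta>: "continuous_map (prod_topology (subtopology (prod_topology P P) \<Omega>) unit_interval) P
       (\<lambda>z. \<theta> (fst (fst z)) (snd (fst z)) (snd z))"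
    and \<theta>_ends: "\<And>p q. (p, q) \<in> \<Omega> \<Longrightarrow> \<theta> p q 0 = p \<and> \<theta> p q 1 = q"
    and \<theta>_diag: "\<And>p u. p \<in> topspace P \<Longrightarrow> u \<in> {0..1} \<Longrightarrow> \<theta> p p u = p"
begin

lemma continuous_map_\<theta>:
  assumes f: "continuous_map Z P f" and g: "continuous_map Z P g" and u: "continuous_map Z unit_interval u"
    and \<Omega>: "\<And>z. z \<in> topspace Z \<Longrightarrow> (f z, g z) \<in> \<Omega>"
  shows "continuous_map Z P (\<lambda>z. \<theta> (f z) (g z) (u z))"
proof -
  have "continuous_map Z (subtopology (prod_topology P P) \<Omega>) (\<lambda>z. (f z, g z))"
    using \<Omega> by (auto simp: continuous_map_in_subtopology intro: continuous_map_pairedI f g)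
  from continuous_map_compose[OF continuous_map_pairedI[OF this u] cont_\<theta>] show ?thesis
    by (simp add: o_def)
qed

text \<open>Running back along \<open>h1\<close> and then along \<open>h2\<close> joins the ends of \<open>h1\<close> and \<open>h2\<close>; over \<open>C\<close> this detour is
  pushed across the square \<open>\<theta> (h1 (t, x)) (h2 (t, x)) u\<close> to the short edge \<open>t = 1\<close>. The cutoff \<open>l\<close> measures how far it is pushed.\<close>

lemma exchange_end:
  assumes X: "normal_space X" and C: "closedin X C"
    and h1: "continuous_map (prod_topology unit_interval X) P h1"
    and h2: "continuous_map (prod_topology unit_interval X) P h2"
    and start: "\<And>x. x \<in> topspace X \<Longrightarrow> h1 (0, x) = h2 (0, x)"
    and near: "\<And>t x. t \<in> {0..1} \<Longrightarrow> x \<in> C \<Longrightarrow> (h1 (t, x), h2 (t, x)) \<in> \<Omega>"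
  obtains k where "continuous_map (prod_topology unit_interval X) P k"
    "\<And>x. x \<in> topspace X \<Longrightarrow> k (0, x) = h1 (1, x)" "\<And>x. x \<in> topspace X \<Longrightarrow> k (1, x) = h2 (1, x)"
    "\<And>u x. u \<in> {0..1} \<Longrightarrow> x \<in> C \<Longrightarrow> \<exists>v\<in>{0..1}. k (u, x) = \<theta> (h1 (1, x)) (h2 (1, x)) v"
proof -
  let ?Z = "prod_topology unit_interval X"
  have hh: "continuous_map ?Z (prod_topology P P) (\<lambda>z. (h1 z, h2 z))"
    using h1 h2 by (rule continuous_map_pairedI)
  have hP: "h1 (t, x) \<in> topspace P" "h2 (t, x) \<in> topspace P" if "t \<in> {0..1}" "x \<in> topspace X" for t x
    using h1 h2 that by (auto simp: continuous_map_def Pi_iff)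
  define V where "V = {x \<in> topspace X. \<forall>t\<in>topspace unit_interval. (t, x) \<in> {z \<in> topspace ?Z. (h1 z, h2 z) \<in> \<Omega>}}"
  have V: "openin X V"
    unfolding V_def
  proof (rule open_tube)
    show "compact_space unit_interval"
      by (simp add: compact_space_subtopology)
    show "openin ?Z {z \<in> topspace ?Z. (h1 z, h2 z) \<in> \<Omega>}"
      by (rule openin_continuous_map_preimage[OF hh open_\<Omega>])
  qed
  have V\<Omega>: "(h1 (t, x), h2 (t, x)) \<in> \<Omega>" if "x \<in> V" "t \<in> {0..1}" for t x
    using that by (auto simp: V_def)
  have CV: "C \<subseteq> V"
    using near closedin_subset[OF C] by (auto simp: V_def)
  obtain l W where l: "continuous_map X unit_interval l" "\<And>x. x \<in> C \<Longrightarrow> l x = 1"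
    and W: "openin X W" "topspace X \<subseteq> V \<union> W" "\<And>x. x \<in> W \<Longrightarrow> l x = 0"
    using cutoff_function[OF X C V CV] by blast
  have lI: "l x \<in> {0..1}" if "x \<in> topspace X" for x
    using l(1) that by (auto simp: continuous_map_in_subtopology)
  \<comment> \<open>\<open>a\<close> falls from 1 to 0 on \<open>[0, 1/6]\<close>, stays 0, and
    rises back to 1 on \<open>[5/6, 1]\<close>: the time parameter of the detour. \<open>b\<close>
    crosses from \<open>h1\<close> to \<open>h2\<close> only on \<open>[1/3, 2/3]\<close>. Where
    \<open>l\<close> is 0 the crossing thus happens at the common start, where
    \<open>\<theta>\<close> is constant; so the two formulas \<open>kV\<close> and \<open>kW\<close>
    agree on the overlap.\<close>
  define a :: "real \<Rightarrow> real" where "a u = max 0 (\<bar>6*u - 3\<bar> - 2)" for u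
  define b :: "real \<Rightarrow> real" where "b u = max 0 (min 1 (3*u - 1))" for u
  have aI: "a u \<in> {0..1}" and bI: "b u \<in> {0..1}" if "u \<in> {0..1}" for u
    using that by (auto simp: a_def b_def abs_if max_def)
  have ac: "continuous_on {0..1} a" and bc: "continuous_on {0..1} b"
    unfolding a_def b_def by (intro continuous_intros)+
  define kV where "kV z = \<theta> (h1 (max (l (snd z)) (a (fst z)), snd z)) (h2 (max (l (snd z)) (a (fst z)), snd z)) (b (fst z))" for z
  define kW where "kW z = (if fst z \<le> 1/2 then h1 (a (fst z), snd z) else h2 (a (fst z), snd z))" for z
  define k where "k z = (if z \<in> {0..1} \<times> V then kV z else kW z)" for z
  have fst_c: "continuous_map ?Z unit_interval fst" and snd_c: "continuous_map ?Z X snd"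
    by (rule continuous_map_fst continuous_map_snd)+
  have lz: "continuous_map ?Z unit_interval (\<lambda>z. l (snd z))"
    using continuous_map_compose[OF snd_c l(1)] by (simp add: o_def)
  have az: "continuous_map ?Z unit_interval (\<lambda>z. a (fst z))" and bz: "continuous_map ?Z unit_interval (\<lambda>z. b (fst z))"
    by - (rule continuous_map_unit_compose[OF ac _ fst_c], erule aI, rule continuous_map_unit_compose[OF bc _ fst_c], erule bI)
  have kV: "continuous_map (subtopology ?Z ({0..1} \<times> V)) P kV"
    unfolding kV_def
  proof (rule continuous_map_\<theta>)
    show "(h1 (max (l (snd z)) (a (fst z)), snd z), h2 (max (l (snd z)) (a (fst z)), snd z)) \<in> \<Omega>"
      if "z \<in> topspace (subtopology ?Z ({0..1} \<times> V))" for z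
      using that lI[of "snd z"] aI[of "fst z"] by (intro V\<Omega>) (auto simp: max_def)
  qed (intro continuous_map_from_subtopology continuous_map_cylinder[OF h1] continuous_map_cylinder[OF h2]
      continuous_map_unit_max lz az bz snd_c)+
  have "continuous_map ?Z P (\<lambda>z. if fst z \<le> 1/2 then h1 (a (fst z), snd z) else h2 (a (fst z), snd z))"
  proof (rule continuous_map_cases_le)
    show "h1 (a (fst z), snd z) = h2 (a (fst z), snd z)" if "z \<in> topspace ?Z" "fst z = 1/2" for z
      using that start[of "snd z"] by (auto simp: a_def)
    show "continuous_map ?Z euclideanreal fst"
      using fst_c by (simp add: continuous_map_in_subtopology)
  qed (auto intro!: continuous_map_from_subtopology continuous_map_cylinder[OF h1] continuous_map_cylinder[OF h2] az snd_c)
  then have kW: "continuous_map ?Z P kW"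
    by (simp add: kW_def[abs_def])
  have "continuous_map ?Z P k"
    unfolding k_def
  proof (rule continuous_map_glue_open[where V="{0..1} \<times> W"])
    show "openin ?Z ({0..1} \<times> V)" "openin ?Z ({0..1} \<times> W)"
      using V W by (auto simp: openin_prod_Times_iff)
    show "topspace ?Z \<subseteq> {0..1} \<times> V \<union> {0..1} \<times> W"
      using W by auto
    show "kV z = kW z" if z: "z \<in> topspace ?Z" "z \<in> {0..1} \<times> V" "z \<in> {0..1} \<times> W" for z
    proof -
      obtain u x where ux: "z = (u, x)" "u \<in> {0..1}" "x \<in> V" "x \<in> W" "x \<in> topspace X"
        using z by auto
      have m: "max (l x) (a u) = a u"
        using W(3)[OF ux(4)] aI[OF ux(2)] by simp
      have \<Omega>: "(h1 (a u, x), h2 (a u, x)) \<in> \<Omega>"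
        using V\<Omega>[OF ux(3) aI[OF ux(2)]] .
      consider "u \<le> 1/3" | "u \<ge> 2/3" | "1/3 < u" "u < 2/3"
        by linarith
      then show ?thesis
      proof cases
        case 1
        then have "b u = 0"
          by (simp add: b_def)
        then show ?thesis
          using 1 \<theta>_ends[OF \<Omega>] by (simp add: kV_def kW_def ux m)
      next
        case 2
        then have "b u = 1"
          by (simp add: b_def)
        then show ?thesis
          using 2 \<theta>_ends[OF \<Omega>] by (simp add: kV_def kW_def ux m)
      next
        case 3
        then have "a u = 0"
          by (simp add: a_def abs_if)
        then show ?thesis
          using start[OF ux(5)] \<theta>_diag[OF hP(1)[of 0 x]] ux bI W(3)[OF ux(4)] by (simp add: kV_def kW_def)
      qed
    qed
  qed (use kV kW in \<open>auto intro: continuous_map_from_subtopology\<close>)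
  moreover have "k (0, x) = h1 (1, x)" "k (1, x) = h2 (1, x)" if x: "x \<in> topspace X" for x
  proof -
    have ab: "a 0 = 1" "a 1 = 1" "b 0 = 0" "b 1 = 1"
      by (simp_all add: a_def b_def)
    have m: "max (l x) 1 = 1"
      using lI[OF x] by auto
    show "k (0, x) = h1 (1, x)" "k (1, x) = h2 (1, x)"
      using \<theta>_ends[OF V\<Omega>[of x 1]] by (auto simp: k_def kV_def kW_def ab m)
  qed
  moreover have "\<exists>v\<in>{0..1}. k (u, x) = \<theta> (h1 (1, x)) (h2 (1, x)) v" if "u \<in> {0..1}" "x \<in> C" for u x
  proof -
    have "max (l x) (a u) = 1"
      using l(2)[OF that(2)] aI[OF that(1)] by auto
    then have "k (u, x) = \<theta> (h1 (1, x)) (h2 (1, x)) (b u)"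
      using that CV by (auto simp: k_def kV_def)
    with bI[OF that(1)] show ?thesis
      by blast
  qed
  ultimately show ?thesis
    using that by blast
qed

text \<open>The path from \<open>y\<close> to the start of \<open>h\<close>, traversed within time
  \<open>\<delta>\<close>, followed by a compressed \<open>h\<close>, is run in the slowed time
  \<open>r = l x * t\<close>. Over \<open>C\<close> this is true time; over \<open>W\<close> time
  stands still and the homotopy is constantly \<open>y\<close>, so it extends to points where no
  canonical path is available. As only the start is prescribed, the end may change freely.\<close>

lemma lift_start:
  assumes X: "normal_space X" and C: "closedin X C" and y: "continuous_map X P y"
    and h: "continuous_map (prod_topology unit_interval X) P h"
    and near: "\<And>x. x \<in> C \<Longrightarrow> (y x, h (0, x)) \<in> \<Omega>" and \<delta>: "0 < \<delta>" "\<delta> < 1"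
  obtains k where "continuous_map (prod_topology unit_interval X) P k"
    "\<And>x. x \<in> topspace X \<Longrightarrow> k (0, x) = y x"
    "\<And>t x. t \<in> {0..\<delta>} \<Longrightarrow> x \<in> C \<Longrightarrow> \<exists>v\<in>{0..1}. k (t, x) = \<theta> (y x) (h (0, x)) v"
    "\<And>t x. t \<in> {\<delta><..1} \<Longrightarrow> x \<in> C \<Longrightarrow> k (t, x) = h ((t - \<delta>) / (1 - \<delta>), x)"
proof -
  let ?Z = "prod_topology unit_interval X"
  have h0: "continuous_map X P (\<lambda>x. h (0, x))"
    by (rule continuous_map_cylinder[OF h]) auto
  define V where "V = {x \<in> topspace X. (y x, h (0, x)) \<in> \<Omega>}"
  have V: "openin X V"
    unfolding V_def using continuous_map_pairedI[OF y h0] open_\<Omega> by (rule openin_continuous_map_preimage)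
  have CV: "C \<subseteq> V"
    using near closedin_subset[OF C] by (auto simp: V_def)
  obtain l W where l: "continuous_map X unit_interval l" "\<And>x. x \<in> C \<Longrightarrow> l x = 1"
    and W: "openin X W" "topspace X \<subseteq> V \<union> W" "\<And>x. x \<in> W \<Longrightarrow> l x = 0"
    using cutoff_function[OF X C V CV] by blast
  define a where "a r = min 1 (r / \<delta>)" for r
  define b where "b r = max 0 ((r - \<delta>) / (1 - \<delta>))" for r
  have aI: "a r \<in> {0..1}" and bI: "b r \<in> {0..1}" if "r \<in> {0..1}" for r
    using that \<delta> by (auto simp: a_def b_def divide_le_eq_1)
  have ac: "continuous_on {0..1} a" and bc: "continuous_on {0..1} b"
    unfolding a_def b_def using \<delta> by (intro continuous_intros; simp)+
  define r where "r z = l (snd z) * fst z" for z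
  define kV where "kV z = (if r z \<le> \<delta> then \<theta> (y (snd z)) (h (0, snd z)) (a (r z)) else h (b (r z), snd z))" for z
  define k where "k z = (if z \<in> {0..1} \<times> V then kV z else y (snd z))" for z
  have fst_c: "continuous_map ?Z unit_interval fst" and snd_c: "continuous_map ?Z X snd"
    by (rule continuous_map_fst continuous_map_snd)+
  have lz: "continuous_map ?Z unit_interval (\<lambda>z. l (snd z))"
    using continuous_map_compose[OF snd_c l(1)] by (simp add: o_def)
  have rz: "continuous_map ?Z unit_interval r"
    unfolding r_def by (rule continuous_map_unit_mult[OF lz fst_c])
  have az: "continuous_map ?Z unit_interval (\<lambda>z. a (r z))" and bz: "continuous_map ?Z unit_interval (\<lambda>z. b (r z))"
    by - (rule continuous_map_unit_compose[OF ac _ rz], erule aI, rule continuous_map_unit_compose[OF bc _ rz], erule bI)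
  have yz: "continuous_map ?Z P (\<lambda>z. y (snd z))" and hz: "continuous_map ?Z P (\<lambda>z. h (0, snd z))"
    using continuous_map_compose[OF snd_c y] continuous_map_compose[OF snd_c h0] by (simp_all add: o_def)
  have end_\<theta>: "\<theta> (y x) (h (0, x)) 0 = y x" "\<theta> (y x) (h (0, x)) 1 = h (0, x)" if "x \<in> V" for x
    using \<theta>_ends that by (auto simp: V_def)
  have "continuous_map (subtopology ?Z ({0..1} \<times> V)) P
     (\<lambda>z. if r z \<le> \<delta> then \<theta> (y (snd z)) (h (0, snd z)) (a (r z)) else h (b (r z), snd z))"
  proof (rule continuous_map_cases_le)
    show "continuous_map (subtopology ?Z ({0..1} \<times> V)) euclideanreal r"
      using continuous_map_from_subtopology[OF rz] by (simp add: continuous_map_in_subtopology)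
    have "continuous_map (subtopology ?Z ({0..1} \<times> V)) P (\<lambda>z. \<theta> (y (snd z)) (h (0, snd z)) (a (r z)))"
      by (intro continuous_map_\<theta> continuous_map_from_subtopology yz hz az) (auto simp: V_def)
    then show "continuous_map (subtopology (subtopology ?Z ({0..1} \<times> V)) {z \<in> topspace (subtopology ?Z ({0..1} \<times> V)). r z \<le> \<delta>}) P
        (\<lambda>z. \<theta> (y (snd z)) (h (0, snd z)) (a (r z)))"
      by (rule continuous_map_from_subtopology)
    show "continuous_map (subtopology (subtopology ?Z ({0..1} \<times> V)) {z \<in> topspace (subtopology ?Z ({0..1} \<times> V)). \<delta> \<le> r z}) P
        (\<lambda>z. h (b (r z), snd z))"
      by (intro continuous_map_from_subtopology continuous_map_cylinder[OF h] bz snd_c)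
    show "\<theta> (y (snd z)) (h (0, snd z)) (a (r z)) = h (b (r z), snd z)"
      if "z \<in> topspace (subtopology ?Z ({0..1} \<times> V))" "r z = \<delta>" for z
      using that end_\<theta>(2)[of "snd z"] \<delta> by (auto simp: a_def b_def)
  qed auto
  then have kV: "continuous_map (subtopology ?Z ({0..1} \<times> V)) P kV"
    by (simp add: kV_def[abs_def])
  have "continuous_map ?Z P k"
    unfolding k_def
  proof (rule continuous_map_glue_open[where V="{0..1} \<times> W"])
    show "openin ?Z ({0..1} \<times> V)" "openin ?Z ({0..1} \<times> W)"
      using V W by (auto simp: openin_prod_Times_iff)
    show "topspace ?Z \<subseteq> {0..1} \<times> V \<union> {0..1} \<times> W"
      using W by auto
    show "kV z = y (snd z)" if "z \<in> topspace ?Z" "z \<in> {0..1} \<times> V" "z \<in> {0..1} \<times> W" for z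
      using that W(3)[of "snd z"] end_\<theta>(1)[of "snd z"] \<delta> by (auto simp: kV_def r_def a_def)
  qed (use kV yz in \<open>auto intro: continuous_map_from_subtopology\<close>)
  moreover have "k (0, x) = y x" if "x \<in> topspace X" for x
    using end_\<theta>(1)[of x] \<delta> by (auto simp: k_def kV_def r_def a_def)
  moreover have "\<exists>v\<in>{0..1}. k (t, x) = \<theta> (y x) (h (0, x)) v" if t: "t \<in> {0..\<delta>}" and x: "x \<in> C" for t x
  proof -
    have "k (t, x) = \<theta> (y x) (h (0, x)) (a t)"
      using t \<delta> l(2)[OF x] CV x by (auto simp: k_def kV_def r_def)
    moreover have "a t \<in> {0..1}"
      using t \<delta> by (intro aI) auto
    ultimately show ?thesis
      by blast
  qed
  moreover have "k (t, x) = h ((t - \<delta>) / (1 - \<delta>), x)" if t: "t \<in> {\<delta><..1}" and x: "x \<in> C" for t x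
    using t \<delta> l(2)[OF x] CV x by (auto simp: k_def kV_def r_def b_def)
  ultimately show ?thesis
    using that by blast
qed

end

text \<open>\<open>k\<close> is squeezed into the last stretch of length \<open>\<delta>\<close>;
  when \<open>k\<close> is short and \<open>\<delta>\<close> is small, the result stays close to
  \<open>h\<close>, unlike concatenation at half time.\<close>

lemma append_homotopy:
  assumes h: "continuous_map (prod_topology unit_interval X) P h"
    and k: "continuous_map (prod_topology unit_interval X) P k"
    and join: "\<And>x. x \<in> topspace X \<Longrightarrow> h (1, x) = k (0, x)" and \<delta>: "0 < \<delta>" "\<delta> < 1"
  obtains g where "continuous_map (prod_topology unit_interval X) P g"
    "\<And>t x. t \<in> {0..1-\<delta>} \<Longrightarrow> g (t, x) = h (t / (1 - \<delta>), x)"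
    "\<And>t x. t \<in> {1-\<delta><..1} \<Longrightarrow> g (t, x) = k ((t - (1 - \<delta>)) / \<delta>, x)"
proof -
  let ?Z = "prod_topology unit_interval X"
  define a where "a t = min 1 (t / (1 - \<delta>))" for t
  define b where "b t = max 0 ((t - (1 - \<delta>)) / \<delta>)" for t
  have aI: "a t \<in> {0..1}" and bI: "b t \<in> {0..1}" if "t \<in> {0..1}" for t
    using that \<delta> by (auto simp: a_def b_def divide_le_eq_1)
  have ac: "continuous_on {0..1} a" and bc: "continuous_on {0..1} b"
    unfolding a_def b_def using \<delta> by (intro continuous_intros; simp)+
  have fst_c: "continuous_map ?Z unit_interval fst" and snd_c: "continuous_map ?Z X snd"
    by (rule continuous_map_fst continuous_map_snd)+
  have az: "continuous_map ?Z unit_interval (\<lambda>z. a (fst z))" and bz: "continuous_map ?Z unit_interval (\<lambda>z. b (fst z))"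
    by - (rule continuous_map_unit_compose[OF ac _ fst_c], erule aI, rule continuous_map_unit_compose[OF bc _ fst_c], erule bI)
  define g where "g z = (if fst z \<le> 1 - \<delta> then h (a (fst z), snd z) else k (b (fst z), snd z))" for z
  have "continuous_map ?Z P (\<lambda>z. if fst z \<le> 1 - \<delta> then h (a (fst z), snd z) else k (b (fst z), snd z))"
  proof (rule continuous_map_cases_le)
    show "continuous_map ?Z euclideanreal fst"
      using fst_c by (simp add: continuous_map_in_subtopology)
    show "h (a (fst z), snd z) = k (b (fst z), snd z)" if "z \<in> topspace ?Z" "fst z = 1 - \<delta>" for z
      using that join[of "snd z"] \<delta> by (auto simp: a_def b_def)
  qed (auto intro!: continuous_map_from_subtopology continuous_map_cylinder[OF h] continuous_map_cylinder[OF k] az bz snd_c)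
  then have "continuous_map ?Z P g"
    by (simp add: g_def[abs_def])
  then show ?thesis
    by (rule that) (use \<delta> in \<open>auto simp: g_def a_def b_def\<close>)
qed

section \<open>The space of homotopies\<close>

locale homotopy_setting = metric_mapping_space X K M d + equiconnection mtopology \<Omega> \<theta>
  for X :: "'a topology" and K and M :: "'b set" and d and \<Omega> and \<theta> +
  assumes normal_X: "normal_space X" and Hausdorff_X: "Hausdorff_space X" and second_countable_X: "second_countable X"
    and complete_M: mcomplete and separable_M: "separable_space mtopology"
begin

abbreviation cylinder :: "(real \<times> 'a) topology" where
  "cylinder \<equiv> prod_topology unit_interval X"

sublocale Hom: metric_mapping_space cylinder "\<lambda>n. {0..1} \<times> K n" M d
proof
  show "compactin cylinder ({0..1} \<times> K n)" for n
    by (simp add: compactin_Times compact_K compactin_subtopology)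
  have "unit_interval interior_of {0..1} = {0..1}"
    by (metis interior_of_topspace topspace_euclidean_subtopology)
  then show "{0..1} \<times> K n \<subseteq> cylinder interior_of ({0..1} \<times> K (Suc n))" for n
    using K_Suc[of n] by (auto simp: interior_of_Times)
  show "topspace cylinder \<subseteq> (\<Union>n. {0..1} \<times> K n)"
    using K_cover by auto
qed

definition start_of :: "(real \<times> 'a \<Rightarrow> 'b) \<Rightarrow> 'a \<Rightarrow> 'b" where
  "start_of h = restrict (\<lambda>x. h (0, x)) (topspace X)"

definition end_of :: "(real \<times> 'a \<Rightarrow> 'b) \<Rightarrow> 'a \<Rightarrow> 'b" where
  "end_of h = restrict (\<lambda>x. h (1, x)) (topspace X)"

lemma closed_K: "closedin X (K n)"
  using compact_K Hausdorff_X compactin_imp_closedin by blast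

lemma Hom_continuous: "h \<in> Hom.Maps \<Longrightarrow> continuous_map cylinder mtopology h"
  by (simp add: map_set_def)

lemma Hom_in: "h \<in> Hom.Maps \<Longrightarrow> t \<in> {0..1} \<Longrightarrow> x \<in> topspace X \<Longrightarrow> h (t, x) \<in> M"
  by (rule Hom.in_Maps) auto

lemma slice_in_Maps:
  assumes "h \<in> Hom.Maps" "t \<in> {0..1}"
  shows "restrict (\<lambda>x. h (t, x)) (topspace X) \<in> Maps"
proof -
  have "continuous_map X mtopology (\<lambda>x. h (t, x))"
    by (rule continuous_map_cylinder[OF Hom_continuous[OF assms(1)]]) (use assms in auto)
  then show ?thesis
    by (auto simp: map_set_def intro: continuous_map_eq)
qed

lemma start_of_in: "h \<in> Hom.Maps \<Longrightarrow> start_of h \<in> Maps" and end_of_in: "h \<in> Hom.Maps \<Longrightarrow> end_of h \<in> Maps"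
  unfolding start_of_def end_of_def by (rule slice_in_Maps; simp)+

lemma restrict_Hom:
  assumes "continuous_map cylinder mtopology k"
  shows "restrict k (topspace cylinder) \<in> Hom.Maps"
  using assms by (auto simp: map_set_def intro: continuous_map_eq)

lemma weight_cylinder: "t \<in> {0..1} \<Longrightarrow> Hom.weight (t, x) = weight x"
  by (simp add: Hom.weight_def weight_def)

lemma mapd_slice_le:
  assumes "t \<in> {0..1}"
  shows "mapd (restrict (\<lambda>x. h (t, x)) (topspace X)) (restrict (\<lambda>x. h' (t, x)) (topspace X)) \<le> Hom.mapd h h'"
proof (rule mapd_least)
  show "0 \<le> Hom.mapd h h'"
    by (rule Hom.mapd_nonneg)
  fix x assume "x \<in> topspace X"
  then show "min (d (restrict (\<lambda>x. h (t, x)) (topspace X) x) (restrict (\<lambda>x. h' (t, x)) (topspace X) x)) (weight x) \<le> Hom.mapd h h'"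
    using Hom.mapd_upper[of "(t, x)" h h'] assms weight_cylinder[OF assms] by simp
qed

lemma continuous_map_slice:
  assumes "t \<in> {0..1}"
  shows "continuous_map Hom.Map.mtopology Map.mtopology (\<lambda>h. restrict (\<lambda>x. h (t, x)) (topspace X))"
  unfolding Hom.Map.metric_continuous_map[OF Map.Metric_space_axioms]
proof (intro conjI ballI allI impI)
  show "(\<lambda>h. restrict (\<lambda>x. h (t, x)) (topspace X)) ` Hom.Maps \<subseteq> Maps"
    using slice_in_Maps assms by blast
  fix h \<epsilon> assume "h \<in> Hom.Maps" "(0::real) < \<epsilon>"
  then show "\<exists>\<delta>>0. \<forall>h'. h' \<in> Hom.Maps \<and> Hom.mapd h h' < \<delta> \<longrightarrow>
      mapd (restrict (\<lambda>x. h (t, x)) (topspace X)) (restrict (\<lambda>x. h' (t, x)) (topspace X)) < \<epsilon>"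
    using mapd_slice_le[OF assms] by (intro exI[of _ \<epsilon>]) (auto intro: le_less_trans)
qed

section \<open>Uniform estimates for homotopies over compact sets\<close>

lemma time_uniform:
  assumes h: "continuous_map cylinder mtopology h" and C: "compactin X C" and "\<epsilon> > 0"
  obtains \<delta> where "0 < \<delta>" "\<delta> < 1"
    "\<And>t t' x. t \<in> {0..1} \<Longrightarrow> t' \<in> {0..1} \<Longrightarrow> \<bar>t - t'\<bar> \<le> \<delta> \<Longrightarrow> x \<in> C \<Longrightarrow> d (h (t, x)) (h (t', x)) < \<epsilon>"
proof -
  have hM: "h z \<in> M" if "z \<in> topspace cylinder" for z
    using h that unfolding continuous_map_def by (auto simp: Pi_iff)
  have CX: "C \<subseteq> topspace X"
    using C compactin_subset_topspace by blast
  have "\<exists>r>0. \<forall>z\<in>{0..1} \<times> C. \<forall>t'\<in>{0..1}. \<bar>fst z - t'\<bar> \<le> r \<longrightarrow> d (h z) (h (t', snd z)) < \<epsilon>"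
  proof (rule compact_uniform_radius[of cylinder])
    show "compactin cylinder ({0..1} \<times> C)"
      using C by (simp add: compactin_Times compactin_subtopology)
    fix z :: "real \<times> 'a" assume z: "z \<in> {0..1} \<times> C"
    obtain t x where tx: "z = (t, x)" "t \<in> {0..1}" "x \<in> C" "x \<in> topspace X"
      using z CX by auto
    have "openin cylinder {z' \<in> topspace cylinder. h z' \<in> mball (h z) (\<epsilon>/2)}"
      by (rule openin_continuous_map_preimage[OF h]) auto
    moreover have "z \<in> {z' \<in> topspace cylinder. h z' \<in> mball (h z) (\<epsilon>/2)}"
      using tx hM[of z] \<open>\<epsilon> > 0\<close> by auto
    ultimately obtain A V where AV: "openin unit_interval A" "openin X V" "t \<in> A" "x \<in> V"
        "A \<times> V \<subseteq> {z' \<in> topspace cylinder. h z' \<in> mball (h z) (\<epsilon>/2)}"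
      unfolding openin_prod_topology_alt tx(1) by meson
    obtain r where r: "r > 0" "ball t r \<inter> {0..1} \<subseteq> A"
      using AV(1,3) unfolding openin_contains_ball by blast
    show "\<exists>r>0. \<exists>V. openin cylinder V \<and> z \<in> V \<and>
        (\<forall>z\<in>V \<inter> {0..1} \<times> C. \<forall>t'\<in>{0..1}. \<bar>fst z - t'\<bar> \<le> r \<longrightarrow> d (h z) (h (t', snd z)) < \<epsilon>)"
    \<comment> \<open>With \<open>r/2\<close> both times, \<open>u\<close> within \<open>r/2\<close>
      of \<open>t\<close> and \<open>t'\<close> within \<open>r/2\<close> of \<open>u\<close>, fall
      into \<open>ball t r\<close>.\<close>
    proof (intro exI[of _ "r/2"] exI[of _ "(ball t (r/2) \<inter> {0..1}) \<times> V"] conjI ballI impI)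
      have "openin unit_interval (ball t (r/2) \<inter> {0..1})"
        by (simp add: openin_open_Int Int_commute)
      then show "openin cylinder ((ball t (r/2) \<inter> {0..1}) \<times> V)"
        using AV(2) by (simp add: openin_prod_Times_iff)
      show "z \<in> (ball t (r/2) \<inter> {0..1}) \<times> V"
        using tx r AV by simp
      fix w t' assume w: "w \<in> (ball t (r/2) \<inter> {0..1}) \<times> V \<inter> {0..1} \<times> C" "t' \<in> {0..1}" "\<bar>fst w - t'\<bar> \<le> r/2"
      obtain u y where uy: "w = (u, y)" "u \<in> {0..1}" "y \<in> V" "\<bar>t - u\<bar> < r/2"
        using w(1) by (auto simp: dist_real_def)
      have "\<bar>u - t'\<bar> \<le> r/2"
        using w(3) uy(1) by simp
      then have "\<bar>t - u\<bar> < r" "\<bar>t - t'\<bar> < r"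
        using uy(4) r(1) by linarith+
      then have "u \<in> ball t r \<inter> {0..1}" "t' \<in> ball t r \<inter> {0..1}"
        using uy(2) w(2) by (auto simp: dist_real_def)
      then have "(u, y) \<in> A \<times> V" "(t', y) \<in> A \<times> V"
        using r(2) uy(3) by auto
      then have "h (u, y) \<in> mball (h z) (\<epsilon>/2)" "h (t', y) \<in> mball (h z) (\<epsilon>/2)"
        using AV(5) by blast+
      then have "d (h z) (h (u, y)) < \<epsilon>/2" "d (h z) (h (t', y)) < \<epsilon>/2" "h z \<in> M" "h (u, y) \<in> M" "h (t', y) \<in> M"
        by auto
      then show "d (h w) (h (t', snd w)) < \<epsilon>"
        using triangle''[of "h (u, y)" "h z" "h (t', y)"] uy(1) by simp
    qed (use r in auto)
  qed auto
  then obtain r where r: "r > 0" "\<And>t t' x. t \<in> {0..1} \<Longrightarrow> x \<in> C \<Longrightarrow> t' \<in> {0..1} \<Longrightarrow> \<bar>t - t'\<bar> \<le> r \<Longrightarrow> d (h (t, x)) (h (t', x)) < \<epsilon>"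
    by (metis (no_types, lifting) SigmaI fst_conv snd_conv)
  show ?thesis
    by (rule that[of "min r (1/2)"]) (use r in auto)
qed

lemma open_distance_less: "openin (prod_topology mtopology mtopology) {(p, q) \<in> M \<times> M. d p q < \<epsilon>}"
proof (subst openin_subopen, intro ballI)
  fix z assume "z \<in> {(p, q) \<in> M \<times> M. d p q < \<epsilon>}"
  then obtain p q where z: "z = (p, q)" "p \<in> M" "q \<in> M" "d p q < \<epsilon>"
    by auto
  define r where "r = (\<epsilon> - d p q) / 2"
  have r: "r > 0"
    using z by (simp add: r_def)
  have "d p' q' < \<epsilon>" if "p' \<in> mball p r" "q' \<in> mball q r" for p' q'
    using that triangle''[of p' p q'] triangle[of p q q'] by (auto simp: r_def field_simps)
  then have "mball p r \<times> mball q r \<subseteq> {(p, q) \<in> M \<times> M. d p q < \<epsilon>}"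
    by auto
  moreover have "openin (prod_topology mtopology mtopology) (mball p r \<times> mball q r)"
    by (simp add: openin_prod_Times_iff)
  ultimately show "\<exists>T. openin (prod_topology mtopology mtopology) T \<and> z \<in> T \<and> T \<subseteq> {(p, q) \<in> M \<times> M. d p q < \<epsilon>}"
    using z r by (intro exI[of _ "mball p r \<times> mball q r"]) auto
qed

text \<open>The whole canonical path is required to stay near \<open>p\<close>, since closeness of
  the ends alone would not prevent an excursion. Compactness of the time interval keeps this
  condition open.\<close>

definition \<Omega>_small :: "real \<Rightarrow> ('b \<times> 'b) set" where
  "\<Omega>_small \<epsilon> = {(p, q) \<in> \<Omega>. \<forall>u\<in>{0..1}. d (\<theta> p q u) p < \<epsilon>}"

lemma \<Omega>_subset: "\<Omega> \<subseteq> M \<times> M"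
  using openin_subset[OF open_\<Omega>] by simp

lemma \<theta>_in:
  assumes "(p, q) \<in> \<Omega>" "u \<in> {0..1}"
  shows "\<theta> p q u \<in> M"
proof -
  have "((p, q), u) \<in> topspace (prod_topology (subtopology (prod_topology mtopology mtopology) \<Omega>) unit_interval)"
    using assms \<Omega>_subset by auto
  from funcset_mem[OF continuous_map_funspace[OF cont_\<theta>] this] show ?thesis
    by simp
qed

lemma open_\<Omega>_small: "openin (prod_topology mtopology mtopology) (\<Omega>_small \<epsilon>)"
proof -
  let ?S = "subtopology (prod_topology mtopology mtopology) \<Omega>"
  let ?Z = "prod_topology unit_interval ?S"
  have fst_c: "continuous_map ?Z mtopology (\<lambda>z. fst (snd z))" and snd_c: "continuous_map ?Z mtopology (\<lambda>z. snd (snd z))"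
    using continuous_map_compose[OF continuous_map_snd continuous_map_from_subtopology[OF continuous_map_fst]]
      continuous_map_compose[OF continuous_map_snd continuous_map_from_subtopology[OF continuous_map_snd]]
    by (simp_all add: o_def)
  have "continuous_map ?Z mtopology (\<lambda>z. \<theta> (fst (snd z)) (snd (snd z)) (fst z))"
    by (rule continuous_map_\<theta>[OF fst_c snd_c continuous_map_fst]) auto
  then have c: "continuous_map ?Z (prod_topology mtopology mtopology) (\<lambda>z. (\<theta> (fst (snd z)) (snd (snd z)) (fst z), fst (snd z)))"
    using fst_c by (rule continuous_map_pairedI)
  define W where "W = {z \<in> topspace ?Z. (\<theta> (fst (snd z)) (snd (snd z)) (fst z), fst (snd z)) \<in> {(p, q) \<in> M \<times> M. d p q < \<epsilon>}}"
  have "openin ?Z W"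
    unfolding W_def by (rule openin_continuous_map_preimage[OF c open_distance_less])
  then have "openin ?S {x \<in> topspace ?S. \<forall>t\<in>topspace unit_interval. (t, x) \<in> W}"
    by (intro open_tube) (simp_all add: compact_space_subtopology)
  moreover have "{x \<in> topspace ?S. \<forall>t\<in>topspace unit_interval. (t, x) \<in> W} = \<Omega>_small \<epsilon>"
    using \<Omega>_subset \<theta>_in by (auto simp: W_def \<Omega>_small_def)
  ultimately show ?thesis
    using openin_trans_full open_\<Omega> by fastforce
qed

lemma diag_\<Omega>_small: "p \<in> M \<Longrightarrow> \<epsilon> > 0 \<Longrightarrow> (p, p) \<in> \<Omega>_small \<epsilon>"
  using diag_\<Omega>[of p] \<theta>_diag[of p] by (auto simp: \<Omega>_small_def)

section \<open>Verification of the path axioms for homotopies\<close>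

text \<open>Errors on \<open>K n\<close>: up to time \<open>1 - \<delta>\<close> the new homotopy is
  \<open>h\<close> displaced in time by at most \<open>\<delta>\<close>, which costs
  \<open>\<epsilon>/4\<close>. Afterwards it moves along a small canonical path within
  \<open>\<epsilon>/4\<close> of the end of \<open>h\<close>, from which \<open>h\<close> itself is
  less than \<open>\<epsilon>/4\<close> away.\<close>

lemma transport_homotopy:
  assumes h0: "h0 \<in> Hom.Maps" and "\<epsilon> > 0"
  shows "\<exists>r>0. \<forall>h1 \<in> Hom.Map.mball h0 r. \<forall>h2 \<in> Hom.Map.mball h0 r. start_of h1 = start_of h2 \<longrightarrow>
        (\<forall>h\<in>Hom.Maps. end_of h = end_of h1 \<longrightarrow> (\<exists>h'\<in>Hom.Maps. start_of h' = start_of h \<and> end_of h' = end_of h2 \<and> Hom.mapd h h' < \<epsilon>))"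
proof -
  obtain n where n: "\<And>f g. (\<And>z. z \<in> {0..1} \<times> K n \<Longrightarrow> d (f z) (g z) \<le> \<epsilon>/2) \<Longrightarrow> Hom.mapd f g < \<epsilon>"
    using Hom.uniform_control[OF \<open>\<epsilon> > 0\<close>] by blast
  have C: "compactin cylinder ({0..1} \<times> K n)"
    by (rule Hom.compact_K)
  have "(h0 z, h0 z) \<in> \<Omega>_small (\<epsilon>/4)" if "z \<in> {0..1} \<times> K n" for z
    using that \<open>\<epsilon> > 0\<close> Hom.in_Maps[OF h0, of z] Hom.K_subset[of n] by (intro diag_\<Omega>_small) auto
  then obtain \<eta> where \<eta>: "\<eta> > 0" "\<forall>z\<in>{0..1} \<times> K n. \<forall>p\<in>M. \<forall>q\<in>M. d (h0 z) p < \<eta> \<longrightarrow> d (h0 z) q < \<eta> \<longrightarrow> (p, q) \<in> \<Omega>_small (\<epsilon>/4)"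
    using compact_graph_margin[OF Hom_continuous[OF h0] Hom_continuous[OF h0] C open_\<Omega>_small] by blast
  obtain r where r: "r > 0" "\<And>f g z. Hom.mapd f g < r \<Longrightarrow> z \<in> {0..1} \<times> K n \<Longrightarrow> d (f z) (g z) < \<eta>"
    using Hom.uniform_nbhd[OF C \<eta>(1)] by blast
  have "\<exists>h'\<in>Hom.Maps. start_of h' = start_of h \<and> end_of h' = end_of h2 \<and> Hom.mapd h h' < \<epsilon>"
    if h1: "h1 \<in> Hom.Map.mball h0 r" and h2: "h2 \<in> Hom.Map.mball h0 r" and start: "start_of h1 = start_of h2"
      and h: "h \<in> Hom.Maps" and ends: "end_of h = end_of h1" for h1 h2 h
  proof -
    have h12: "h1 \<in> Hom.Maps" "h2 \<in> Hom.Maps"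
      using h1 h2 by auto
    have start': "h1 (0, x) = h2 (0, x)" and ends': "h (1, x) = h1 (1, x)" if "x \<in> topspace X" for x
      using fun_cong[OF start, of x] fun_cong[OF ends, of x] that by (simp_all add: start_of_def end_of_def)
    have small: "(h1 z, h2 z) \<in> \<Omega>_small (\<epsilon>/4)" if z: "z \<in> {0..1} \<times> K n" for z
    proof -
      have "z \<in> topspace cylinder"
        using Hom.K_subset[of n] z by blast
      then have "h1 z \<in> M" "h2 z \<in> M"
        using Hom.in_Maps h12 by blast+
      moreover have "d (h0 z) (h1 z) < \<eta>" "d (h0 z) (h2 z) < \<eta>"
        using r(2)[OF _ z] h1 h2 by auto
      ultimately show ?thesis
        using \<eta>(2) z by blast
    qed
    obtain k where k: "continuous_map cylinder mtopology k"
      "\<And>x. x \<in> topspace X \<Longrightarrow> k (0, x) = h1 (1, x)" "\<And>x. x \<in> topspace X \<Longrightarrow> k (1, x) = h2 (1, x)"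
      "\<And>u x. u \<in> {0..1} \<Longrightarrow> x \<in> K n \<Longrightarrow> \<exists>v\<in>{0..1}. k (u, x) = \<theta> (h1 (1, x)) (h2 (1, x)) v"
    proof (rule exchange_end[OF normal_X closed_K Hom_continuous[OF h12(1)] Hom_continuous[OF h12(2)] start'])
      show "(h1 (t, x), h2 (t, x)) \<in> \<Omega>" if "t \<in> {0..1}" "x \<in> K n" for t x
        using small[of "(t, x)"] that by (simp add: \<Omega>_small_def)
    qed auto
    obtain \<delta> where \<delta>: "0 < \<delta>" "\<delta> < 1"
      "\<And>t t' x. t \<in> {0..1} \<Longrightarrow> t' \<in> {0..1} \<Longrightarrow> \<bar>t - t'\<bar> \<le> \<delta> \<Longrightarrow> x \<in> K n \<Longrightarrow> d (h (t, x)) (h (t', x)) < \<epsilon>/4"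
      using time_uniform[OF Hom_continuous[OF h] compact_K, of "\<epsilon>/4" n] \<open>\<epsilon> > 0\<close> by auto
    obtain g where g: "continuous_map cylinder mtopology g"
      "\<And>t x. t \<in> {0..1-\<delta>} \<Longrightarrow> g (t, x) = h (t / (1 - \<delta>), x)"
      "\<And>t x. t \<in> {1-\<delta><..1} \<Longrightarrow> g (t, x) = k ((t - (1 - \<delta>)) / \<delta>, x)"
      using append_homotopy[OF Hom_continuous[OF h] k(1) _ \<delta>(1,2)] ends' k(2) by metis
    define h' where "h' = restrict g (topspace cylinder)"
    have h'M: "h' \<in> Hom.Maps"
      unfolding h'_def by (rule restrict_Hom[OF g(1)])
    moreover have "start_of h' = start_of h"
      using g(2)[of 0] \<delta> by (auto simp: start_of_def h'_def fun_eq_iff restrict_def)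
    moreover have "end_of h' = end_of h2"
      using g(3)[of 1] k(3) \<delta> by (auto simp: end_of_def h'_def fun_eq_iff restrict_def)
    moreover have "Hom.mapd h h' < \<epsilon>"
    proof (rule n)
      fix z :: "real \<times> 'a" assume "z \<in> {0..1} \<times> K n"
      then obtain t x where z: "z = (t, x)" "t \<in> {0..1}" "x \<in> K n" and xX: "x \<in> topspace X"
        using K_subset[of n] by auto
      have h'g: "h' z = g (t, x)"
        using z xX by (simp add: h'_def)
      have htM: "h (t, x) \<in> M" "h (1, x) \<in> M"
        using Hom_in[OF h] z xX by auto
      show "d (h z) (h' z) \<le> \<epsilon>/2"
      proof (cases "t \<le> 1 - \<delta>")
        case True
        have "t * (1 - \<delta>) \<le> t"
          using z \<delta> by (simp add: mult_left_le)
        then have "t \<le> t / (1 - \<delta>)" "t / (1 - \<delta>) \<le> 1"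
          using True \<delta> by (simp_all add: field_simps)
        moreover have "t / (1 - \<delta>) - t = (t / (1 - \<delta>)) * \<delta>"
          using \<delta> by (simp add: field_simps)
        moreover have "(t / (1 - \<delta>)) * \<delta> \<le> 1 * \<delta>"
          using calculation \<delta> by (intro mult_right_mono) auto
        ultimately have "d (h (t, x)) (h (t / (1 - \<delta>), x)) < \<epsilon>/4"
          using z by (intro \<delta>(3)) auto
        then show ?thesis
          using g(2)[of t x] True z h'g \<open>\<epsilon> > 0\<close> by simp
      next
        case False
        define u where "u = (t - (1 - \<delta>)) / \<delta>"
        have u: "u \<in> {0..1}"
          using False z \<delta> by (auto simp: u_def field_simps)
        obtain v where v: "v \<in> {0..1}" "k (u, x) = \<theta> (h1 (1, x)) (h2 (1, x)) v"
          using k(4)[OF u z(3)] by blast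
        have "(h1 (1, x), h2 (1, x)) \<in> \<Omega>_small (\<epsilon>/4)"
          using small[of "(1, x)"] z by simp
        then have "d (k (u, x)) (h (1, x)) < \<epsilon>/4" "k (u, x) \<in> M"
          using v ends'[OF xX] \<theta>_in by (auto simp: \<Omega>_small_def)
        moreover have "d (h (t, x)) (h (1, x)) < \<epsilon>/4"
          using False z by (intro \<delta>(3)) auto
        ultimately have "d (h (t, x)) (k (u, x)) < \<epsilon>/2"
          using triangle'[of "h (t, x)" "h (1, x)" "k (u, x)"] htM by linarith
        moreover have "h' z = k (u, x)"
          using g(3)[of t x] False z h'g by (simp add: u_def)
        ultimately show ?thesis
          using z by simp
      qed
    qed
    ultimately show ?thesis
      by blast
  qed
  with r(1) show ?thesis
    by blast
qed

text \<open>A start \<open>y'\<close> close to that of \<open>h\<close> is extended by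
  \<open>lift_start\<close> to a homotopy close to \<open>h\<close>. On \<open>K n\<close>, before
  time \<open>\<delta>\<close>, three errors of \<open>\<epsilon>/8\<close> add up: the drift of
  \<open>h\<close> from its start, the distance of the two starts, and the canonical path. Later
  only the time displacement of at most \<open>\<delta>\<close> remains.\<close>

lemma open_map_start_of: "open_map Hom.Map.mtopology Map.mtopology start_of"
  unfolding open_map_def
proof (intro allI impI)
  fix U assume U: "openin Hom.Map.mtopology U"
  show "openin Map.mtopology (start_of ` U)"
    unfolding Map.openin_mtopology
  proof (intro conjI allI impI)
    show "start_of ` U \<subseteq> Maps"
      using openin_subset[OF U] start_of_in by auto
    fix y assume "y \<in> start_of ` U"
    then obtain h where hU: "h \<in> U" and y: "y = start_of h"
      by blast
    then obtain \<epsilon> where \<epsilon>: "\<epsilon> > 0" "Hom.Map.mball h \<epsilon> \<subseteq> U" and h: "h \<in> Hom.Maps"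
      using U unfolding Hom.Map.openin_mtopology by blast
    obtain n where n: "\<And>f g. (\<And>z. z \<in> {0..1} \<times> K n \<Longrightarrow> d (f z) (g z) \<le> \<epsilon>/2) \<Longrightarrow> Hom.mapd f g < \<epsilon>"
      using Hom.uniform_control[OF \<epsilon>(1)] by blast
    obtain \<delta> where \<delta>: "0 < \<delta>" "\<delta> < 1"
      "\<And>t t' x. t \<in> {0..1} \<Longrightarrow> t' \<in> {0..1} \<Longrightarrow> \<bar>t - t'\<bar> \<le> \<delta> \<Longrightarrow> x \<in> K n \<Longrightarrow> d (h (t, x)) (h (t', x)) < \<epsilon>/8"
      using time_uniform[OF Hom_continuous[OF h] compact_K, of "\<epsilon>/8" n] \<epsilon>(1) by auto
    have yM: "y \<in> Maps"
      using y h start_of_in by blast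
    then have yc: "continuous_map X mtopology y"
      by (simp add: map_set_def)
    have "(y x, y x) \<in> \<Omega>_small (\<epsilon>/8)" if "x \<in> K n" for x
      using that \<epsilon>(1) in_Maps[OF yM, of x] K_subset[of n] by (intro diag_\<Omega>_small) auto
    \<comment> \<open>Both coordinates are perturbed from \<open>y x\<close>; the pair needed below
      is \<open>(y' x, y x)\<close>, whose second entry is \<open>h (0, x)\<close>.\<close>
    then obtain \<eta> where \<eta>: "\<eta> > 0" "\<forall>x\<in>K n. \<forall>p\<in>M. \<forall>q\<in>M. d (y x) p < \<eta> \<longrightarrow> d (y x) q < \<eta> \<longrightarrow> (p, q) \<in> \<Omega>_small (\<epsilon>/8)"
      using compact_graph_margin[OF yc yc compact_K open_\<Omega>_small] by blast
    obtain r where r: "r > 0" "\<And>f g x. mapd f g < r \<Longrightarrow> x \<in> K n \<Longrightarrow> d (f x) (g x) < min \<eta> (\<epsilon>/8)"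
      using uniform_nbhd[OF compact_K, of "min \<eta> (\<epsilon>/8)" n] \<eta>(1) \<epsilon>(1) by auto
    have "y' \<in> start_of ` U" if y': "y' \<in> Map.mball y r" for y'
    proof -
      have y'M: "y' \<in> Maps" and close: "\<And>x. x \<in> K n \<Longrightarrow> d (y x) (y' x) < min \<eta> (\<epsilon>/8)"
        using y' r(2) by auto
      have y'c: "continuous_map X mtopology y'"
        using y'M by (simp add: map_set_def)
      have small: "(y' x, h (0, x)) \<in> \<Omega>_small (\<epsilon>/8)" if x: "x \<in> K n" for x
      proof -
        have xX: "x \<in> topspace X"
          using x K_subset by blast
        have "y' x \<in> M" "y x \<in> M" "d (y x) (y' x) < \<eta>" "d (y x) (y x) < \<eta>"
          using in_Maps[OF y'M xX] in_Maps[OF yM xX] close[OF x] \<eta>(1) by auto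
        then have "(y' x, y x) \<in> \<Omega>_small (\<epsilon>/8)"
          using \<eta>(2) x by blast
        then show ?thesis
          using xX by (simp add: y start_of_def)
      qed
      obtain k where k: "continuous_map cylinder mtopology k"
        "\<And>x. x \<in> topspace X \<Longrightarrow> k (0, x) = y' x"
        "\<And>t x. t \<in> {0..\<delta>} \<Longrightarrow> x \<in> K n \<Longrightarrow> \<exists>v\<in>{0..1}. k (t, x) = \<theta> (y' x) (h (0, x)) v"
        "\<And>t x. t \<in> {\<delta><..1} \<Longrightarrow> x \<in> K n \<Longrightarrow> k (t, x) = h ((t - \<delta>) / (1 - \<delta>), x)"
      proof (rule lift_start[OF normal_X closed_K y'c Hom_continuous[OF h] _ \<delta>(1,2)])
        show "(y' x, h (0, x)) \<in> \<Omega>" if "x \<in> K n" for x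
          using small[OF that] by (simp add: \<Omega>_small_def)
      qed (rule that)
      define h' where "h' = restrict k (topspace cylinder)"
      have h'M: "h' \<in> Hom.Maps"
        unfolding h'_def by (rule restrict_Hom[OF k(1)])
      have "Hom.mapd h h' < \<epsilon>"
      proof (rule n)
        fix z :: "real \<times> 'a" assume "z \<in> {0..1} \<times> K n"
        then obtain t x where z: "z = (t, x)" "t \<in> {0..1}" "x \<in> K n" and xX: "x \<in> topspace X"
          using K_subset[of n] by auto
        have h'k: "h' z = k (t, x)"
          using z xX by (simp add: h'_def)
        have M: "h (t, x) \<in> M" "h (0, x) \<in> M" "y' x \<in> M"
          using Hom_in[OF h] z xX in_Maps[OF y'M xX] by auto
        show "d (h z) (h' z) \<le> \<epsilon>/2"
        proof (cases "t \<le> \<delta>")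
          case True
          then obtain v where v: "v \<in> {0..1}" "k (t, x) = \<theta> (y' x) (h (0, x)) v"
            using k(3)[of t x] z by auto
          have "d (k (t, x)) (y' x) < \<epsilon>/8" "k (t, x) \<in> M"
            using small[OF z(3)] v \<theta>_in by (auto simp: \<Omega>_small_def)
          moreover have "d (h (0, x)) (y' x) < \<epsilon>/8"
            using close[OF z(3)] xX by (simp add: y start_of_def)
          moreover have "d (h (t, x)) (h (0, x)) < \<epsilon>/8"
            using True z by (intro \<delta>(3)) auto
          ultimately have "d (h (t, x)) (k (t, x)) < \<epsilon>/2"
            using triangle[of "h (t, x)" "h (0, x)" "y' x"] triangle'[of "h (t, x)" "y' x" "k (t, x)"] M \<epsilon>(1) by linarith
          then show ?thesis
            using z h'k by simp
        next
          case False
          define u where "u = (t - \<delta>) / (1 - \<delta>)"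
          have u: "u \<in> {0..1}"
            using False z \<delta> by (auto simp: u_def field_simps)
          have "t - u = \<delta> * (1 - u)"
            using \<delta> by (simp add: u_def field_simps)
          then have "0 \<le> t - u" "t - u \<le> \<delta>"
            using u \<delta> by (simp_all add: mult_left_le)
          then have "d (h (t, x)) (h (u, x)) < \<epsilon>/8"
            using u z by (intro \<delta>(3)) auto
          then show ?thesis
            using k(4)[of t x] False z h'k \<epsilon>(1) by (simp add: u_def)
        qed
      qed
      then have "h' \<in> U"
        using \<epsilon> h h'M by auto
      moreover have "start_of h' x = y' x" for x
        using k(2)[of x] y'M by (auto simp: start_of_def h'_def map_set_def extensional_def)
      then have "start_of h' = y'"
        by blast
      ultimately show ?thesis
        by blast
    qed
    with r(1) show "\<exists>r>0. Map.mball y r \<subseteq> start_of ` U"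
      by blast
  qed
qed

lemma homotopy_relation_eq: "(\<lambda>h. (start_of h, end_of h)) ` Hom.Maps = homotopy_relation X mtopology"
proof (intro equalityI subsetI)
  fix z assume "z \<in> (\<lambda>h. (start_of h, end_of h)) ` Hom.Maps"
  then obtain h where h: "h \<in> Hom.Maps" "z = (start_of h, end_of h)"
    by blast
  have "homotopic_with (\<lambda>_. True) X mtopology (start_of h) (end_of h)"
    by (subst homotopic_with) (use Hom_continuous[OF h(1)] in \<open>auto simp: start_of_def end_of_def\<close>)
  then show "z \<in> homotopy_relation X mtopology"
    using h start_of_in end_of_in by (simp add: homotopy_relation_def)
next
  fix z assume "z \<in> homotopy_relation X mtopology"
  then obtain f g where z: "z = (f, g)" "f \<in> Maps" "g \<in> Maps" "homotopic_with (\<lambda>_. True) X mtopology f g"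
    by (auto simp: homotopy_relation_def)
  then obtain k where k: "continuous_map cylinder mtopology k" "\<forall>x. k (0, x) = f x" "\<forall>x. k (1, x) = g x"
    unfolding homotopic_with_def by blast
  define h where "h = restrict k (topspace cylinder)"
  have "h \<in> Hom.Maps"
    unfolding h_def by (rule restrict_Hom[OF k(1)])
  moreover have "start_of h = f" "end_of h = g"
    using k z(2,3) by (auto simp: start_of_def end_of_def h_def map_set_def extensional_def fun_eq_iff)
  ultimately show "z \<in> (\<lambda>h. (start_of h, end_of h)) ` Hom.Maps"
    using z(1) by blast
qed

end

lemma equiv_homotopy_relation: "equiv (map_set X Y) (homotopy_relation X Y)"
proof (rule equivI)
  show "refl_on (map_set X Y) (homotopy_relation X Y)"
    by (auto simp: refl_on_def homotopy_relation_def map_set_def)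
  show "sym (homotopy_relation X Y)"
    by (auto simp: sym_def homotopy_relation_def homotopic_with_sym)
  show "trans (homotopy_relation X Y)"
    by (auto simp: homotopy_relation_def intro!: transI intro: homotopic_with_trans)
qed (auto simp: homotopy_relation_def)

context homotopy_setting
begin

sublocale paths: path_structure Hom.Maps Hom.mapd Maps mapd start_of end_of
proof
  show "Hom.Map.mcomplete"
    by (rule Hom.mcomplete_mapd[OF complete_M])
  show "separable_space Hom.Map.mtopology"
    by (intro Hom.separable_mapd second_countable_prod_topology second_countable_X separable_M
        second_countable_subtopology second_countable_euclidean)
  show "continuous_map Hom.Map.mtopology Map.mtopology start_of"
    using continuous_map_slice[of 0] by (simp add: start_of_def[abs_def])
  show "continuous_map Hom.Map.mtopology Map.mtopology end_of"
    using continuous_map_slice[of 1] by (simp add: end_of_def[abs_def])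
  show "open_map Hom.Map.mtopology Map.mtopology start_of"
    by (rule open_map_start_of)
  show "equiv Maps ((\<lambda>h. (start_of h, end_of h)) ` Hom.Maps)"
    unfolding homotopy_relation_eq by (rule equiv_homotopy_relation)
qed (rule transport_homotopy)

lemma E_eq: "paths.E = homotopy_relation X mtopology"
  by (simp add: paths.E_def homotopy_relation_eq)

lemma Polish_mapping_space: "Polish_space (compact_open_topology X mtopology)"
  unfolding Polish_space_def mtopology_mapd[symmetric]
  using separable_mapd[OF second_countable_X separable_M] mcomplete_mapd[OF complete_M]
    Map.completely_metrizable_space_mtopology by blast

end

section \<open>H-groups\<close>

lemma exhaustion_exists:
  assumes lc: "locally_compact_space X" and sc: "second_countable X"
  obtains K where "exhausted_space X K"
proof -
  have nbhd: "\<exists>L'. compactin X L' \<and> L \<subseteq> X interior_of L'" if L: "compactin X L" for L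
  proof -
    have "\<forall>x\<in>L. \<exists>U C. openin X U \<and> compactin X C \<and> x \<in> U \<and> U \<subseteq> C"
      using lc compactin_subset_topspace[OF L] unfolding locally_compact_space_def by blast
    then obtain U C where UC: "\<And>x. x \<in> L \<Longrightarrow> openin X (U x) \<and> compactin X (C x) \<and> x \<in> U x \<and> U x \<subseteq> C x"
      by metis
    have "openin X (U x)" if "x \<in> L" for x
      using UC[OF that] by simp
    moreover have "L \<subseteq> (\<Union>x\<in>L. U x)"
      using UC by auto
    ultimately obtain F where F: "finite F" "F \<subseteq> L" "L \<subseteq> (\<Union>x\<in>F. U x)"
      by (rule compactin_subcover_image[OF L])
    have "compactin X (\<Union>(C ` F))"
      using F UC by (intro compactin_Union) auto
    moreover have "(\<Union>x\<in>F. U x) \<subseteq> X interior_of (\<Union>(C ` F))"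
    proof (rule interior_of_maximal)
      show "(\<Union>x\<in>F. U x) \<subseteq> \<Union>(C ` F)"
        using F(2) UC by (intro UN_mono) auto
      show "openin X (\<Union>x\<in>F. U x)"
        using F(2) UC by (intro openin_Union) auto
    qed
    ultimately show ?thesis
      using F(3) by blast
  qed
  obtain \<B> where \<B>: "countable \<B>" "\<forall>V \<in> \<B>. openin X V" "\<forall>U x. openin X U \<and> x \<in> U \<longrightarrow> (\<exists>V \<in> \<B>. x \<in> V \<and> V \<subseteq> U)"
    using sc unfolding second_countable_def by (elim exE conjE)
  \<comment> \<open>Basic sets with a compact superset still cover \<open>X\<close> by local
    compactness. The empty set is added to make the family nonempty, so that
    \<open>from_nat_into\<close> enumerates it.\<close>
  define \<B>' where "\<B>' = insert {} {B\<in>\<B>. \<exists>C. compactin X C \<and> B \<subseteq> C}"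
  have range: "range (from_nat_into \<B>') = \<B>'"
    using \<B>(1) by (intro range_from_nat_into) (auto simp: \<B>'_def)
  have "\<exists>C. compactin X C \<and> from_nat_into \<B>' n \<subseteq> C" for n
  proof -
    have "from_nat_into \<B>' n \<in> \<B>'"
      using range by blast
    then show ?thesis
      by (auto simp: \<B>'_def intro: exI[of _ "{}"])
  qed
  then obtain D where D: "\<And>n. compactin X (D n) \<and> from_nat_into \<B>' n \<subseteq> D n"
    by metis
  \<comment> \<open>Absorbing \<open>D n\<close> at stage \<open>Suc n\<close> makes the union
    everything, while the interior condition makes the exhaustion cofinal among compact
    sets.\<close>
  have "\<exists>K. \<forall>n. compactin X (K n) \<and> K n \<union> D n \<subseteq> X interior_of K (Suc n)"
  proof (rule dependent_nat_choice)
    show "\<exists>K. compactin X K"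
      by (rule exI[of _ "{}"]) simp
    show "\<exists>K'. compactin X K' \<and> K \<union> D n \<subseteq> X interior_of K'" if "compactin X K" for K n
      using nbhd[of "K \<union> D n"] compactin_Un[OF that, of "D n"] D by blast
  qed
  then obtain K where K: "\<And>n. compactin X (K n)" "\<And>n. K n \<union> D n \<subseteq> X interior_of K (Suc n)"
    by blast
  have "exhausted_space X K"
  proof
    show "topspace X \<subseteq> (\<Union>n. K n)"
    proof
      fix x assume "x \<in> topspace X"
      then obtain U C where UC: "openin X U" "compactin X C" "x \<in> U" "U \<subseteq> C"
        using lc unfolding locally_compact_space_def by blast
      then obtain B where B: "B \<in> \<B>" "x \<in> B" "B \<subseteq> U"
        using \<B>(3) by meson
      then have "B \<in> \<B>'"
        using UC(2,4) unfolding \<B>'_def by blast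
      then obtain n where "B = from_nat_into \<B>' n"
        using range by (metis imageE)
      then have "x \<in> K (Suc n)"
        using B D[of n] K(2)[of n] interior_of_subset[of X "K (Suc n)"] by blast
      then show "x \<in> (\<Union>n. K n)"
        by blast
    qed
  qed (use K in auto)
  then show ?thesis
    by (rule that)
qed

section \<open>Division up to homotopy\<close>

lemma homotopic_with_pair:
  assumes "homotopic_with (\<lambda>_. True) X A f f'" "homotopic_with (\<lambda>_. True) X B g g'"
  shows "homotopic_with (\<lambda>_. True) X (prod_topology A B) (\<lambda>x. (f x, g x)) (\<lambda>x. (f' x, g' x))"
proof -
  obtain h where h: "continuous_map (prod_topology unit_interval X) A h" "\<forall>x. h (0, x) = f x" "\<forall>x. h (1, x) = f' x"
    using assms(1) unfolding homotopic_with_def by blast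
  obtain k where k: "continuous_map (prod_topology unit_interval X) B k" "\<forall>x. k (0, x) = g x" "\<forall>x. k (1, x) = g' x"
    using assms(2) unfolding homotopic_with_def by blast
  show ?thesis
    unfolding homotopic_with_def
    using h k by (intro exI[of _ "\<lambda>z. (h z, k z)"]) (auto intro: continuous_map_pairedI)
qed

lemma homotopic_with_forget:
  assumes "homotopic_with Q X Y f g"
  shows "homotopic_with (\<lambda>_. True) X Y f g"
  using assms by (rule homotopic_with_mono) simp

lemma homotopic_with_precompose:
  assumes "homotopic_with Q Y Z f g" "continuous_map X Y h"
  shows "homotopic_with (\<lambda>_. True) X Z (\<lambda>x. f (h x)) (\<lambda>x. g (h x))"
  using homotopic_with_compose_continuous_map_right[OF homotopic_with_forget[OF assms(1)] assms(2), of "\<lambda>_. True"]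
  by (simp add: o_def)

lemma homotopic_with_postcompose:
  assumes "homotopic_with (\<lambda>_. True) X Y f g" "continuous_map Y Z h"
  shows "homotopic_with (\<lambda>_. True) X Z (\<lambda>x. h (f x)) (\<lambda>x. h (g x))"
  using homotopic_with_compose_continuous_map_left[OF assms, of "\<lambda>_. True"] by (simp add: o_def)

context
  fixes P :: "'p topology" and e \<mu> z A B
  assumes cont_\<mu>: "continuous_map (prod_topology P P) P \<mu>" and e: "e \<in> topspace P" and cont_z: "continuous_map P P z"
    and assoc: "homotopic_with A (prod_topology P (prod_topology P P)) P
       (\<lambda>(a, b, c). \<mu> (\<mu> (a, b), c)) (\<lambda>(a, b, c). \<mu> (a, \<mu> (b, c)))"
    and unit_left: "homotopic_with B P P (\<lambda>a. \<mu> (e, a)) (\<lambda>a. a)"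
    and unit_right: "homotopic_with B P P (\<lambda>a. \<mu> (a, e)) (\<lambda>a. a)"
    and inv_left: "homotopic_with B P P (\<lambda>a. \<mu> (z a, a)) (\<lambda>_. e)"
    and inv_right: "homotopic_with B P P (\<lambda>a. \<mu> (a, z a)) (\<lambda>_. e)"
begin

text \<open>The group computation, pulled back along \<open>f\<close> and \<open>g\<close>.
  Forwards, multiply by the inverse of \<open>g\<close> on the right. Backwards, \<open>f\<close> is
  homotopic to \<open>f e\<close>, to \<open>f (g' g)\<close>, to \<open>(f g') g\<close>, to
  \<open>e g\<close>, and so to \<open>g\<close>, where \<open>g'\<close> denotes the inverse
  \<open>z\<close> after \<open>g\<close>.\<close>

lemma homotopic_iff_difference_null:
  assumes f: "continuous_map X P f" and g: "continuous_map X P g"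
  shows "homotopic_with (\<lambda>_. True) X P f g \<longleftrightarrow> homotopic_with (\<lambda>_. True) X P (\<lambda>x. \<mu> (f x, z (g x))) (\<lambda>_. e)"
proof
  let ?H = "homotopic_with (\<lambda>_. True) X P"
  have mult: "?H (\<lambda>x. \<mu> (a x, b x)) (\<lambda>x. \<mu> (a' x, b' x))" if "?H a a'" "?H b b'" for a a' b b'
    using homotopic_with_postcompose[OF homotopic_with_pair[OF that] cont_\<mu>] .
  have zg: "continuous_map X P (\<lambda>x. z (g x))"
    using continuous_map_compose[OF g cont_z] by (simp add: o_def)
  note homotopic_with_trans [trans]
  have refl: "?H a a" if "continuous_map X P a" for a
    using that by simp
  {
    assume "?H f g"
    then have "?H (\<lambda>x. \<mu> (f x, z (g x))) (\<lambda>x. \<mu> (g x, z (g x)))"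
      by (rule mult[OF _ refl[OF zg]])
    moreover have "?H (\<lambda>x. \<mu> (g x, z (g x))) (\<lambda>_. e)"
      using homotopic_with_precompose[OF inv_right g] .
    ultimately show "?H (\<lambda>x. \<mu> (f x, z (g x))) (\<lambda>_. e)"
      by (rule homotopic_with_trans)
  }
  assume null: "?H (\<lambda>x. \<mu> (f x, z (g x))) (\<lambda>_. e)"
  have "?H f (\<lambda>x. \<mu> (f x, e))"
    using homotopic_with_precompose[OF unit_right f] by (rule homotopic_with_symD)
  also have "?H (\<lambda>x. \<mu> (f x, e)) (\<lambda>x. \<mu> (f x, \<mu> (z (g x), g x)))"
    by (rule mult[OF refl[OF f] homotopic_with_symD[OF homotopic_with_precompose[OF inv_left g]]])
  also have "?H (\<lambda>x. \<mu> (f x, \<mu> (z (g x), g x))) (\<lambda>x. \<mu> (\<mu> (f x, z (g x)), g x))"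
    using homotopic_with_precompose[OF assoc continuous_map_pairedI[OF f continuous_map_pairedI[OF zg g]]]
    by (simp add: homotopic_with_symD)
  also have "?H (\<lambda>x. \<mu> (\<mu> (f x, z (g x)), g x)) (\<lambda>x. \<mu> (e, g x))"
    by (rule mult[OF null refl[OF g]])
  also have "?H (\<lambda>x. \<mu> (e, g x)) g"
    using homotopic_with_precompose[OF unit_left g] .
  finally show "?H f g" .
qed

end

section \<open>Pointwise operations on mapping spaces\<close>

context metric_mapping_space
begin

text \<open>It suffices to pull back the sets generating the compact-open topology. Over the compact
  set \<open>C\<close> the graph of \<open>(f, g)\<close> lies in the open preimage \<open>W\<close>
  of \<open>U\<close> under \<open>m\<close>, and its margin in \<open>W\<close> gives a product of
  balls around \<open>(f, g)\<close>.\<close>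

lemma continuous_map_pointwise_operation:
  assumes m: "continuous_map (prod_topology mtopology mtopology) mtopology m"
  shows "continuous_map (prod_topology Map.mtopology Map.mtopology) Map.mtopology
     (\<lambda>(f, g). restrict (\<lambda>x. m (f x, g x)) (topspace X))"
proof -
  let ?T = "prod_topology Map.mtopology Map.mtopology"
  let ?F = "\<lambda>(f, g). restrict (\<lambda>x. m (f x, g x)) (topspace X)"
  have F_in: "?F fg \<in> Maps" if "fg \<in> Maps \<times> Maps" for fg
  proof -
    obtain f g where fg: "fg = (f, g)" "f \<in> Maps" "g \<in> Maps"
      using \<open>fg \<in> Maps \<times> Maps\<close> by auto
    then have "continuous_map X (prod_topology mtopology mtopology) (\<lambda>x. (f x, g x))"
      by (auto simp: map_set_def intro: continuous_map_pairedI)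
    from continuous_map_compose[OF this m]
    have "continuous_map X mtopology (\<lambda>x. m (f x, g x))"
      by (simp add: o_def)
    then have "continuous_map X mtopology (restrict (\<lambda>x. m (f x, g x)) (topspace X))"
      by (rule continuous_map_eq) simp
    then show ?thesis
      by (simp add: fg map_set_def)
  qed
  have "openin ?T (?F -` {f \<in> Maps. f ` C \<subseteq> U} \<inter> topspace ?T)" if C: "compactin X C" and U: "openin mtopology U" for C U
  proof (subst openin_subopen, intro ballI)
    fix fg assume fg: "fg \<in> ?F -` {f \<in> Maps. f ` C \<subseteq> U} \<inter> topspace ?T"
    then obtain f g where fgM: "fg = (f, g)" "f \<in> Maps" "g \<in> Maps"
      by auto
    have CX: "C \<subseteq> topspace X"
      using C compactin_subset_topspace by blast
    define W where "W = {pq \<in> topspace (prod_topology mtopology mtopology). m pq \<in> U}"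
    have W: "openin (prod_topology mtopology mtopology) W"
      unfolding W_def by (rule openin_continuous_map_preimage[OF m U])
    have fgW: "(f x, g x) \<in> W" if x: "x \<in> C" for x
    proof -
      have "x \<in> topspace X"
        using x CX by blast
      moreover have "?F (f, g) ` C \<subseteq> U"
        using fg fgM(1) by blast
      ultimately show ?thesis
        using x in_Maps[OF fgM(2)] in_Maps[OF fgM(3)] by (auto simp: W_def image_subset_iff)
    qed
    have "continuous_map X mtopology f" "continuous_map X mtopology g"
      using fgM by (auto simp: map_set_def)
    from compact_graph_margin[OF this C W fgW]
    obtain \<eta> where \<eta>: "\<eta> > 0" "\<forall>x\<in>C. \<forall>p\<in>M. \<forall>q\<in>M. d (f x) p < \<eta> \<longrightarrow> d (g x) q < \<eta> \<longrightarrow> (p, q) \<in> W"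
      by blast
    obtain r where r: "r > 0" "\<And>f g x. mapd f g < r \<Longrightarrow> x \<in> C \<Longrightarrow> d (f x) (g x) < \<eta>"
      using uniform_nbhd[OF C \<eta>(1)] by blast
    have "Map.mball f r \<times> Map.mball g r \<subseteq> ?F -` {f \<in> Maps. f ` C \<subseteq> U} \<inter> topspace ?T"
    proof
      fix fg' assume fg': "fg' \<in> Map.mball f r \<times> Map.mball g r"
      then obtain f' g' where f'g': "fg' = (f', g')" "f' \<in> Maps" "g' \<in> Maps" "mapd f f' < r" "mapd g g' < r"
        by auto
      have "m (f' x, g' x) \<in> U" if x: "x \<in> C" for x
      proof -
        have "x \<in> topspace X"
          using x CX by blast
        then have "f' x \<in> M" "g' x \<in> M" "d (f x) (f' x) < \<eta>" "d (g x) (g' x) < \<eta>"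
          using in_Maps f'g' r(2) x by auto
        then have "(f' x, g' x) \<in> W"
          using \<eta>(2) x by blast
        then show ?thesis
          by (simp add: W_def)
      qed
      then have "?F fg' ` C \<subseteq> U"
        using CX by (auto simp: f'g'(1))
      moreover have "fg' \<in> Maps \<times> Maps"
        using f'g' by blast
      ultimately show "fg' \<in> ?F -` {f \<in> Maps. f ` C \<subseteq> U} \<inter> topspace ?T"
        using F_in[of fg'] by simp
    qed
    moreover have "openin ?T (Map.mball f r \<times> Map.mball g r)"
      by (simp add: openin_prod_Times_iff)
    moreover have "fg \<in> Map.mball f r \<times> Map.mball g r"
      using fgM r by simp
    ultimately show "\<exists>T. openin ?T T \<and> fg \<in> T \<and> T \<subseteq> ?F -` {f \<in> Maps. f ` C \<subseteq> U} \<inter> topspace ?T"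
      by blast
  qed
  moreover have "?F ` topspace ?T \<subseteq> \<Union>{{f \<in> Maps. f ` C \<subseteq> U} | C U. compactin X C \<and> openin mtopology U}"
  proof -
    have "?F ` topspace ?T \<subseteq> Maps"
      using F_in by (intro image_subsetI) simp
    also have "Maps = topspace (compact_open_topology X mtopology)"
      by (simp add: topspace_compact_open_topology)
    finally show ?thesis
      by (simp add: compact_open_topology_def)
  qed
  ultimately have "continuous_map ?T (compact_open_topology X mtopology) ?F"
    unfolding compact_open_topology_def by (intro continuous_on_generated_topo) auto
  then show ?thesis
    by (simp add: mtopology_mapd)
qed

end

context homotopy_setting
begin

lemma homotopy_class_Borel:
  assumes "f \<in> Maps"
  shows "homotopy_relation X mtopology `` {f} \<in> sets (borel_of Map.mtopology)"
  using paths.class_Borel[OF assms] by (simp add: E_eq)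

text \<open>In an H-group, \<open>f\<close> and \<open>g\<close> are homotopic iff \<open>\<mu> (f, z g)\<close> is null-homotopic, so that the relation is a
  continuous preimage of the class of the constant map.\<close>

lemma Borel_homotopy_relation:
  assumes \<mu>: "continuous_map (prod_topology mtopology mtopology) mtopology \<mu>" and z: "continuous_map mtopology mtopology z"
    and e: "e \<in> M"
    and diff: "\<And>f g. continuous_map X mtopology f \<Longrightarrow> continuous_map X mtopology g \<Longrightarrow>
      homotopic_with (\<lambda>_. True) X mtopology f g \<longleftrightarrow> homotopic_with (\<lambda>_. True) X mtopology (\<lambda>x. \<mu> (f x, z (g x))) (\<lambda>_. e)"
  shows "Borel_relation (compact_open_topology X mtopology) (homotopy_relation X mtopology)"
proof -
  define m where "m pq = \<mu> (fst pq, z (snd pq))" for pq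
  have "continuous_map (prod_topology mtopology mtopology) mtopology (\<lambda>pq. z (snd pq))"
    using continuous_map_compose[OF continuous_map_snd z] by (simp add: o_def)
  from continuous_map_compose[OF continuous_map_pairedI[OF continuous_map_fst this] \<mu>]
  have m: "continuous_map (prod_topology mtopology mtopology) mtopology m"
    by (simp add: o_def m_def[abs_def])
  define F where "F = (\<lambda>(f, g). restrict (\<lambda>x. m (f x, g x)) (topspace X))"
  have F: "continuous_map (prod_topology Map.mtopology Map.mtopology) Map.mtopology F"
    unfolding F_def by (rule continuous_map_pointwise_operation[OF m])
  define c where "c = restrict (\<lambda>_. e) (topspace X)"
  have c: "c \<in> Maps"
    using e by (auto simp: c_def map_set_def intro: continuous_map_eq[of X mtopology "\<lambda>_. e"])
  have "F -` (homotopy_relation X mtopology `` {c}) \<inter> space (borel_of (prod_topology Map.mtopology Map.mtopology))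
      = homotopy_relation X mtopology"
  proof -
    have "(c, F (f, g)) \<in> homotopy_relation X mtopology \<longleftrightarrow> (f, g) \<in> homotopy_relation X mtopology"
      if fg: "f \<in> Maps" "g \<in> Maps" for f g
    proof -
      have "F (f, g) \<in> Maps"
        using F fg by (auto simp: continuous_map_def Pi_iff)
      then have "(c, F (f, g)) \<in> homotopy_relation X mtopology \<longleftrightarrow> homotopic_with (\<lambda>_. True) X mtopology (F (f, g)) c"
        using c by (simp add: homotopy_relation_def homotopic_with_sym)
      also have "\<dots> \<longleftrightarrow> homotopic_with (\<lambda>_. True) X mtopology (\<lambda>x. \<mu> (f x, z (g x))) (\<lambda>_. e)"
        by (rule iffI; erule homotopic_with_eq) (auto simp: F_def c_def m_def)
      also have "\<dots> \<longleftrightarrow> homotopic_with (\<lambda>_. True) X mtopology f g"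
        using diff[of f g] fg by (simp add: map_set_def)
      also have "\<dots> \<longleftrightarrow> (f, g) \<in> homotopy_relation X mtopology"
        using fg by (simp add: homotopy_relation_def)
      finally show ?thesis .
    qed
    moreover have "homotopy_relation X mtopology \<subseteq> Maps \<times> Maps"
      by (auto simp: homotopy_relation_def)
    ultimately show ?thesis
      by auto
  qed
  then show ?thesis
    unfolding Borel_relation_def mtopology_mapd[symmetric]
    using measurable_sets[OF continuous_map_measurable_borel_of[OF F] homotopy_class_Borel[OF c]] by simp
qed

end

theorem theorem1p2:
  fixes M :: "'a set" and d :: "'a \<Rightarrow> 'a \<Rightarrow> real" and X :: "'a topology"
    and P :: "'p topology" and e :: 'p and \<mu> :: "'p \<times> 'p \<Rightarrow> 'p"
  assumes "Metric_space M d"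
    and "X = Metric_space.mtopology M d"
    and "locally_compact_space X"
    and "separable_space X"
    and "polyhedral_H_group P e \<mu>"
  shows "Polish_space (compact_open_topology X P) \<and>
         equiv (topspace (compact_open_topology X P)) (homotopy_relation X P) \<and>
         Borel_relation (compact_open_topology X P) (homotopy_relation X P) \<and>
         idealistic (compact_open_topology X P) (homotopy_relation X P)"
proof -
  have X: "metrizable_space X" "second_countable X"
    using assms Metric_space.metrizable_space_mtopology Metric_space.separable_imp_second_countable by metis+
  obtain K where K: "exhausted_space X K"
    using exhaustion_exists[OF assms(3) X(2)] .
  have poly: "polyhedron P" and e: "e \<in> topspace P" and \<mu>: "continuous_map (prod_topology P P) P \<mu>"
    and assoc: "homotopic_with (\<lambda>h. h (e, e, e) = e) (prod_topology P (prod_topology P P)) P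
       (\<lambda>(a, b, c). \<mu> (\<mu> (a, b), c)) (\<lambda>(a, b, c). \<mu> (a, \<mu> (b, c)))"
    and unit: "homotopic_with (\<lambda>h. h e = e) P P (\<lambda>a. \<mu> (e, a)) (\<lambda>a. a)" "homotopic_with (\<lambda>h. h e = e) P P (\<lambda>a. \<mu> (a, e)) (\<lambda>a. a)"
    and ex_z: "\<exists>z. continuous_map P P z \<and> z e = e \<and>
        homotopic_with (\<lambda>h. h e = e) P P (\<lambda>a. \<mu> (z a, a)) (\<lambda>_. e) \<and>
        homotopic_with (\<lambda>h. h e = e) P P (\<lambda>a. \<mu> (a, z a)) (\<lambda>_. e)"
    using assms(5) unfolding polyhedral_H_group_def by simp_all
  obtain z where z: "continuous_map P P z" "homotopic_with (\<lambda>h. h e = e) P P (\<lambda>a. \<mu> (z a, a)) (\<lambda>_. e)"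
    "homotopic_with (\<lambda>h. h e = e) P P (\<lambda>a. \<mu> (a, z a)) (\<lambda>_. e)"
    using ex_z by blast
  \<comment> \<open>Any complete metric for the topology of \<open>P\<close> serves: by
    \<open>mtopology_mapd\<close> the metric on maps built from it induces the compact-open
    topology.\<close>
  obtain N dN where N: "Metric_space N dN" "Metric_space.mcomplete N dN" "P = Metric_space.mtopology N dN"
    using polyhedron_Polish_locally_equiconnected(1)[OF poly]
    unfolding Polish_space_def completely_metrizable_space_def by blast
  have sep: "separable_space P"
    using polyhedron_Polish_locally_equiconnected(1)[OF poly] by (simp add: Polish_space_def)
  obtain \<Omega> \<theta> where "openin (prod_topology P P) \<Omega>" "\<forall>p\<in>topspace P. (p, p) \<in> \<Omega>"
     "continuous_map (prod_topology (subtopology (prod_topology P P) \<Omega>) (top_of_set {0..1::real})) P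
       (\<lambda>z. \<theta> (fst (fst z)) (snd (fst z)) (snd z))"
     "\<forall>(p, q)\<in>\<Omega>. \<theta> p q 0 = p \<and> \<theta> p q 1 = q"
     "\<forall>p\<in>topspace P. \<forall>u\<in>{0..1}. \<theta> p p u = p"
    using polyhedron_Polish_locally_equiconnected(2)[OF poly]
    unfolding locally_equiconnected_def by (elim exE conjE) (rule that; assumption)
  then have \<theta>: "equiconnection P \<Omega> \<theta>"
    by unfold_locales auto
  interpret N: Metric_space N dN
    by fact
  interpret homotopy_setting X K N dN \<Omega> \<theta>
  proof (intro homotopy_setting.intro homotopy_setting_axioms.intro metric_mapping_space.intro)
    show "equiconnection N.mtopology \<Omega> \<theta>"
      using \<theta> N(3) by simp
    show "separable_space N.mtopology"
      using sep N(3) by simp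
  qed (use K N X metrizable_imp_normal_space metrizable_imp_Hausdorff_space in auto)
  have "idealistic (compact_open_topology X P) (homotopy_relation X P)"
    using paths.idealistic_E by (simp add: E_eq mtopology_mapd N(3))
  moreover have "Polish_space (compact_open_topology X P)"
    using Polish_mapping_space N(3) by simp
  moreover have "Borel_relation (compact_open_topology X P) (homotopy_relation X P)"
    unfolding N(3)
  proof (rule Borel_homotopy_relation)
    show "continuous_map (prod_topology N.mtopology N.mtopology) N.mtopology \<mu>" "continuous_map N.mtopology N.mtopology z" "e \<in> N"
      using \<mu> z(1) e N(3) by simp_all
    show "homotopic_with (\<lambda>_. True) X N.mtopology f g \<longleftrightarrow>
        homotopic_with (\<lambda>_. True) X N.mtopology (\<lambda>x. \<mu> (f x, z (g x))) (\<lambda>_. e)"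
      if "continuous_map X N.mtopology f" "continuous_map X N.mtopology g" for f g
      using homotopic_iff_difference_null[OF \<mu> e z(1) assoc unit z(2,3), of X f g] that N(3) by simp
  qed
  ultimately show ?thesis
    by (simp add: topspace_compact_open_topology equiv_homotopy_relation)
qed

end
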